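(* Let $K$ be an imaginary quadratic number field and let $D\in\mathbb{N}-\{0\}$. The set of $\Gamma_K$-conjugacy classes of maximal nonelementary $\mathbb{C}$-Fuchsian subgroups of $\Gamma_K$ with discriminant $D$ is finite and nonempty. Moreover, every maximal nonelementary $\mathbb{C}$-Fuchsian subgroup of $\Gamma_K$ with discriminant $D$ is commensurable up to conjugacy in $\mathrm{PSU}_h$ with $\Gamma_{K,2D}$.
   Context: Let $h$ be the Hermitian form $h(z_0,z_1,z_2)=-z_0\overline{z_2}-z_2\overline{z_0}+|z_1|^2$ on $\mathbb{C}^3$ (signature $(1,2)$), with associated Hermitian product $\langle\cdot,\cdot\rangle$. Let $\mathrm{SU}_h=\{g\in\mathrm{SL}_3(\mathbb{C}): h\circ g=h\}$ and $\mathrm{PSU}_h=\mathrm{SU}_h/(\mathbb{U}_3\,\mathrm{Id})$ where $\mathbb{U}_3$ is the group of cube roots of unity; it acts projectively on $\mathbb{P}_2(\mathbb{C})$. A point $[z]\in\mathbb{P}_2(\mathbb{C})$ is negative/null/positive if $h(z)<0$, $=0$, $>0$. The complex hyperbolic plane $\mathbb{H}^2_\mathbb{C}$ is the set of negative points. A complex geodesic is the intersection of $\mathbb{H}^2_\mathbb{C}$ with a complex projective line meeting it. Let $K$ be an imaginary quadratic field with ring of integers $\mathcal{O}_K$; the Picard modular group $\Gamma_K=\mathrm{PSU}_h(\mathcal{O}_K)$ is the image in $\mathrm{PSU}_h$ of the matrices of $\mathrm{SU}_h$ with entries in $\mathcal{O}_K$. A $\mathbb{C}$-Fuchsian subgroup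 of $\Gamma_K$ is the intersection of $\Gamma_K$ with the image of a Lie group embedding of $\mathrm{PSL}_2(\mathbb{R})$ into $\mathrm{PSU}_h$ preserving a complex projective line meeting $\mathbb{H}^2_\mathbb{C}$ (equivalently, a discrete subgroup preserving a complex geodesic and inducing parallel transport on its unit normal bundle). It is nonelementary if it is not virtually cyclic; "maximal" means maximal for inclusion among nonelementary $\mathbb{C}$-Fuchsian subgroups of $\Gamma_K$. A nonelementary $\mathbb{C}$-Fuchsian subgroup $\Gamma'$ of $\Gamma_K$ fixes a unique point of $\mathbb{P}_2(K)$; write it $[z_0:z_1:z_2]$ with $z_0,z_1,z_2\in\mathcal{O}_K$ relatively prime; the discriminant of $\Gamma'$ is the positive integer $\Delta_{\Gamma'}=h(z_0,z_1,z_2)$ (independent of choices). For $D\in\mathbb{N}-\{0\}$, $\Gamma_{K,D}=\mathrm{Stab}_{\Gamma_K}[-D:0:1]$. Two subgroups $\Gamma,\Gamma'$ are commensurable if $\Gamma\cap\Gamma'$ has finite index in both, and commensurable up to conjugacy in $\mathrm{PSU}_h$ if there is $g\in\mathrm{PSU}_h$ with $g\Gamma g^{-1}$ and $\Gamma'$ commensurable.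
   Formalization: C-Fuchsian subgroups use embeddings of SL_2(R), since PSL_2(R) has no embedding preserving such a line; "has discriminant D" means some representative of the fixed point with only unit common divisors has h = D, as the value can depend on the choice when the class number exceeds 1. *)

theory Defs
  imports
    "HOL-Analysis.Analysis"
    "HOL-Algebra.Coset"
    "HOL-Algebra.Generated_Groups"
    "HOL-Computational_Algebra.Polynomial"
begin

section \<open>Imaginary quadratic fields, as subfields of the complex numbers\<close>

lemma rat_vector_space_complex: "vector_space (\<lambda>(q::rat) (z::complex). of_rat q * z)"
  by unfold_locales (simp_all add: algebra_simps of_rat_add of_rat_mult)

definition imaginary_quadratic_field :: "complex set \<Rightarrow> bool" where
  "imaginary_quadratic_field K \<longleftrightarrow>
     0 \<in> K \<and> 1 \<in> K \<and>
     (\<forall>x\<in>K. \<forall>y\<in>K. x + y \<in> K \<and> x - y \<in> K \<and> x * y \<in> K) \<and>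
     (\<forall>x\<in>K. inverse x \<in> K) \<and>
     vector_space.dim (\<lambda>(q::rat) (z::complex). of_rat q * z) K = 2 \<and>
     \<not> K \<subseteq> \<real>"

definition ring_of_integers :: "complex set \<Rightarrow> complex set" where
  "ring_of_integers K = {x \<in> K. algebraic_int x}"

text \<open>
  Relatively prime: every common divisor in the ring of integers is a unit of it.
\<close>

definition relatively_prime :: "complex set \<Rightarrow> complex^3 \<Rightarrow> bool" where
  "relatively_prime K z \<longleftrightarrow>
     (\<forall>c \<in> ring_of_integers K.
        (\<forall>i. \<exists>w \<in> ring_of_integers K. z $ i = c * w) \<longrightarrow>
        (\<exists>u \<in> ring_of_integers K. c * u = 1))"


section \<open>The Hermitian form and the projective unitary group\<close>

text \<open>
  The coordinates \<open>z\<^sub>0, z\<^sub>1, z\<^sub>2\<close> of the mathematics are \<open>z $ 1, z $ 2, z $ 3\<close>.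
  The sum under \<^term>\<open>Re\<close> is a real number, so taking the real part only changes the type.
\<close>

definition herm :: "complex^3 \<Rightarrow> real" where
  "herm z = Re (- (z $ 1) * cnj (z $ 3) - (z $ 3) * cnj (z $ 1)) + (cmod (z $ 2))\<^sup>2"

definition SU_h :: "(complex^3^3) monoid" where
  "SU_h = \<lparr>carrier = {A. det A = 1 \<and> (\<forall>z. herm (A *v z) = herm z)},
           monoid.mult = (**), one = mat 1\<rparr>"

definition U3 :: "(complex^3^3) set" where
  "U3 = {mat \<omega> | \<omega>. \<omega> ^ 3 = 1}"

definition PSU_h :: "(complex^3^3) set monoid" where
  "PSU_h = SU_h Mod U3"

text \<open>
  The quotient topology. The union of a set of cosets is its preimage under the canonical
  projection.
\<close>

definition PSU_h_topology :: "(complex^3^3) set topology" where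
  "PSU_h_topology =
     topology (\<lambda>U. U \<subseteq> carrier PSU_h \<and> openin (top_of_set (carrier SU_h)) (\<Union>U))"


section \<open>The projective plane and the complex hyperbolic plane\<close>

text \<open>
  A point of the projective plane is the set of its homogeneous coordinate vectors.
\<close>

definition proj :: "complex^3 \<Rightarrow> (complex^3) set" where
  "proj z = {c *s z | c. c \<noteq> 0}"

definition P2 :: "complex set \<Rightarrow> (complex^3) set set" where
  "P2 K = {proj z | z. z \<noteq> 0 \<and> (\<forall>i. z $ i \<in> K)}"

definition H2C :: "(complex^3) set set" where
  "H2C = {proj z | z. herm z < 0}"

definition projective_line :: "(complex^3) set set \<Rightarrow> bool" where
  "projective_line L \<longleftrightarrow> (\<exists>V. vec.subspace V \<and> vec.dim V = 2 \<and> L = proj ` (V - {0}))"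

text \<open>
  The projective action. All representatives of an element of \<^term>\<open>PSU_h\<close> differ by scalars,
  hence act in the same way on points.
\<close>

definition act :: "(complex^3^3) set \<Rightarrow> (complex^3) set \<Rightarrow> (complex^3) set" where
  "act g p = {A *v v | A v. A \<in> g \<and> v \<in> p}"


section \<open>Picard modular groups\<close>

definition Picard :: "complex set \<Rightarrow> (complex^3^3) set set" where
  "Picard K = {U3 #>\<^bsub>SU_h\<^esub> A | A. A \<in> carrier SU_h \<and> (\<forall>i j. A $ i $ j \<in> ring_of_integers K)}"

definition Picard_stab :: "complex set \<Rightarrow> nat \<Rightarrow> (complex^3^3) set set" where
  "Picard_stab K D =
     {g \<in> Picard K. act g (proj (vector [- of_nat D, 0, 1])) = proj (vector [- of_nat D, 0, 1])}"


section \<open>Subgroups up to finite index and conjugacy\<close>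

definition finite_index :: "('a, 'b) monoid_scheme \<Rightarrow> 'a set \<Rightarrow> 'a set \<Rightarrow> bool" where
  "finite_index G H A \<longleftrightarrow> subgroup H (G\<lparr>carrier := A\<rparr>) \<and> finite (rcosets\<^bsub>G\<lparr>carrier := A\<rparr>\<^esub> H)"

definition virtually_cyclic :: "('a, 'b) monoid_scheme \<Rightarrow> 'a set \<Rightarrow> bool" where
  "virtually_cyclic G A \<longleftrightarrow> (\<exists>a\<in>A. finite_index G (generate G {a}) A)"

definition conjugate :: "('a, 'b) monoid_scheme \<Rightarrow> 'a \<Rightarrow> 'a set \<Rightarrow> 'a set" where
  "conjugate G g A = (\<lambda>x. g \<otimes>\<^bsub>G\<^esub> x \<otimes>\<^bsub>G\<^esub> inv\<^bsub>G\<^esub> g) ` A"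

definition commensurable :: "('a, 'b) monoid_scheme \<Rightarrow> 'a set \<Rightarrow> 'a set \<Rightarrow> bool" where
  "commensurable G A B \<longleftrightarrow> finite_index G (A \<inter> B) A \<and> finite_index G (A \<inter> B) B"

definition commensurable_up_to_conjugacy ::
    "('a, 'b) monoid_scheme \<Rightarrow> 'a set \<Rightarrow> 'a set \<Rightarrow> bool" where
  "commensurable_up_to_conjugacy G A B \<longleftrightarrow>
     (\<exists>g \<in> carrier G. commensurable G (conjugate G g A) B)"


section \<open>C-Fuchsian subgroups\<close>

text \<open>
  The source group of the embeddings is \<open>SL\<^sub>2(\<real>)\<close>. The three-dimensional simple Lie
  subgroups of \<^term>\<open>PSU_h\<close> preserving a complex projective line that meets the complex hyperbolic
  plane are the images of the groups \<open>SU(1,1)\<close> fixing a positive vector. The element of such a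
  group acting as \<open>-1\<close> on the orthogonal plane and as \<open>1\<close> on the fixed vector is not a scalar,
  so the group is a copy of \<open>SL\<^sub>2(\<real>)\<close>, and there is no embedding of the quotient
  \<open>PSL\<^sub>2(\<real>)\<close> preserving such a line.

  Continuous homomorphisms of Lie groups are smooth, and injective ones are immersions, so a
  Lie group embedding is a homomorphism that is a homeomorphism onto its image.
\<close>

definition SL2R :: "(real^2^2) monoid" where
  "SL2R = \<lparr>carrier = {A. det A = 1}, monoid.mult = (**), one = mat 1\<rparr>"

definition Lie_group_embedding :: "(real^2^2 \<Rightarrow> (complex^3^3) set) \<Rightarrow> bool" where
  "Lie_group_embedding \<phi> \<longleftrightarrow>
     \<phi> \<in> hom SL2R PSU_h \<and> embedding_map (top_of_set (carrier SL2R)) PSU_h_topology \<phi>"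

definition C_Fuchsian :: "complex set \<Rightarrow> (complex^3^3) set set \<Rightarrow> bool" where
  "C_Fuchsian K \<Gamma> \<longleftrightarrow>
     (\<exists>\<phi> L. Lie_group_embedding \<phi> \<and> projective_line L \<and> L \<inter> H2C \<noteq> {} \<and>
            (\<forall>g \<in> \<phi> ` carrier SL2R. act g ` L = L) \<and>
            \<Gamma> = Picard K \<inter> \<phi> ` carrier SL2R)"

definition nonelementary_C_Fuchsian :: "complex set \<Rightarrow> (complex^3^3) set set \<Rightarrow> bool" where
  "nonelementary_C_Fuchsian K \<Gamma> \<longleftrightarrow> C_Fuchsian K \<Gamma> \<and> \<not> virtually_cyclic PSU_h \<Gamma>"

definition maximal_nonelementary_C_Fuchsian ::
    "complex set \<Rightarrow> (complex^3^3) set set \<Rightarrow> bool" where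
  "maximal_nonelementary_C_Fuchsian K \<Gamma> \<longleftrightarrow>
     nonelementary_C_Fuchsian K \<Gamma> \<and>
     (\<forall>\<Gamma>'. nonelementary_C_Fuchsian K \<Gamma>' \<and> \<Gamma> \<subseteq> \<Gamma>' \<longrightarrow> \<Gamma>' = \<Gamma>)"

text \<open>
  The discriminant, as a relation: \<open>z\<close> is a relatively prime integral representative of the
  unique fixed point in the projective plane over \<open>K\<close>. When \<open>K\<close> has class number one, \<open>z\<close> is
  unique up to units and the relation is single-valued. In general every point has such a
  representative, but representatives of one point may differ by more than a unit.
\<close>

definition has_discriminant :: "complex set \<Rightarrow> (complex^3^3) set set \<Rightarrow> nat \<Rightarrow> bool" where
  "has_discriminant K \<Gamma> D \<longleftrightarrow>
     (\<exists>z. (\<forall>i. z $ i \<in> ring_of_integers K) \<and> relatively_prime K z \<and>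
          {p \<in> P2 K. \<forall>g\<in>\<Gamma>. act g p = p} = {proj z} \<and> herm z = real D)"

definition max_C_Fuchsian_of_discriminant ::
    "complex set \<Rightarrow> nat \<Rightarrow> (complex^3^3) set set set" where
  "max_C_Fuchsian_of_discriminant K D =
     {\<Gamma>. maximal_nonelementary_C_Fuchsian K \<Gamma> \<and> has_discriminant K \<Gamma> D}"

definition Picard_conjugacy :: "complex set \<Rightarrow> (complex^3^3) set set rel" where
  "Picard_conjugacy K = {(\<Gamma>, \<Gamma>'). \<exists>g \<in> Picard K. \<Gamma>' = conjugate PSU_h g \<Gamma>}"


section \<open>Well-formedness of the groups and of the topology\<close>

lemma matrix_inv_det_1:
  fixes A :: "'a::field^'n^'n"
  assumes "det A = 1"
  shows "matrix_inv A ** A = mat 1" "A ** matrix_inv A = mat 1" "det (matrix_inv A) = 1"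
proof -
  have "invertible A" using assms by (simp add: invertible_det_nz)
  then have "A ** matrix_inv A = mat 1 \<and> matrix_inv A ** A = mat 1"
    unfolding invertible_def matrix_inv_def by (rule someI_ex)
  then show 1: "matrix_inv A ** A = mat 1" and "A ** matrix_inv A = mat 1"
    by simp_all
  have "det (matrix_inv A) * det A = 1"
    by (metis 1 det_I det_mul)
  then show "det (matrix_inv A) = 1" using assms by simp
qed

lemma group_SL2R: "group SL2R"
proof (rule groupI)
  fix A assume "A \<in> carrier SL2R"
  then show "\<exists>B\<in>carrier SL2R. B \<otimes>\<^bsub>SL2R\<^esub> A = \<one>\<^bsub>SL2R\<^esub>"
    using matrix_inv_det_1[of A] by (auto simp: SL2R_def)
qed (auto simp: SL2R_def det_mul matrix_mul_assoc)

lemma group_SU_h: "group SU_h"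
proof (rule groupI)
  fix A assume A: "A \<in> carrier SU_h"
  then have d: "det A = 1" and p: "\<And>z. herm (A *v z) = herm z" by (auto simp: SU_h_def)
  have "herm (matrix_inv A *v z) = herm z" for z
    using p[of "matrix_inv A *v z"] matrix_inv_det_1(2)[OF d]
    by (simp add: matrix_vector_mul_assoc)
  then have "matrix_inv A \<in> carrier SU_h"
    using matrix_inv_det_1[OF d] by (simp add: SU_h_def)
  then show "\<exists>B\<in>carrier SU_h. B \<otimes>\<^bsub>SU_h\<^esub> A = \<one>\<^bsub>SU_h\<^esub>"
    using matrix_inv_det_1(1)[OF d] by (auto simp: SU_h_def)
qed (auto simp: SU_h_def det_mul matrix_mul_assoc simp flip: matrix_vector_mul_assoc)

lemma mat_mult_vec: "mat c *v (v::complex^3) = c *s v"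
  by (simp add: vec_eq_iff matrix_vector_mult_def mat_def if_distrib[of "\<lambda>x. x * _"] cong: if_cong)

lemma mat_mult_mat: "mat c ** (mat d :: complex^3^3) = mat (c * d)"
  by (simp add: vec_eq_iff matrix_matrix_mult_def mat_def if_distrib[of "\<lambda>x. x * _"] cong: if_cong)

lemma mat_commute: "mat c ** (A :: complex^3^3) = A ** mat c"
  by (simp add: vec_eq_iff matrix_matrix_mult_def mat_def if_distrib[of "\<lambda>x. x * _"]
      if_distrib[of "\<lambda>x. _ * x"] mult.commute cong: if_cong)

lemma herm_scale: "herm (c *s z) = (cmod c)\<^sup>2 * herm z"
  unfolding herm_def cmod_power2 by (simp add: power2_eq_square algebra_simps)

lemma U3_subset: "U3 \<subseteq> carrier SU_h"
proof
  fix A assume "A \<in> U3"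
  then obtain w where w: "A = mat w" "w ^ 3 = 1" by (auto simp: U3_def)
  have "cmod w ^ 3 = 1" using w(2) by (metis norm_one norm_power)
  then have "cmod w = 1"
    using power_eq_imp_eq_base[of "cmod w" 3 1] by simp
  moreover have "det A = 1"
    using w by (simp add: det_3 mat_def power3_eq_cube)
  ultimately show "A \<in> carrier SU_h"
    by (simp add: SU_h_def w(1) mat_mult_vec herm_scale)
qed

lemma U3_normal: "U3 \<lhd> SU_h"
proof -
  interpret group SU_h by (rule group_SU_h)
  have one: "\<one>\<^bsub>SU_h\<^esub> \<in> U3" by (auto simp: U3_def SU_h_def intro: exI[of _ 1])
  have sg: "subgroup U3 SU_h"
  proof (rule subgroupI)
    show "U3 \<noteq> {}" using one by auto
    show "a \<otimes>\<^bsub>SU_h\<^esub> b \<in> U3" if "a \<in> U3" "b \<in> U3" for a b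
      using that by (fastforce simp: U3_def SU_h_def mat_mult_mat power_mult_distrib)
    fix a assume a: "a \<in> U3"
    then obtain w where w: "a = mat w" "w ^ 3 = 1" by (auto simp: U3_def)
    then have "mat (w ^ 2) \<in> U3" by (auto simp: U3_def simp flip: power_mult)
         (metis (no_types) mult.commute power_mult power_one w(2))
    moreover have "mat (w ^ 2) \<otimes>\<^bsub>SU_h\<^esub> a = \<one>\<^bsub>SU_h\<^esub>"
      using w by (simp add: SU_h_def mat_mult_mat power2_eq_square power3_eq_cube)
    ultimately show "inv\<^bsub>SU_h\<^esub> a \<in> U3"
      using a U3_subset inv_equality[of "mat (w ^ 2)" a] by (simp add: subset_iff)
  qed (rule U3_subset)
  show ?thesis
  proof (rule normalI[OF sg], rule ballI)
    fix A assume "A \<in> carrier SU_h"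
    show "U3 #>\<^bsub>SU_h\<^esub> A = A <#\<^bsub>SU_h\<^esub> U3"
      unfolding r_coset_def l_coset_def by (auto simp: SU_h_def U3_def mat_commute)
  qed
qed

lemma group_PSU_h: "group PSU_h"
  unfolding PSU_h_def by (rule normal.factorgroup_is_group[OF U3_normal])

lemma openin_PSU_h_topology:
  "openin PSU_h_topology U \<longleftrightarrow>
     U \<subseteq> carrier PSU_h \<and> openin (top_of_set (carrier SU_h)) (\<Union>U)"
proof -
  interpret normal U3 SU_h by (rule U3_normal)
  have "istopology (\<lambda>U. U \<subseteq> carrier PSU_h \<and> openin (top_of_set (carrier SU_h)) (\<Union>U))"
    unfolding istopology_def
  proof (intro conjI allI impI)
    fix S T
    assume S: "S \<subseteq> carrier PSU_h \<and> openin (top_of_set (carrier SU_h)) (\<Union>S)"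
      and T: "T \<subseteq> carrier PSU_h \<and> openin (top_of_set (carrier SU_h)) (\<Union>T)"
    show "S \<inter> T \<subseteq> carrier PSU_h" using S by blast
    have "\<Union>(S \<inter> T) = \<Union>S \<inter> \<Union>T"
    proof
      show "\<Union>S \<inter> \<Union>T \<subseteq> \<Union>(S \<inter> T)"
      proof
        fix x assume "x \<in> \<Union>S \<inter> \<Union>T"
        then obtain X Y where XY: "X \<in> S" "Y \<in> T" "x \<in> X" "x \<in> Y" by blast
        then have "X \<in> rcosets\<^bsub>SU_h\<^esub> U3" "Y \<in> rcosets\<^bsub>SU_h\<^esub> U3"
          using S T by (auto simp: PSU_h_def FactGroup_def)
        then have "X = Y"
          using XY rcos_disjoint[OF is_subgroup] by (auto simp: pairwise_def disjnt_def)
        then show "x \<in> \<Union>(S \<inter> T)" using XY by blast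
      qed
    qed blast
    then show "openin (top_of_set (carrier SU_h)) (\<Union>(S \<inter> T))"
      using S T by (metis openin_Int)
  next
    fix F assume F: "\<forall>S\<in>F. S \<subseteq> carrier PSU_h \<and> openin (top_of_set (carrier SU_h)) (\<Union>S)"
    show "\<Union>F \<subseteq> carrier PSU_h" using F by blast
    have "\<Union>(\<Union>F) = \<Union>(Union ` F)" by blast
    then show "openin (top_of_set (carrier SU_h)) (\<Union>(\<Union>F))"
      using F by (metis (mono_tags, lifting) imageE openin_Union)
  qed
  then show ?thesis by (simp add: PSU_h_topology_def topology_inverse')
qed

end

theory Submission
  imports Defs "HOL-Analysis.Kronecker_Approximation_Theorem"
begin

text \<open>
  A homomorphic image of \<open>SL\<^sub>2(\<real>)\<close> preserving a complex geodesic fixes the positive vector \<open>v\<close> orthogonal to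
  it: the cube of the eigenvalue on \<open>v\<close> is a character of a perfect group. Conversely the group \<open>Gv v\<close> of all
  elements fixing \<open>v\<close> is such an image. Hence the maximal subgroups of discriminant \<open>D\<close> are the groups
  \<open>Gam z = Picard K \<inter> Gv z\<close> with \<open>z\<close> integral of norm \<open>D\<close>.

  Commensurability: an explicit \<open>K\<close>-rational isometry maps \<open>2 z\<close> to \<open>\<plusminus> (- 2 D, 0, 1)\<close>, and conjugation by it
  preserves integrality on a congruence subgroup.

  Nonemptiness: solutions of a Pell equation give two hyperbolic elements of \<open>Gam z\<close> whose powers do not commute
  and whose only common fixed point is \<open>z\<close>.

  Finiteness: an integral \<open>z\<close> of norm \<open>D\<close> is completed by an orthogonal integral \<open>x\<close> of bounded nonzero norm and
  by their cross product to a frame, and there are finitely many such frames up to integral isometries.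
\<close>

section \<open>Arithmetic of imaginary quadratic fields\<close>

text \<open>The ring of integers of \<open>K\<close> need not be principal, so there is neither a
  Euclidean division nor a basis of the integral vectors adapted to \<open>z\<close>. Dirichlet
  approximation with a bounded multiplier \<open>j\<close> replaces the division, a factorial
  absorbs the multipliers, and orthogonal integral frames whose norms are bounded replace the bases.
  The number 2 D comes from h(-2 D, 0, 1) = 4 D, which is D times the square of a rational number:
  thus 2 z and (-2 D, 0, 1) have equal norms and are related by an isometry over \<open>K\<close>.
  The determinant of that isometry may have no cube root in \<open>K\<close>, which is harmless
  because scalars cancel in a conjugation. An element of \<open>PSU_h\<close> has three
  representatives, and the integral one may differ from the one fixing a given vector; hence the
  cube roots of unity that accompany most statements. The two hyperbolic elements also give
  maximality: a larger group fixes a positive vector, which can only lie on their common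
  eigenline.\<close>

lemma Rats_bounded_denominators_imp_Ints:
  fixes N :: "'a::field_char_0"
  assumes "N \<in> \<rat>" "c > 0" and den: "\<And>k. of_int c * N ^ k \<in> \<int>"
  shows "N \<in> \<int>"
proof -
  obtain a b where ab: "b > 0" "coprime a b" "N = of_int a / of_int b"
    using assms(1) by (auto elim: Rats_cases')
  \<comment> \<open>For N = a/b in lowest terms, the power \<open>b ^ k\<close> divides c a^k and
    therefore c. If b were at least 2, the exponent k = c would already give a power exceeding
    c.\<close>
  have dvd: "b ^ k dvd c" for k
  proof -
    obtain m where "of_int c * N ^ k = of_int m"
      using den[of k] by (auto elim: Ints_cases)
    then have "of_int (c * a ^ k) = (of_int (m * b ^ k) :: 'a)"
      using ab(1) by (simp add: ab(3) power_divide field_simps)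
    then have "c * a ^ k = m * b ^ k" by (simp only: of_int_eq_iff)
    then have "b ^ k dvd c * a ^ k" by simp
    then show ?thesis
      using ab(2) by (meson coprime_commute coprime_dvd_mult_left_iff coprime_power_left_iff coprime_power_right_iff)
  qed
  have "b = 1"
  proof (rule ccontr)
    assume "b \<noteq> 1"
    then have "b \<ge> 2" using ab(1) by simp
    then have "2 ^ nat c \<le> b ^ nat c" by (intro power_mono) auto
    also have "\<dots> \<le> c" using dvd assms(2) by (intro zdvd_imp_le)
    finally have "int (2 ^ nat c) \<le> int (nat c)" using assms(2) by simp
    then show False using less_exp[of "nat c"] by linarith
  qed
  then show ?thesis using ab(3) by simp
qed

text \<open>The numbers a and b are the roots of X^2 - (a + b) X + a b, so a rational a is an
  algebraic integer, hence an integer. This extracts integrality from two conditions that are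
  symmetric in a and b.\<close>

lemma Ints_of_sum_product:
  fixes a b :: "'a::field_char_0"
  assumes "a \<in> \<rat>" "a + b \<in> \<int>" "a * b \<in> \<int>"
  shows "a \<in> \<int>"
proof (rule rational_algebraic_int_is_int[OF _ assms(1)])
  have "- (a + b) \<in> \<int>" by (rule Ints_minus[OF assms(2)])
  then have "- a - b \<in> \<int>" by simp
  then show "algebraic_int a"
    by (intro algebraic_int.intros[of "[:a * b, - (a + b), 1:]"])
       (use assms in \<open>auto simp: coeff_pCons algebra_simps split: nat.splits\<close>)
qed

text \<open>Here \<open>d\<close> is any positive integer with K = Q(s), not necessarily squarefree,
  so Z + Z s may have index greater than two in the ring of integers. Arguments that use coordinates
  with respect to 1 and \<open>s\<close> allow for denominators instead of distinguishing residues
  of \<open>d\<close> modulo 4.\<close>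

locale imaginary_quadratic =
  fixes K :: "complex set" and s :: complex and d :: nat
  assumes s_sq: "s ^ 2 = - of_nat d" and d_pos: "d > 0"
    and K_iff: "x \<in> K \<longleftrightarrow> (\<exists>p\<in>\<rat>. \<exists>q\<in>\<rat>. x = p + q * s)"
begin

lemma s_imaginary: "Re s = 0" "Im s \<noteq> 0" "cnj s = - s" "s * s = - of_nat d" "s \<noteq> 0"
proof -
  have "Re (s ^ 2) = - real d" "Im (s ^ 2) = 0" by (simp_all add: s_sq)
  then have *: "(Re s)\<^sup>2 - (Im s)\<^sup>2 = - real d" "Re s * Im s = 0"
    by (auto simp: power2_eq_square)
  show I: "Im s \<noteq> 0"
  proof
    assume "Im s = 0"
    then have "(Re s)\<^sup>2 = - real d" using * by simp
    then show False using d_pos by (smt (verit) of_nat_0_less_iff zero_le_power2)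
  qed
  then show R: "Re s = 0" using * by simp
  show "cnj s = - s" by (simp add: complex_eq_iff R)
  show "s * s = - of_nat d" using s_sq by (simp add: power2_eq_square)
  show "s \<noteq> 0" using I by auto
qed

lemma cnj_Rats: "x \<in> \<rat> \<Longrightarrow> cnj x = x"
  by (auto elim!: Rats_cases')

lemma K_Rats: "x \<in> \<rat> \<Longrightarrow> x \<in> K"
  unfolding K_iff by (rule bexI[of _ x], rule bexI[of _ 0]) auto

lemma K_0 [simp]: "0 \<in> K" and K_1 [simp]: "1 \<in> K" and K_s [simp]: "s \<in> K"
  and K_of_int [simp]: "of_int i \<in> K" and K_of_nat [simp]: "of_nat n \<in> K"
  and K_numeral [simp]: "numeral m \<in> K"
proof -
  show "s \<in> K" unfolding K_iff by (rule bexI[of _ 0], rule bexI[of _ 1]) auto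
qed (auto intro: K_Rats)

lemma K_add [intro, simp]: assumes "x \<in> K" "y \<in> K" shows "x + y \<in> K"
proof -
  obtain p q p' q' where "p \<in> \<rat>" "q \<in> \<rat>" "x = p + q * s" "p' \<in> \<rat>" "q' \<in> \<rat>" "y = p' + q' * s"
    using assms by (auto simp: K_iff)
  then show ?thesis unfolding K_iff
    by (intro bexI[of _ "p + p'"] bexI[of _ "q + q'"]) (auto simp: algebra_simps)
qed

lemma K_mult [intro, simp]: assumes "x \<in> K" "y \<in> K" shows "x * y \<in> K"
proof -
  obtain p q p' q' where "p \<in> \<rat>" "q \<in> \<rat>" "x = p + q * s" "p' \<in> \<rat>" "q' \<in> \<rat>" "y = p' + q' * s"
    using assms by (auto simp: K_iff)
  moreover have "(p + q * s) * (p' + q' * s) = p * p' + q * q' * (s * s) + (p * q' + q * p') * s"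
    by (simp add: algebra_simps)
  ultimately show ?thesis unfolding K_iff s_imaginary
    by (intro bexI[of _ "p * p' - of_nat d * q * q'"] bexI[of _ "p * q' + q * p'"]) auto
qed

lemma K_cnj [intro, simp]: assumes "x \<in> K" shows "cnj x \<in> K"
proof -
  obtain p q where "p \<in> \<rat>" "q \<in> \<rat>" "x = p + q * s" using assms by (auto simp: K_iff)
  then show ?thesis unfolding K_iff
    by (intro bexI[of _ p] bexI[of _ "-q"]) (auto simp: cnj_Rats s_imaginary)
qed

lemma K_minus [intro, simp]: "x \<in> K \<Longrightarrow> - x \<in> K"
  using K_mult[of "-1" x] K_Rats[of "-1"] by simp

lemma K_diff [intro, simp]: "x \<in> K \<Longrightarrow> y \<in> K \<Longrightarrow> x - y \<in> K"
  using K_add[of x "- y"] by simp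

lemma K_trace_norm_Rats:
  assumes "x \<in> K" shows "x + cnj x \<in> \<rat>" "x * cnj x \<in> \<rat>"
proof -
  obtain p q where pq: "p \<in> \<rat>" "q \<in> \<rat>" "x = p + q * s" using assms by (auto simp: K_iff)
  have c: "cnj p = p" "cnj q = q" using pq cnj_Rats by auto
  have "x + cnj x = 2 * p" by (simp add: pq(3) c s_imaginary)
  then show "x + cnj x \<in> \<rat>" using pq(1) by (metis Rats_mult Rats_number_of)
  have "x * cnj x = p * p - q * q * (s * s)"
    by (simp add: pq(3) c s_imaginary(3) algebra_simps)
  then show "x * cnj x \<in> \<rat>" using pq by (simp add: s_imaginary(4))
qed

lemma K_inverse [intro, simp]: assumes "x \<in> K" shows "inverse x \<in> K"
proof (cases "x = 0")
  case False
  then have "inverse x = inverse (x * cnj x) * cnj x" by simp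
  moreover have "inverse (x * cnj x) \<in> K" by (intro K_Rats Rats_inverse K_trace_norm_Rats assms)
  ultimately show ?thesis using assms by (metis K_cnj K_mult)
qed auto

lemma K_divide [intro, simp]: "x \<in> K \<Longrightarrow> y \<in> K \<Longrightarrow> x / y \<in> K"
  by (simp add: divide_inverse)

text \<open>The order Z + Z s, used as the lattice with respect to which denominators of elements of
  \<open>K\<close> are measured.\<close>

definition Zs :: "complex set" where "Zs = {of_int i + of_int j * s | i j. True}"

lemma Zs_iff: "x \<in> Zs \<longleftrightarrow> (\<exists>i\<in>\<int>. \<exists>j\<in>\<int>. x = i + j * s)"
  unfolding Zs_def Ints_def by blast

lemma Zs_add: assumes "x \<in> Zs" "y \<in> Zs" shows "x + y \<in> Zs"
proof -
  obtain i j i' j' where "i \<in> \<int>" "j \<in> \<int>" "x = i + j * s" "i' \<in> \<int>" "j' \<in> \<int>" "y = i' + j' * s"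
    using assms by (auto simp: Zs_iff)
  then show ?thesis unfolding Zs_iff
    by (intro bexI[of _ "i + i'"] bexI[of _ "j + j'"]) (auto simp: algebra_simps)
qed

lemma Zs_mult_Ints: assumes "n \<in> \<int>" "x \<in> Zs" shows "n * x \<in> Zs"
proof -
  obtain i j where "i \<in> \<int>" "j \<in> \<int>" "x = i + j * s" using assms by (auto simp: Zs_iff)
  then show ?thesis using assms(1) unfolding Zs_iff
    by (intro bexI[of _ "n * i"] bexI[of _ "n * j"]) (auto simp: algebra_simps)
qed

lemma Zs_0: "0 \<in> Zs"
  unfolding Zs_iff by (intro bexI[of _ 0]) auto

lemma Zs_sum: "(\<And>i. i \<in> A \<Longrightarrow> f i \<in> Zs) \<Longrightarrow> sum f A \<in> Zs"
proof (induction A rule: infinite_finite_induct)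
  case (insert x F)
  then show ?case by (simp add: Zs_add)
qed (simp_all add: Zs_0)

lemma Zs_norm_Ints: assumes "x \<in> Zs" shows "x * cnj x \<in> \<int>"
proof -
  obtain i j where ij: "i \<in> \<int>" "j \<in> \<int>" "x = i + j * s" using assms by (auto simp: Zs_iff)
  have "cnj i = i" "cnj j = j" using ij by (auto elim!: Ints_cases)
  then have "x * cnj x = i * i - j * j * (s * s)"
    using ij by (simp add: s_imaginary(3) algebra_simps)
  then show ?thesis using ij by (simp add: s_imaginary(4))
qed

lemma K_denominator: assumes "x \<in> K" obtains c :: int where "c > 0" "of_int c * x \<in> Zs"
proof -
  obtain p q where pq: "p \<in> \<rat>" "q \<in> \<rat>" "x = p + q * s" using assms by (auto simp: K_iff)
  obtain a b a' b' where ab: "b > 0" "p = of_int a / of_int b" "b' > 0" "q = of_int a' / of_int b'"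
    using pq(1,2) by (metis Rats_cases')
  have "of_int (b * b') * x = of_int (a * b') + of_int (a' * b) * s"
    using ab by (simp add: pq(3) field_simps)
  then have "of_int (b * b') * x \<in> Zs" unfolding Zs_def by blast
  then show ?thesis using that[of "b * b'"] ab by simp
qed

text \<open>A monic relation of degree n expresses every higher power through 1, x, ..., x^(n-1)
  with integral coefficients, so a common denominator of these n powers serves for all.\<close>

lemma algebraic_int_powers_bounded_denominator:
  assumes "x \<in> K" "algebraic_int x"
  obtains c :: int where "c > 0" "\<And>k. of_int c * x ^ k \<in> Zs"
proof -
  obtain p where p: "lead_coeff p = 1" "\<forall>i. coeff p i \<in> \<int>" "poly p x = 0"
    using assms(2) by (auto simp: algebraic_int.simps)
  define n where "n = degree p"
  have xk: "x ^ k \<in> K" for k by (induction k) (use assms(1) in auto)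
  have "\<exists>c>0. \<forall>k<m. of_int c * x ^ k \<in> Zs" for m :: nat
  proof (induction m)
    case 0
    show ?case by (rule exI[of _ 1]) auto
  next
    case (Suc m)
    then obtain c :: int where c: "c > 0" "\<And>k. k < m \<Longrightarrow> of_int c * x ^ k \<in> Zs" by auto
    obtain c' :: int where c': "c' > 0" "of_int c' * x ^ m \<in> Zs" using K_denominator[OF xk] by blast
    have "of_int (c * c') * x ^ k \<in> Zs" if "k < Suc m" for k
    proof (cases "k = m")
      case True
      then show ?thesis using Zs_mult_Ints[of "of_int c", OF _ c'(2)] by (simp add: mult.assoc)
    next
      case False
      then show ?thesis using Zs_mult_Ints[of "of_int c'", OF _ c(2)[of k]] that by (simp add: mult_ac)
    qed
    then show ?case using c c' by (intro exI[of _ "c * c'"]) auto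
  qed
  then obtain c :: int where c: "c > 0" "\<And>k. k < n \<Longrightarrow> of_int c * x ^ k \<in> Zs" by blast
  have "of_int c * x ^ k \<in> Zs" for k
  proof (induction k rule: less_induct)
    case (less k)
    show ?case
    proof (cases "k < n")
      case False
      have "0 = (\<Sum>i\<le>n. coeff p i * x ^ i)" using p(3) by (simp add: poly_altdef n_def)
      also have "{..n} = insert n {..<n}" by auto
      finally have "x ^ n = - (\<Sum>i<n. coeff p i * x ^ i)" using p(1) by (simp add: n_def add_eq_0_iff2 add_eq_0_iff)
      then have "x ^ k = - (\<Sum>i<n. coeff p i * x ^ i) * x ^ (k - n)"
        using False by (metis le_add_diff_inverse linorder_not_less power_add)
      also have "of_int c * \<dots> = (\<Sum>i<n. (- coeff p i) * (of_int c * x ^ (i + (k - n))))"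
        by (simp add: sum_distrib_left sum_distrib_right power_add mult_ac sum_negf)
      also have "\<dots> \<in> Zs"
        using False p(2) by (intro Zs_sum Zs_mult_Ints less) auto
      finally show ?thesis .
    qed (use c in auto)
  qed
  then show ?thesis using that c by blast
qed

text \<open>The norm is multiplicative: c x^k has norm c^2 N(x)^k, which is an integer. Hence all
  powers of the rational number N(x) have denominators dividing c^2.\<close>

lemma norm_Ints_of_bounded_denominator:
  assumes "x \<in> K" "c > 0" "\<And>k. of_int c * x ^ k \<in> Zs"
  shows "x * cnj x \<in> \<int>"
proof (rule Rats_bounded_denominators_imp_Ints)
  fix k
  have "of_int (c * c) * (x * cnj x) ^ k = (of_int c * x ^ k) * cnj (of_int c * x ^ k)"
    by (simp add: power_mult_distrib)
  then show "of_int (c * c) * (x * cnj x) ^ k \<in> \<int>" using Zs_norm_Ints[OF assms(3)] by metis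
qed (use K_trace_norm_Rats assms in auto)

abbreviation OK :: "complex set" where "OK \<equiv> ring_of_integers K"

text \<open>For an algebraic integer x both N(x) and N(1 + x) are integers, and the trace is N(1 +
  x) - 1 - N(x). Conversely x is a root of X^2 - tr(x) X + N(x). The criterion turns closure of
  \<open>OK\<close> under the ring operations into a computation with traces and norms.\<close>

lemma OK_iff: "x \<in> OK \<longleftrightarrow> x \<in> K \<and> x + cnj x \<in> \<int> \<and> x * cnj x \<in> \<int>"
proof
  assume "x \<in> OK"
  then have x: "x \<in> K" "algebraic_int x" by (auto simp: ring_of_integers_def)
  obtain c :: int where c: "c > 0" "\<And>k. of_int c * x ^ k \<in> Zs"
    using algebraic_int_powers_bounded_denominator[OF x] by blast
  have N: "x * cnj x \<in> \<int>" by (rule norm_Ints_of_bounded_denominator[OF x(1) c])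
  have "of_int c * (1 + x) ^ k \<in> Zs" for k
  proof -
    have "of_int c * (1 + x) ^ k = (\<Sum>i\<le>k. of_nat (k choose i) * (of_int c * x ^ i))"
      using binomial_ring[of x 1 k] by (simp add: add.commute sum_distrib_left mult_ac)
    then show ?thesis using c(2) by (simp add: Zs_sum Zs_mult_Ints)
  qed
  then have "(1 + x) * cnj (1 + x) \<in> \<int>"
    by (rule norm_Ints_of_bounded_denominator[rotated 2]) (use x c in auto)
  then have "(1 + x) * cnj (1 + x) - 1 - x * cnj x \<in> \<int>" using N by (metis Ints_1 Ints_diff)
  moreover have "(1 + x) * cnj (1 + x) - 1 - x * cnj x = x + cnj x" by (simp add: algebra_simps)
  ultimately show "x \<in> K \<and> x + cnj x \<in> \<int> \<and> x * cnj x \<in> \<int>" using x N by metis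
next
  assume x: "x \<in> K \<and> x + cnj x \<in> \<int> \<and> x * cnj x \<in> \<int>"
  then have "- (x + cnj x) \<in> \<int>" by (metis Ints_minus)
  then have "- x - cnj x \<in> \<int>" by simp
  then have "algebraic_int x"
    by (intro algebraic_int.intros[of "[:x * cnj x, - (x + cnj x), 1:]"])
       (use x in \<open>auto simp: coeff_pCons algebra_simps split: nat.splits\<close>)
  then show "x \<in> OK" using x by (simp add: ring_of_integers_def)
qed

lemma OK_imp_K: "x \<in> OK \<Longrightarrow> x \<in> K"
  by (simp add: OK_iff)

text \<open>The traces of x y and of x times the conjugate of y have the integral sum tr(x) tr(y)
  and an integral product, so \<open>Ints_of_sum_product\<close> applies to them.\<close>

lemma OK_trace_Ints:
  assumes x: "x \<in> OK" and y: "y \<in> OK"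
  shows "x * y + cnj (x * y) \<in> \<int>"
proof (rule Ints_of_sum_product)
  have sq: "u * u + cnj u * cnj u \<in> \<int>" if "u \<in> OK" for u
  proof -
    have "(u + cnj u) * (u + cnj u) - 2 * (u * cnj u) \<in> \<int>" using that unfolding OK_iff
      by (meson Ints_diff Ints_mult Ints_numeral)
    then show ?thesis by (simp add: algebra_simps)
  qed
  have "x * y + cnj (x * y) + (x * cnj y + cnj x * y) = (x + cnj x) * (y + cnj y)"
    by (simp add: algebra_simps)
  then show "x * y + cnj (x * y) + (x * cnj y + cnj x * y) \<in> \<int>"
    using x y by (simp add: OK_iff)
  have "(x * y + cnj (x * y)) * (x * cnj y + cnj x * y)
      = (x * x + cnj x * cnj x) * (y * cnj y) + (y * y + cnj y * cnj y) * (x * cnj x)"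
    by (simp add: algebra_simps)
  also have "\<dots> \<in> \<int>" using x y sq[OF x] sq[OF y] unfolding OK_iff by (meson Ints_add Ints_mult)
  finally show "(x * y + cnj (x * y)) * (x * cnj y + cnj x * y) \<in> \<int>" .
  show "x * y + cnj (x * y) \<in> \<rat>" using x y by (intro K_trace_norm_Rats) (auto simp: OK_iff)
qed

lemma OK_mult [intro, simp]: "x \<in> OK \<Longrightarrow> y \<in> OK \<Longrightarrow> x * y \<in> OK"
proof -
  assume xy: "x \<in> OK" "y \<in> OK"
  have "x * y * cnj (x * y) = (x * cnj x) * (y * cnj y)" by simp
  then show ?thesis using xy OK_trace_Ints[OF xy] unfolding OK_iff by (metis Ints_mult K_mult)
qed

lemma OK_cnj [intro, simp]: "x \<in> OK \<Longrightarrow> cnj x \<in> OK"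
  unfolding OK_iff by (simp add: add.commute mult.commute)

lemma OK_add [intro, simp]: "x \<in> OK \<Longrightarrow> y \<in> OK \<Longrightarrow> x + y \<in> OK"
proof -
  assume xy: "x \<in> OK" "y \<in> OK"
  have "(x + y) * cnj (x + y) = x * cnj x + y * cnj y + (x * cnj y + cnj (x * cnj y))"
    by (simp add: algebra_simps)
  also have "\<dots> \<in> \<int>" using xy OK_trace_Ints[OF xy(1) OK_cnj[OF xy(2)]] unfolding OK_iff by (meson Ints_add)
  finally have 1: "(x + y) * cnj (x + y) \<in> \<int>" .
  have "(x + y) + cnj (x + y) = (x + cnj x) + (y + cnj y)" by simp
  then have "(x + y) + cnj (x + y) \<in> \<int>" using xy unfolding OK_iff by (metis Ints_add)
  then show ?thesis using 1 xy unfolding OK_iff by auto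
qed

lemma OK_Ints: "x \<in> \<int> \<Longrightarrow> x \<in> OK"
  unfolding OK_iff by (auto elim!: Ints_cases)

lemma OK_0 [simp]: "0 \<in> OK" and OK_1 [simp]: "1 \<in> OK" and OK_s [simp]: "s \<in> OK"
  and OK_of_int [simp]: "of_int i \<in> OK" and OK_of_nat [simp]: "of_nat n \<in> OK"
  and OK_numeral [simp]: "numeral m \<in> OK"
proof -
  show "s \<in> OK" unfolding OK_iff by (simp add: s_imaginary)
qed (auto intro: OK_Ints)

lemma OK_minus [intro, simp]: "x \<in> OK \<Longrightarrow> - x \<in> OK"
  using OK_mult[of "-1" x] OK_Ints[of "-1"] by simp

lemma OK_diff [intro, simp]: "x \<in> OK \<Longrightarrow> y \<in> OK \<Longrightarrow> x - y \<in> OK"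
  using OK_add[of x "- y"] by simp

lemma OK_power [intro, simp]: "x \<in> OK \<Longrightarrow> x ^ n \<in> OK"
  by (induction n) auto

lemma OK_norm_Ints: assumes "x \<in> OK" shows "(cmod x)\<^sup>2 \<in> \<int>" "2 * Re x \<in> \<int>"
proof -
  have "complex_of_real ((cmod x)\<^sup>2) \<in> \<int>"
    using assms by (simp add: OK_iff complex_mult_cnj cmod_def)
  then show "(cmod x)\<^sup>2 \<in> \<int>" by (simp only: of_real_in_Ints_iff)
  have "complex_of_real (2 * Re x) \<in> \<int>" using assms by (simp add: OK_iff complex_add_cnj)
  then show "2 * Re x \<in> \<int>" by (simp only: of_real_in_Ints_iff)
qed

text \<open>Trace and norm are bounded integers on the disc, and they determine an element up to
  complex conjugation.\<close>

lemma finite_OK_disc: "finite {x \<in> OK. cmod x \<le> R}"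
proof -
  define F where "F = (\<lambda>i. real_of_int i) ` {- \<lceil>2 * R + R\<^sup>2\<rceil> .. \<lceil>2 * R + R\<^sup>2\<rceil>}"
  define f where "f = (\<lambda>x. (2 * Re x, (cmod x)\<^sup>2))"
  let ?S = "{x \<in> OK. cmod x \<le> R}"
  have mem: "r \<in> F" if "r \<in> \<int>" "\<bar>r\<bar> \<le> 2 * R + R\<^sup>2" for r
  proof -
    obtain i where i: "r = of_int i" using \<open>r \<in> \<int>\<close> by (auto elim: Ints_cases)
    have "real_of_int \<bar>i\<bar> \<le> 2 * R + R\<^sup>2" using that i by simp
    then have "real_of_int \<bar>i\<bar> \<le> of_int \<lceil>2 * R + R\<^sup>2\<rceil>" using le_of_int_ceiling order_trans by blast
    then have "\<bar>i\<bar> \<le> \<lceil>2 * R + R\<^sup>2\<rceil>" by (simp only: of_int_le_iff)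
    then show ?thesis unfolding F_def i by (intro imageI) auto
  qed
  have "f ` ?S \<subseteq> F \<times> F"
  proof
    fix y assume "y \<in> f ` ?S"
    then obtain x where x: "x \<in> OK" "cmod x \<le> R" "y = f x" by auto
    have R: "R \<ge> 0" using x(2) norm_ge_zero order_trans by blast
    have "\<bar>2 * Re x\<bar> \<le> 2 * R + R\<^sup>2" using abs_Re_le_cmod[of x] x(2) by (smt (verit) zero_le_power2)
    moreover have "(cmod x)\<^sup>2 \<le> R\<^sup>2" using x(2) by (intro power_mono) auto
    then have "\<bar>(cmod x)\<^sup>2\<bar> \<le> 2 * R + R\<^sup>2" using R zero_le_power2[of "cmod x"] by linarith
    ultimately show "y \<in> F \<times> F" using x mem OK_norm_Ints[OF x(1)] by (auto simp: f_def)
  qed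
  then have fin: "finite (f ` ?S)" by (rule finite_subset) (simp add: F_def)
  have "finite {x \<in> ?S. f x = y}" for y
  proof (cases "{x \<in> ?S. f x = y} = {}")
    case False
    then obtain x0 where x0: "f x0 = y" by auto
    have "{x \<in> ?S. f x = y} \<subseteq> {x0, cnj x0}"
    proof
      fix x assume "x \<in> {x \<in> ?S. f x = y}"
      then have "Re x = Re x0" "(cmod x)\<^sup>2 = (cmod x0)\<^sup>2" using x0 by (auto simp: f_def)
      then have "Re x = Re x0" "Im x = Im x0 \<or> Im x = - Im x0"
        by (auto simp: cmod_power2 power2_eq_iff)
      then show "x \<in> {x0, cnj x0}" by (auto simp: complex_eq_iff)
    qed
    then show ?thesis by (rule finite_subset) simp
  qed (simp only: finite.emptyI)
  then have "finite (\<Union>y\<in>f ` ?S. {x \<in> ?S. f x = y})" using fin by (intro finite_UN_I)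
  moreover have "?S \<subseteq> (\<Union>y\<in>f ` ?S. {x \<in> ?S. f x = y})" by blast
  ultimately show ?thesis by (rule rev_finite_subset)
qed

text \<open>Finiteness of \<open>OK\<close> modulo \<open>M\<close>, in a form suited to pigeonhole
  arguments. Multiplication by 2 d maps \<open>OK\<close> into Z + Z s, so the two coordinates of 2
  d x modulo 2 d M determine the class of x modulo \<open>M\<close>.\<close>

lemma OK_residue_label:
  assumes "M > 0"
  obtains lab :: "complex \<Rightarrow> int \<times> int"
  where "finite (range lab)" "\<And>x y. x \<in> OK \<Longrightarrow> y \<in> OK \<Longrightarrow> lab x = lab y \<Longrightarrow> \<exists>w\<in>OK. x - y = of_nat M * w"
proof -
  have ex: "\<exists>i j :: int. of_nat (2 * d) * x = of_int i + of_int j * s" if "x \<in> OK" for x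
  proof -
    have "x \<in> K" using that by (simp add: OK_iff)
    then obtain p q where pq: "p \<in> \<rat>" "q \<in> \<rat>" "x = p + q * s" using K_iff by blast
    have c: "cnj p = p" "cnj q = q" using pq cnj_Rats by auto
    have "x + cnj x = 2 * p" by (simp add: pq(3) c s_imaginary)
    then have t: "2 * p \<in> \<int>" using that by (simp add: OK_iff)
    have "x * cnj x = p * p - q * q * (s * s)"
      by (simp add: pq(3) c s_imaginary(3) algebra_simps)
    then have "x * cnj x = p * p + of_nat d * q * q" by (simp add: s_imaginary(4))
    then have n: "p * p + of_nat d * q * q \<in> \<int>" using that by (simp add: OK_iff)
    have "(2 * of_nat d * q) * (2 * of_nat d * q)
        = of_nat d * (4 * (p * p + of_nat d * q * q) - (2 * p) * (2 * p))" by (simp add: algebra_simps)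
    also have "\<dots> \<in> \<int>" using t n by (meson Ints_mult Ints_diff Ints_of_nat Ints_numeral)
    finally have sqi: "(2 * of_nat d * q) * (2 * of_nat d * q) \<in> \<int>" .
    have "2 * of_nat d * q \<in> \<int>"
    proof (rule Ints_of_sum_product)
      show "2 * of_nat d * q + - (2 * of_nat d * q) \<in> \<int>" by simp
      show "(2 * of_nat d * q) * - (2 * of_nat d * q) \<in> \<int>" using sqi by simp
    qed (use pq in auto)
    then obtain j where j: "2 * of_nat d * q = of_int j" by (auto elim: Ints_cases)
    obtain i where i: "2 * p = of_int i" using t by (auto elim: Ints_cases)
    have "of_nat (2 * d) * x = of_nat d * (2 * p) + (2 * of_nat d * q) * s" by (simp add: pq(3) algebra_simps)
    also have "\<dots> = of_int (int d * i) + of_int j * s" by (simp add: i j)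
    finally show ?thesis by blast
  qed
  define P where "P = (\<lambda>x (ij :: int \<times> int). of_nat (2 * d) * x = of_int (fst ij) + of_int (snd ij) * s)"
  define m where "m = int (2 * d * M)"
  have m: "m > 0" using assms d_pos by (simp add: m_def)
  define co where "co = (\<lambda>x. SOME ij. P x ij)"
  define lab where "lab = (\<lambda>x. (fst (co x) mod m, snd (co x) mod m))"
  show ?thesis
  proof
    have "range lab \<subseteq> {0..m} \<times> {0..m}" using m by (auto simp: lab_def less_imp_le)
    then show "finite (range lab)" by (rule finite_subset) simp
    fix x y assume xy: "x \<in> OK" "y \<in> OK" and l: "lab x = lab y"
    have P: "P u (co u)" if "u \<in> OK" for u
      unfolding co_def by (rule someI_ex) (use ex[OF that] in \<open>auto simp: P_def\<close>)
    obtain a b where ab: "fst (co x) - fst (co y) = m * a" "snd (co x) - snd (co y) = m * b"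
      using l by (auto simp: lab_def mod_eq_dvd_iff dvd_def)
    have "of_nat (2 * d) * (x - y) = of_int (fst (co x) - fst (co y)) + of_int (snd (co x) - snd (co y)) * s"
      using P[OF xy(1)] P[OF xy(2)] by (simp add: P_def algebra_simps)
    also have "\<dots> = of_nat (2 * d) * (of_nat M * (of_int a + of_int b * s))"
      unfolding ab by (simp add: m_def algebra_simps)
    finally have "x - y = of_nat M * (of_int a + of_int b * s)" using d_pos by simp
    then show "\<exists>w\<in>OK. x - y = of_nat M * w" by (intro bexI[of _ "of_int a + of_int b * s"]) auto
  qed
qed

text \<open>Simultaneous approximation of the two real coordinates of \<open>\<theta>\<close> with
  respect to 1 and \<open>s\<close>. The choice of \<open>k\<close> makes the total error (1 + |s|)
  / k at most 1/2. What matters later is that the bound is below 1, as for a Euclidean division, and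
  that \<open>N\<close> does not depend on \<open>\<theta>\<close>.\<close>

lemma Dirichlet_approx_OK:
  obtains N :: nat where "N > 0" "\<And>\<theta>. \<exists>j\<in>{1..N}. \<exists>\<beta>\<in>OK. (cmod (of_nat j * \<theta> - \<beta>))\<^sup>2 \<le> 1/2"
proof -
  obtain k :: nat where k: "real k \<ge> 2 * (1 + cmod s)" using real_arch_simple by blast
  have kp: "real k > 0" using k by (smt (verit) norm_ge_zero)
  have k0: "k > 0" using kp by simp
  show ?thesis
  proof (rule that[of "k ^ 2"])
    show "0 < k ^ 2" using k0 by simp
    fix \<theta> :: complex
    define t where "t = (\<lambda>i::nat. if i = 0 then Re \<theta> else Im \<theta> / Im s)"
    obtain q p where q: "0 < q" "q \<le> int (k ^ 2)"
      and p: "\<And>i. i < 2 \<Longrightarrow> \<bar>of_int q * t i - of_int (p i)\<bar> < 1 / real k"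
      using Dirichlet_approx_simult[OF k0] by metis
    define \<beta> where "\<beta> = of_int (p 0) + of_int (p 1) * s"
    have "of_nat (nat q) * \<theta> - \<beta> = of_real (of_int q * t 0 - of_int (p 0)) + of_real (of_int q * t 1 - of_int (p 1)) * s"
      using q(1) s_imaginary(1,2) by (simp add: complex_eq_iff \<beta>_def t_def algebra_simps)
    then have "cmod (of_nat (nat q) * \<theta> - \<beta>) \<le> \<bar>of_int q * t 0 - of_int (p 0)\<bar> + \<bar>of_int q * t 1 - of_int (p 1)\<bar> * cmod s"
      by (metis norm_mult norm_of_real norm_triangle_ineq)
    also have "\<dots> \<le> 1 / real k + 1 / real k * cmod s"
      using p[of 0] p[of 1] by (intro add_mono mult_right_mono) auto
    also have "\<dots> = (1 + cmod s) / real k" by (simp add: add_divide_distrib)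
    also have "\<dots> \<le> 1/2" using k kp by (simp add: field_simps)
    finally have "cmod (of_nat (nat q) * \<theta> - \<beta>) \<le> 1/2" .
    then have "(cmod (of_nat (nat q) * \<theta> - \<beta>))\<^sup>2 \<le> (1/2)\<^sup>2" by (intro power_mono) auto
    then have "(cmod (of_nat (nat q) * \<theta> - \<beta>))\<^sup>2 \<le> 1/2" by (simp add: power2_eq_square)
    moreover have "nat q \<in> {1..k ^ 2}" using q by (simp add: nat_le_iff)
    ultimately show "\<exists>j\<in>{1..k ^ 2}. \<exists>\<beta>\<in>OK. (cmod (of_nat j * \<theta> - \<beta>))\<^sup>2 \<le> 1/2"
      by (intro bexI[of _ "nat q"] bexI[of _ \<beta>]) (auto simp: \<beta>_def)
  qed
qed

end

text \<open>A nonreal x in \<open>K\<close> forms a rational basis together with 1. Completing the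
  square in its quadratic relation gives y with rational square a/b; then b y has the integral
  square a b, which is negative because b y is not real.\<close>

lemma imaginary_quadratic_field_generator:
  assumes "imaginary_quadratic_field K"
  obtains s d where "imaginary_quadratic K s d"
proof -
  interpret Q: vector_space "\<lambda>(q::rat) (z::complex). of_rat q * z" by (rule rat_vector_space_complex)
  have one: "1 \<in> K" and add: "\<And>x y. x \<in> K \<Longrightarrow> y \<in> K \<Longrightarrow> x + y \<in> K"
    and mult: "\<And>x y. x \<in> K \<Longrightarrow> y \<in> K \<Longrightarrow> x * y \<in> K"
    and diff: "\<And>x y. x \<in> K \<Longrightarrow> y \<in> K \<Longrightarrow> x - y \<in> K"
    and inv: "\<And>x. x \<in> K \<Longrightarrow> inverse x \<in> K"
    and zero: "0 \<in> K"
    and dim: "Q.dim K = 2" and nr: "\<not> K \<subseteq> \<real>"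
    using assms by (auto simp: imaginary_quadratic_field_def)
  have nat: "of_nat n \<in> K" for n by (induction n) (auto intro: one add zero)
  have int: "of_int n \<in> K" for n
    by (cases n rule: int_cases2) (use diff[OF zero nat] nat in auto)
  have rat: "r \<in> K" if "r \<in> \<rat>" for r
    using that mult[OF int inv[OF int]] by (auto elim!: Rats_cases' simp: divide_inverse)
  have RR: "u \<in> \<rat> \<Longrightarrow> u \<in> \<real>" for u :: complex by (auto elim!: Rats_cases')
  obtain x where x: "x \<in> K" "x \<notin> \<real>" using nr by blast
  obtain B where B: "B \<subseteq> K" "K \<subseteq> Q.span B" "card B = 2"
    using Q.basis_exists[of K] dim by metis
  have finB: "finite B" using B(3) by (metis card.infinite zero_neq_numeral)
  have sp1: "Q.span {1} = \<rat>" unfolding Q.span_singleton by (auto simp: Rats_def)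
  have xs: "x \<notin> Q.span {1}" using x RR unfolding sp1 by blast
  have ind: "Q.independent {x, 1}" by (subst Q.independent_insert) (use xs x in auto)
  have span: "y \<in> Q.span {x, 1}" if y: "y \<in> K" for y
  proof (rule ccontr)
    assume n: "y \<notin> Q.span {x, 1}"
    then have "y \<notin> {x, 1}" using Q.span_superset by blast
    then have "Q.independent {y, x, 1}" using n ind by (subst Q.independent_insert) auto
    moreover have "{y, x, 1} \<subseteq> Q.span B" using B(2) x(1) y one by auto
    ultimately have "card {y, x, 1} \<le> card B" using Q.independent_span_bound[OF finB] by blast
    moreover have "x \<noteq> 1" using x by auto
    ultimately show False using B(3) \<open>y \<notin> {x, 1}\<close> by simp
  qed
  have form: "\<exists>p\<in>\<rat>. \<exists>q\<in>\<rat>. y = p + q * x" if "y \<in> K" for y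
  proof -
    have "\<exists>k. y - of_rat k * x \<in> Q.span {1}" using span[OF that] by (simp add: Q.span_breakdown_eq)
    then obtain k where "y - of_rat k * x \<in> \<rat>" unfolding sp1 by blast
    then show ?thesis by (intro bexI[of _ "y - of_rat k * x"] bexI[of _ "of_rat k"]) auto
  qed
  obtain p q where pq: "p \<in> \<rat>" "q \<in> \<rat>" "x * x = p + q * x" using form[OF mult[OF x(1) x(1)]] by blast
  define y where "y = x - q / 2"
  define r where "r = p + q * q / 4"
  have yy: "y * y = r" using pq(3) by (simp add: y_def r_def algebra_simps)
  have r: "r \<in> \<rat>" using pq by (auto simp: r_def)
  obtain a b where ab: "b > 0" "r = of_int a / of_int b" using r by (metis Rats_cases')
  define s where "s = of_int b * y"
  have q2: "q / 2 \<in> \<rat>" using pq by auto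
  have ynr: "y \<notin> \<real>"
  proof
    assume "y \<in> \<real>"
    then have "y + q / 2 \<in> \<real>" using RR[OF q2] by (rule Reals_add)
    then show False using x by (simp add: y_def)
  qed
  have ss: "s * s = of_int (a * b)" using yy ab by (simp add: s_def field_simps)
  have snr: "s \<notin> \<real>"
  proof
    assume "s \<in> \<real>"
    then have "s / of_int b \<in> \<real>" by auto
    then show False using ynr ab(1) by (simp add: s_def)
  qed
  have neg: "a * b < 0"
  proof (rule ccontr)
    assume "\<not> a * b < 0"
    then have "0 \<le> real_of_int (a * b)" by (simp only: of_int_0_le_iff not_less)
    have "Im (s * s) = 0" "Re (s * s) = real_of_int (a * b)" using ss by simp_all
    moreover have "Im s \<noteq> 0" using snr complex_is_Real_iff by blast
    ultimately have "Re s = 0" by auto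
    then have "- (Im s * Im s) = real_of_int (a * b)" using \<open>Re (s * s) = _\<close> by simp
    then have "Im s * Im s \<le> 0" using \<open>0 \<le> real_of_int (a * b)\<close> by linarith
    then show False using \<open>Im s \<noteq> 0\<close> by (meson not_real_square_gt_zero not_less)
  qed
  define d where "d = nat (- (a * b))"
  have "imaginary_quadratic K s d"
  proof
    show "s ^ 2 = - of_nat d" using ss neg by (simp add: power2_eq_square d_def)
    show "d > 0" using neg by (simp add: d_def)
    fix u
    show "(u \<in> K) = (\<exists>p\<in>\<rat>. \<exists>q\<in>\<rat>. u = p + q * s)"
    proof
      assume "u \<in> K"
      then obtain p' q' where u: "p' \<in> \<rat>" "q' \<in> \<rat>" "u = p' + q' * x" using form by blast
      have "u = (p' + q' * q / 2) + (q' / of_int b) * s" using ab(1) by (simp add: u s_def y_def algebra_simps)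
      then show "\<exists>p\<in>\<rat>. \<exists>q\<in>\<rat>. u = p + q * s" using u pq by (intro bexI[of _ "p' + q' * q / 2"] bexI[of _ "q' / of_int b"]) auto
    next
      assume "\<exists>p\<in>\<rat>. \<exists>q\<in>\<rat>. u = p + q * s"
      moreover have "s \<in> K" unfolding s_def y_def using x(1) rat[OF q2] by (intro mult diff int)
      ultimately show "u \<in> K" using rat add mult by blast
    qed
  qed
  then show ?thesis using that by blast
qed

section \<open>The Hermitian product\<close>

text \<open>The sesquilinear form polarizing \<open>herm\<close>, linear in the first argument and
  conjugate linear in the second.\<close>

definition hp :: "complex^3 \<Rightarrow> complex^3 \<Rightarrow> complex" where
  "hp x y = - (x $ 1) * cnj (y $ 3) - (x $ 3) * cnj (y $ 1) + (x $ 2) * cnj (y $ 2)"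

lemma hp_simps [simp]:
  "hp (x + x') y = hp x y + hp x' y" "hp (x - x') y = hp x y - hp x' y" "hp (c *s x) y = c * hp x y"
  "hp x (y + y') = hp x y + hp x y'" "hp x (y - y') = hp x y - hp x y'" "hp x (c *s y) = cnj c * hp x y"
  "hp 0 y = 0" "hp x 0 = 0"
  by (simp_all add: hp_def algebra_simps)

lemma cnj_hp: "cnj (hp x y) = hp y x"
  by (simp add: hp_def algebra_simps)

lemma hp_self: "hp x x = of_real (herm x)"
  unfolding herm_def cmod_power2 by (simp add: hp_def complex_eq_iff power2_eq_square algebra_simps)

lemma herm_eq_Re: "herm x = Re (hp x x)"
  by (simp add: hp_self)

lemma hp_axis: "hp (axis 1 1) y = - cnj (y $ 3)" "hp (axis 2 1) y = cnj (y $ 2)" "hp (axis 3 1) y = - cnj (y $ 1)"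
  by (simp_all add: hp_def axis_def)

lemma hp_nondegenerate: assumes "\<And>w. hp w x = hp w y" shows "x = y"
  using assms[of "axis 1 1"] assms[of "axis 2 1"] assms[of "axis 3 1"]
  by (simp add: hp_axis vec_eq_iff forall_3)

lemma hp_polarization:
  "hp x y = (of_real (herm (x + y)) - of_real (herm (x - y))
           + \<i> * of_real (herm (x + \<i> *s y)) - \<i> * of_real (herm (x - \<i> *s y))) / 4"
  unfolding hp_self[symmetric] by (simp add: algebra_simps)

lemma isometry_hp:
  assumes "\<And>z. herm (A *v z) = herm z"
  shows "hp (A *v x) (A *v y) = hp x y"
proof -
  have "A *v x + A *v y = A *v (x + y)" "A *v x - A *v y = A *v (x - y)"
    "A *v x + \<i> *s (A *v y) = A *v (x + \<i> *s y)" "A *v x - \<i> *s (A *v y) = A *v (x - \<i> *s y)"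
    by (simp_all add: matrix_vector_right_distrib matrix_vector_mult_diff_distrib vector_scalar_commute)
  then show ?thesis
    by (subst (1 2) hp_polarization) (simp only: assms)
qed

lemma matrix_vector_mult_3:
  "(A *v x) $ i = A $ i $ 1 * x $ 1 + A $ i $ 2 * x $ 2 + A $ i $ 3 * x $ (3::3)"
  by (simp add: matrix_vector_mult_def sum_3)

lemma matrix_matrix_mult_3:
  "(A ** B) $ i $ j = A $ i $ 1 * B $ 1 $ j + A $ i $ 2 * B $ 2 $ j + A $ i $ (3::3) * B $ 3 $ j"
  by (simp add: matrix_matrix_mult_def sum_3)

text \<open>\<open>hadj A = J A\<^sup>* J\<close>, where \<open>J = J\<inverse>\<close> is the Gram matrix of the Hermitian product.\<close>

definition hadj :: "complex^3^3 \<Rightarrow> complex^3^3" where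
  "hadj A = vector [vector [cnj (A$3$3), - cnj (A$2$3), cnj (A$1$3)],
                    vector [- cnj (A$3$2), cnj (A$2$2), - cnj (A$1$2)],
                    vector [cnj (A$3$1), - cnj (A$2$1), cnj (A$1$1)]]"

lemma hp_hadj: "hp (A *v x) y = hp x (hadj A *v y)"
  by (simp add: hp_def hadj_def matrix_vector_mult_3 algebra_simps)

lemma det_hadj: "det (hadj A) = cnj (det A)"
  by (simp add: det_3 hadj_def algebra_simps)

lemma isometry_hadj:
  assumes "\<And>z. herm (A *v z) = herm z"
  shows "hadj A ** A = mat 1" "A ** hadj A = mat 1"
proof -
  have "hadj A *v (A *v y) = y" for y
    by (rule hp_nondegenerate) (simp flip: hp_hadj add: isometry_hp[OF assms])
  then show "hadj A ** A = mat 1"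
    by (simp add: matrix_eq matrix_vector_mul_assoc)
  then show "A ** hadj A = mat 1" by (simp add: matrix_left_right_inverse)
qed

lemma isometry_inverse:
  assumes A: "\<And>z. herm (A *v z) = herm z" and B: "A ** B = mat 1"
  shows "herm (B *v z) = herm z"
  using A[of "B *v z"] B by (simp add: matrix_vector_mul_assoc)

lemma isometry_det: assumes "\<And>z. herm (A *v z) = herm z" shows "cmod (det A) = 1"
proof -
  have "cnj (det A) * det A = 1"
    using isometry_hadj(1)[OF assms] by (metis det_I det_hadj det_mul)
  then have "complex_of_real ((cmod (det A))\<^sup>2) = 1"
    by (simp add: complex_norm_square mult.commute del: of_real_power)
  then have "(cmod (det A))\<^sup>2 = 1" by (simp only: of_real_eq_1_iff)
  then show ?thesis using power2_eq_iff_nonneg[of "cmod (det A)" 1] by simp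
qed

text \<open>Pairing a linear relation with each of the three vectors shows that the matrix with
  these columns has trivial kernel. So w is a combination of them, and pairing once more yields the
  coefficients.\<close>

lemma orthogonal_expansion:
  assumes "hp a b = 0" "hp a c = 0" "hp b c = 0" "hp a a \<noteq> 0" "hp b b \<noteq> 0" "hp c c \<noteq> 0"
  shows "w = (hp w a / hp a a) *s a + (hp w b / hp b b) *s b + (hp w c / hp c c) *s c"
proof -
  have o: "hp b a = 0" "hp c a = 0" "hp c b = 0" using assms(1-3) by (metis cnj_hp complex_cnj_zero)+
  define B where "B = transpose (vector [a, b, c] :: complex^3^3)"
  have B: "B *v x = x $ 1 *s a + x $ 2 *s b + x $ 3 *s c" for x
    by (simp add: B_def vec_eq_iff matrix_vector_mult_3 transpose_def)
  have "x = 0" if "B *v x = 0" for x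
  proof -
    have "hp (B *v x) a = 0" "hp (B *v x) b = 0" "hp (B *v x) c = 0" using that by simp_all
    then show ?thesis using assms o by (simp add: B vec_eq_iff forall_3)
  qed
  then have "\<exists>B'. B' ** B = mat 1" by (simp add: matrix_left_invertible_ker)
  then obtain B' where "B ** B' = mat 1" using matrix_left_right_inverse by blast
  then have "w = B *v (B' *v w)" by (simp add: matrix_vector_mul_assoc)
  then obtain x :: "complex^3" where x: "w = x $ 1 *s a + x $ 2 *s b + x $ 3 *s c" using B by metis
  have "hp w a = x $ 1 * hp a a" "hp w b = x $ 2 * hp b b" "hp w c = x $ 3 * hp c c"
    using assms o by (simp_all add: x)
  then have "hp w a / hp a a = x $ 1" "hp w b / hp b b = x $ 2" "hp w c / hp c c = x $ 3"
    using assms(4-6) by simp_all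
  then show ?thesis using x by metis
qed

text \<open>The Hermitian cross product: it represents the functional w \<mapsto> det(w, x, y) with
  respect to \<open>hp\<close>, so it is orthogonal to x and y. Its entries are conjugates of 2 by 2
  minors, hence integral for integral arguments.\<close>

definition cr :: "complex^3 \<Rightarrow> complex^3 \<Rightarrow> complex^3" where
  "cr x y = vector [- cnj (x$1 * y$2 - x$2 * y$1), - cnj (x$1 * y$3 - x$3 * y$1), - cnj (x$2 * y$3 - x$3 * y$2)]"

lemma hp_cr: "hp w (cr x y) = det (vector [w, x, y])"
  by (simp add: hp_def cr_def det_3 algebra_simps)

lemma hp_cr_0 [simp]: "hp x (cr x y) = 0" "hp y (cr x y) = 0"
  by (simp_all add: hp_def cr_def algebra_simps)

text \<open>This is the Gram determinant of x and y with the opposite sign, the Gram matrix of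
  \<open>hp\<close> having determinant -1. Consequently the cross product of two orthogonal positive
  vectors is negative.\<close>

lemma hp_cr_self: "hp (cr x y) (cr x y) = hp x y * hp y x - hp x x * hp y y"
  by (simp add: hp_def cr_def algebra_simps)

lemma herm_cr: "herm (cr x y) = (cmod (hp x y))\<^sup>2 - herm x * herm y"
proof -
  have "hp x y * hp y x = complex_of_real ((cmod (hp x y))\<^sup>2)"
    by (metis cnj_hp complex_norm_square)
  then have "hp (cr x y) (cr x y) = of_real ((cmod (hp x y))\<^sup>2 - herm x * herm y)"
    unfolding hp_cr_self by (simp add: hp_self)
  then show ?thesis by (simp only: herm_eq_Re Re_complex_of_real)
qed

text \<open>Subtracting the multiple t x that removes the third coordinate of v leaves y with h(y) =
  |y_1|^2 \<ge> 0, and orthogonality gives h(v) = h(y) - |t|^2 h(x). The case t = 0 is settled on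
  the coordinates.\<close>

lemma orthogonal_to_negative:
  assumes "herm x < 0" "hp v x = 0" "v \<noteq> 0" shows "herm v > 0"
proof -
  obtain a b c where abc: "x $ 1 = a" "x $ 2 = b" "x $ 3 = c" by auto
  have c: "c \<noteq> 0" using assms(1) abc by (auto simp: herm_def)
  define t where "t = v $ 3 / c"
  define y where "y = v - t *s x"
  have y3: "y $ 3 = 0" using c by (simp add: y_def t_def abc)
  have hy: "herm y = (cmod (y $ 2))\<^sup>2" by (simp add: herm_def y3)
  have v: "v = y + t *s x" by (simp add: y_def)
  have "hp y x + t * hp x x = 0" using assms(2) v by simp
  then have yx: "hp y x = - t * of_real (herm x)" by (simp add: hp_self add_eq_0_iff)
  have xy: "hp x y = - cnj t * of_real (herm x)" using yx by (metis cnj_hp complex_cnj_complex_of_real complex_cnj_minus complex_cnj_mult)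
  have "hp v v = hp y y + cnj t * hp y x + t * hp x y + t * cnj t * hp x x"
    by (simp add: v algebra_simps)
  also have "\<dots> = of_real (herm y) - t * cnj t * of_real (herm x)"
    by (simp add: yx xy hp_self algebra_simps)
  also have "\<dots> = of_real (herm y - (cmod t)\<^sup>2 * herm x)"
    by (simp add: complex_norm_square[symmetric] del: of_real_power)
  finally have hv: "herm v = herm y - (cmod t)\<^sup>2 * herm x" by (simp only: herm_eq_Re Re_complex_of_real)
  show ?thesis
  proof (cases "t = 0")
    case False
    then have "(cmod t)\<^sup>2 * herm x < 0" using assms(1) by (simp add: mult_pos_neg)
    moreover have "herm y \<ge> 0" by (simp add: hy)
    ultimately show ?thesis using hv by linarith
  next
    case True
    then have "v = y" "v $ 3 = 0" using v y3 by auto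
    show ?thesis
    proof (cases "v $ 2 = 0")
      case True
      then have "v $ 1 * cnj c = 0" using assms(2) \<open>v $ 3 = 0\<close> by (simp add: hp_def abc)
      then have "v = 0" using c True \<open>v $ 3 = 0\<close> by (simp add: vec_eq_iff forall_3)
      then show ?thesis using assms by simp
    next
      case False
      then show ?thesis using hy \<open>v = y\<close> by simp
    qed
  qed
qed

text \<open>The map \<open>u \<mapsto> u - \<langle>u, x - y\<rangle> / \<langle>x, x - y\<rangle> (x - y)\<close> sends \<open>x\<close> to \<open>y\<close>, and it is unitary even when
  \<open>x - y\<close> is isotropic, since \<open>h(x - y) = 2 Re \<langle>x, x - y\<rangle>\<close>.\<close>

definition witt :: "complex^3 \<Rightarrow> complex^3 \<Rightarrow> complex^3^3" where
  "witt x y = (\<chi> i j. (if i = j then 1 else 0) - hp (axis j 1) (x - y) / hp x (x - y) * (x - y) $ i)"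

lemma witt_mult: "witt x y *v u = u - (hp u (x - y) / hp x (x - y)) *s (x - y)"
proof -
  define a where "a = x - y"
  define e where "e = hp x a"
  have "((\<chi> i j. (if i = j then 1 else 0) - hp (axis j 1) a / e * a $ i) *v u) = u - (hp u a / e) *s a"
    unfolding vec_eq_iff forall_3 matrix_vector_mult_3
    by (simp add: hp_axis) (simp add: hp_def diff_divide_distrib add_divide_distrib algebra_simps)
  then show ?thesis by (simp add: witt_def a_def e_def)
qed

lemma witt:
  assumes "herm x = herm y" "hp x (x - y) \<noteq> 0"
  shows "witt x y *v x = y" "herm (witt x y *v u) = herm u"
proof -
  define a where "a = x - y"
  define \<alpha> where "\<alpha> = hp x a"
  have \<alpha>: "\<alpha> \<noteq> 0" using assms(2) by (simp add: \<alpha>_def a_def)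
  have "hp x x = hp y y" using assms(1) by (simp add: hp_self)
  then have aa: "hp a a = \<alpha> + cnj \<alpha>" by (simp add: a_def \<alpha>_def cnj_hp)
  show "witt x y *v x = y" using assms(2) by (simp add: witt_mult)
  define c where "c = hp u a"
  have au: "hp a u = cnj c" by (simp add: c_def cnj_hp)
  have "hp (u - k *s a) (u - k *s a) = hp u u - cnj k * c - k * cnj c + k * cnj k * (\<alpha> + cnj \<alpha>)" for k
    by (simp add: aa au c_def[symmetric] algebra_simps)
  then have "hp (u - (c / \<alpha>) *s a) (u - (c / \<alpha>) *s a)
      = hp u u - cnj (c / \<alpha>) * c - (c / \<alpha>) * cnj c + (c / \<alpha>) * cnj (c / \<alpha>) * (\<alpha> + cnj \<alpha>)" .
  also have "\<dots> = hp u u"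
  proof -
    have "h - c' / \<beta> * c - (c / \<alpha>) * c' + (c / \<alpha>) * (c' / \<beta>) * (\<alpha> + \<beta>) = h"
      if "\<beta> \<noteq> 0" for c' \<beta> h :: complex using \<alpha> that by (simp add: field_simps)
    from this[of "cnj \<alpha>" "hp u u" "cnj c"] show ?thesis using \<alpha> by simp
  qed
  finally show "herm (witt x y *v u) = herm u"
    unfolding witt_mult herm_eq_Re a_def c_def \<alpha>_def by (rule arg_cong)
qed

text \<open>The numbers \<langle>x, x - y\<rangle> and \<langle>x, x + y\<rangle> have the nonzero
  sum 2 h(x), so the isometry \<open>witt\<close> is available for at least one of y and -y.\<close>

lemma isometry_up_to_sign:
  assumes "herm x = herm y" "herm x \<noteq> 0"
  obtains \<epsilon> :: complex where "\<epsilon> = 1 \<or> \<epsilon> = -1"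
    "witt x (\<epsilon> *s y) *v x = \<epsilon> *s y" "\<And>u. herm (witt x (\<epsilon> *s y) *v u) = herm u"
proof (cases "hp x (x - y) = 0")
  case False
  then show ?thesis using that[of 1] witt[OF assms(1)] by simp
next
  case True
  then have "hp x y = hp x x" by simp
  then have "hp x (x - (-1) *s y) = 2 * hp x x" by simp
  then have "hp x (x - (-1) *s y) \<noteq> 0" using assms(2) by (simp add: hp_self)
  moreover have "herm x = herm ((-1) *s y)" using assms(1) herm_scale[of "-1" y] by simp
  ultimately show ?thesis using that[of "-1"] witt[of x "(-1) *s y"] by blast
qed

section \<open>Rescaling isometries to determinant one\<close>

lemma det_mat_mult: "det (mat c ** (A :: complex^3^3)) = c ^ 3 * det A"
  by (simp add: det_mul) (simp add: det_3 mat_def power3_eq_cube)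

lemma mat_mult_mult_vec: "(mat c ** (A :: complex^3^3)) *v v = c *s (A *v v)"
  by (simp add: mat_mult_vec flip: matrix_vector_mul_assoc)

lemma mat_mult_nth: "(mat c ** (A :: complex^3^3)) $ i $ j = c * A $ i $ j"
  by (simp add: matrix_matrix_mult_def mat_def if_distrib[of "\<lambda>x. x * _"] cong: if_cong)

lemma carrier_SU_h: "A \<in> carrier SU_h \<longleftrightarrow> det A = 1 \<and> (\<forall>z. herm (A *v z) = herm z)"
  by (simp add: SU_h_def)

text \<open>The determinant of an isometry has modulus one; multiplication by a cube root of its
  inverse makes the determinant one and preserves the form.\<close>

lemma isometry_scaled_SU_h:
  assumes "\<And>z. herm (A *v z) = herm z"
  obtains c where "c \<noteq> 0" "mat c ** A \<in> carrier SU_h"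
proof -
  have dA: "cmod (det A) = 1" by (rule isometry_det[OF assms])
  then have nz: "det A \<noteq> 0" by auto
  define c where "c = exp (- Ln (det A) / 3)"
  have "c ^ 3 = exp (3 * (- Ln (det A) / 3))"
    unfolding c_def by (subst exp_of_nat_mult[symmetric]) simp
  also have "\<dots> = inverse (det A)" using nz by (simp add: exp_minus)
  finally have c3: "c ^ 3 = inverse (det A)" .
  then have "cmod c ^ 3 = 1" using dA by (metis inverse_1 norm_inverse norm_power)
  then have "cmod c = 1" using power_eq_imp_eq_base[of "cmod c" 3 1] by simp
  then have "mat c ** A \<in> carrier SU_h" using c3 nz assms
    by (simp add: carrier_SU_h det_mat_mult mat_mult_mult_vec herm_scale)
  moreover have "c \<noteq> 0" by (simp add: c_def)
  ultimately show ?thesis using that by blast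
qed

lemma SU_h_mult: "A \<in> carrier SU_h \<Longrightarrow> B \<in> carrier SU_h \<Longrightarrow> A ** B \<in> carrier SU_h"
  using group.is_monoid[OF group_SU_h, THEN monoid.m_closed, of A B] by (simp add: SU_h_def)

lemma SU_h_one: "mat 1 \<in> carrier SU_h"
  by (simp add: carrier_SU_h)

lemma SU_h_hadj: assumes "A \<in> carrier SU_h"
  shows "hadj A \<in> carrier SU_h" "hadj A ** A = mat 1" "A ** hadj A = mat 1"
proof -
  have A: "\<And>z. herm (A *v z) = herm z" "det A = 1" using assms by (auto simp: carrier_SU_h)
  show "hadj A ** A = mat 1" and i: "A ** hadj A = mat 1" using isometry_hadj[OF A(1)] by auto
  show "hadj A \<in> carrier SU_h"
    using A isometry_inverse[OF A(1) i] by (simp add: carrier_SU_h det_hadj)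
qed

lemma SU_h_hp: "A \<in> carrier SU_h \<Longrightarrow> hp (A *v x) (A *v y) = hp x y"
  by (rule isometry_hp) (simp add: carrier_SU_h)

lemma SU_h_inv: assumes "A \<in> carrier SU_h" "A *v v = c *s v" "c \<noteq> 0" shows "hadj A *v v = inverse c *s v"
proof -
  have "hadj A *v (A *v v) = v" using SU_h_hadj(2)[OF assms(1)] by (simp add: matrix_vector_mul_assoc)
  then have "c *s (hadj A *v v) = v" by (simp add: assms(2) vector_scalar_commute)
  then show ?thesis using assms(3)
    by (metis (no_types) left_inverse vector_smult_assoc vector_smult_lid)
qed

lemma SU_h_mult_nonzero: assumes "A \<in> carrier SU_h" "x \<noteq> 0" shows "A *v x \<noteq> 0"
proof
  assume "A *v x = 0"
  then have "(hadj A ** A) *v x = 0" by (simp flip: matrix_vector_mul_assoc)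
  then show False using assms SU_h_hadj by simp
qed

lemma mat_unit_root_carrier: "w ^ 3 = 1 \<Longrightarrow> mat w \<in> carrier SU_h"
  using U3_subset by (auto simp: U3_def)

section \<open>The projective unitary group\<close>

definition cls :: "complex^3^3 \<Rightarrow> (complex^3^3) set" where
  "cls A = U3 #>\<^bsub>SU_h\<^esub> A"

lemma cls_def': "cls A = {mat \<omega> ** A | \<omega>. \<omega> ^ 3 = 1}"
  unfolding cls_def r_coset_def U3_def by (auto simp: SU_h_def)

lemma mem_cls_self: "A \<in> cls A"
  unfolding cls_def' by (auto intro!: exI[of _ 1])

lemma cls_eqI: assumes "\<omega> ^ 3 = 1" "A = mat \<omega> ** B" shows "cls A = cls B"
proof
  show "cls A \<subseteq> cls B"
    using assms by (auto simp: cls_def' matrix_mul_assoc mat_mult_mat) (metis mult.right_neutral power_mult_distrib)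
  have nz: "\<omega> \<noteq> 0" using assms by auto
  show "cls B \<subseteq> cls A"
  proof
    fix X assume "X \<in> cls B"
    then obtain w where w: "X = mat w ** B" "w ^ 3 = 1" by (auto simp: cls_def')
    have "X = mat (w / \<omega>) ** A" using nz by (simp add: w assms(2) matrix_mul_assoc mat_mult_mat)
    moreover have "(w / \<omega>) ^ 3 = 1" using assms w by (simp add: power_divide)
    ultimately show "X \<in> cls A" by (auto simp: cls_def')
  qed
qed

lemma cls_eq_iff: "cls A = cls B \<longleftrightarrow> (\<exists>\<omega>. \<omega> ^ 3 = 1 \<and> A = mat \<omega> ** B)"
proof
  assume "cls A = cls B"
  then have "A \<in> cls B" using mem_cls_self by blast
  then show "\<exists>\<omega>. \<omega> ^ 3 = 1 \<and> A = mat \<omega> ** B" by (auto simp: cls_def')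
next
  assume "\<exists>\<omega>. \<omega> ^ 3 = 1 \<and> A = mat \<omega> ** B"
  then obtain w where "w ^ 3 = 1" "A = mat w ** B" by blast
  then show "cls A = cls B" by (rule cls_eqI)
qed

lemma carrier_PSU_h: "carrier PSU_h = cls ` carrier SU_h"
  unfolding PSU_h_def carrier_FactGroup cls_def by simp

lemma cls_carrier [simp]: "A \<in> carrier SU_h \<Longrightarrow> cls A \<in> carrier PSU_h"
  by (simp add: carrier_PSU_h)

lemma carrier_of_cls: assumes "cls A \<in> carrier PSU_h" shows "A \<in> carrier SU_h"
proof -
  obtain B where B: "B \<in> carrier SU_h" "cls A = cls B" using assms unfolding carrier_PSU_h by blast
  then obtain w where "w ^ 3 = 1" "A = mat w ** B" by (auto simp: cls_eq_iff)
  then show ?thesis using SU_h_mult[OF mat_unit_root_carrier B(1)] by blast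
qed

lemma cls_mult: assumes "A \<in> carrier SU_h" "B \<in> carrier SU_h"
  shows "cls A \<otimes>\<^bsub>PSU_h\<^esub> cls B = cls (A ** B)"
  using normal.rcos_sum[OF U3_normal assms] by (simp add: PSU_h_def cls_def) (simp add: SU_h_def)

lemma cls_one: "\<one>\<^bsub>PSU_h\<^esub> = cls (mat 1)"
  unfolding PSU_h_def cls_def' U3_def by simp

lemma cls_inv: assumes "A \<in> carrier SU_h" shows "inv\<^bsub>PSU_h\<^esub> (cls A) = cls (hadj A)"
  by (rule group.inv_equality[OF group_PSU_h])
     (use assms SU_h_hadj[OF assms] in \<open>simp_all add: cls_mult cls_one\<close>)

lemma mem_proj: "x \<in> proj v \<longleftrightarrow> (\<exists>c. c \<noteq> 0 \<and> x = c *s v)"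
  by (auto simp: proj_def)

lemma proj_eq_iff: "proj x = proj y \<longleftrightarrow> (\<exists>c. c \<noteq> 0 \<and> x = c *s y)"
proof
  assume "proj x = proj y"
  moreover have "x \<in> proj x" by (auto simp: mem_proj intro!: exI[of _ 1])
  ultimately show "\<exists>c. c \<noteq> 0 \<and> x = c *s y" by (simp add: mem_proj)
next
  assume "\<exists>c. c \<noteq> 0 \<and> x = c *s y"
  then obtain c where c: "c \<noteq> 0" "x = c *s y" by blast
  have "u \<in> proj x \<longleftrightarrow> u \<in> proj y" for u
  proof
    assume "u \<in> proj x"
    then obtain b where "b \<noteq> 0" "u = b *s x" by (auto simp: mem_proj)
    then have "u = (b * c) *s y" "b * c \<noteq> 0" using c by auto
    then show "u \<in> proj y" unfolding mem_proj by blast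
  next
    assume "u \<in> proj y"
    then obtain b where "b \<noteq> 0" "u = b *s y" by (auto simp: mem_proj)
    then have "u = (b / c) *s x" "b / c \<noteq> 0" using c by auto
    then show "u \<in> proj x" unfolding mem_proj by blast
  qed
  then show "proj x = proj y" by blast
qed

lemma act_cls: "act (cls A) (proj v) = proj (A *v v)"
proof -
  have "u \<in> act (cls A) (proj v) \<longleftrightarrow> u \<in> proj (A *v v)" for u
  proof
    assume "u \<in> act (cls A) (proj v)"
    then obtain w c where "w ^ 3 = 1" "c \<noteq> 0" "u = (mat w ** A) *v (c *s v)"
      by (auto simp: act_def cls_def' mem_proj)
    moreover from this have "w \<noteq> 0" by auto
    ultimately show "u \<in> proj (A *v v)" unfolding mem_proj
      by (intro exI[of _ "w * c"]) (simp add: mat_mult_mult_vec vector_scalar_commute)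
  next
    assume "u \<in> proj (A *v v)"
    then obtain c where "c \<noteq> 0" "u = A *v (c *s v)" by (auto simp: mem_proj vector_scalar_commute)
    then show "u \<in> act (cls A) (proj v)"
      unfolding act_def using mem_cls_self[of A] by (auto simp: mem_proj)
  qed
  then show ?thesis by blast
qed

lemma act_cls_fixes_iff:
  assumes "A \<in> carrier SU_h" "v \<noteq> 0"
  shows "act (cls A) (proj v) = proj v \<longleftrightarrow> (\<exists>c. A *v v = c *s v)"
  unfolding act_cls proj_eq_iff using SU_h_mult_nonzero[OF assms] by auto

section \<open>Finite index and virtually cyclic subgroups\<close>

text \<open>The map \<open>f\<close> is an arbitrary label, not assumed constant on cosets: one
  element chosen from each fibre of \<open>f\<close> already represents all cosets of
  \<open>H\<close>.\<close>

lemma (in group) finite_indexI: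
  assumes A: "subgroup A G" and H: "subgroup H G" and HA: "H \<subseteq> A"
    and fin: "finite (f ` A)" and f: "\<And>x y. x \<in> A \<Longrightarrow> y \<in> A \<Longrightarrow> f x = f y \<Longrightarrow> x \<otimes> inv y \<in> H"
  shows "finite_index G H A"
proof -
  interpret A: group "G\<lparr>carrier := A\<rparr>" by (rule subgroup.subgroup_is_group[OF A group_axioms])
  have sg: "subgroup H (G\<lparr>carrier := A\<rparr>)" using subgroup_incl[OF H A HA] .
  have coset: "r_coset (G\<lparr>carrier := A\<rparr>) H x = H #> x" for x by (simp add: r_coset_def)
  have eq: "H #> x = H #> y" if "x \<in> A" "y \<in> A" "f x = f y" for x y
  proof -
    have c: "x \<in> carrier G" "y \<in> carrier G" using that subgroup.subset[OF A] by auto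
    have "x \<otimes> inv y \<in> H" using f that by blast
    then have "x = (x \<otimes> inv y) \<otimes> y" using c by (simp add: m_assoc)
    then have "x \<in> H #> y" using \<open>x \<otimes> inv y \<in> H\<close> by (auto simp: r_coset_def)
    then show ?thesis using repr_independence[OF _ c(2) H] by simp
  qed
  define g where "g = (\<lambda>l. H #> (SOME x. x \<in> A \<and> f x = l))"
  have "rcosets\<^bsub>G\<lparr>carrier := A\<rparr>\<^esub> H \<subseteq> g ` f ` A"
  proof
    fix C assume "C \<in> rcosets\<^bsub>G\<lparr>carrier := A\<rparr>\<^esub> H"
    then obtain x where x: "x \<in> A" "C = H #> x" by (auto simp: RCOSETS_def coset)
    have "(SOME y. y \<in> A \<and> f y = f x) \<in> A \<and> f (SOME y. y \<in> A \<and> f y = f x) = f x"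
      by (rule someI[of _ x]) (use x in auto)
    then have "H #> x = H #> (SOME y. y \<in> A \<and> f y = f x)" using x(1) by (intro eq) auto
    then have "C = g (f x)" unfolding g_def x(2) .
    then show "C \<in> g ` f ` A" using x by blast
  qed
  then have "finite (rcosets\<^bsub>G\<lparr>carrier := A\<rparr>\<^esub> H)" using fin by (meson finite_imageI finite_subset)
  then show ?thesis using sg by (simp add: finite_index_def)
qed

lemma (in group) generate_singleton_subgroup: "a \<in> carrier G \<Longrightarrow> subgroup (generate G {a}) G"
  by (rule generate_is_subgroup) simp

lemma (in group) virtually_cyclic_finite:
  assumes "subgroup A G" "finite A"
  shows "virtually_cyclic G A"
proof -
  have one: "\<one> \<in> A" using assms(1) by (rule subgroup.one_closed)
  have "generate G {\<one>} = {\<one>}" using generate_pow[of \<one>] by auto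
  moreover have "finite_index G {\<one>} A"
    by (rule finite_indexI[where f = id])
       (use assms one in \<open>auto simp: triv_subgroup dest: subgroup.mem_carrier\<close>)
  ultimately show ?thesis using one unfolding virtually_cyclic_def by (intro bexI[of _ \<one>]) auto
qed

lemma (in group) finite_index_coset_label:
  assumes "finite_index G H A" "subgroup A G" "subgroup H G"
  shows "finite ((\<lambda>x. H #> x) ` A)" "\<And>x y. x \<in> A \<Longrightarrow> y \<in> A \<Longrightarrow> H #> x = H #> y \<Longrightarrow> x \<otimes> inv y \<in> H"
proof -
  have "rcosets\<^bsub>G\<lparr>carrier := A\<rparr>\<^esub> H = (\<lambda>x. H #> x) ` A" by (auto simp: RCOSETS_def r_coset_def)
  then show "finite ((\<lambda>x. H #> x) ` A)" using assms(1) by (simp add: finite_index_def)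
  fix x y assume xy: "x \<in> A" "y \<in> A" "H #> x = H #> y"
  then have c: "x \<in> carrier G" "y \<in> carrier G" using subgroup.subset[OF assms(2)] by auto
  have "x \<in> H #> y" using xy(3) rcos_self[OF c(1) assms(3)] by simp
  then obtain h where h: "h \<in> H" "x = h \<otimes> y" by (auto simp: r_coset_def)
  then have "h \<in> carrier G" using assms(3) by (meson subgroup.mem_carrier)
  then have "x \<otimes> inv y = h" using h c by (simp add: m_assoc)
  then show "x \<otimes> inv y \<in> H" using h by simp
qed

text \<open>Let C, generated by c, have finite index in \<open>B\<close>. The exponents k with c^k
  in \<open>A\<close> form a subgroup of the integers, generated by some g, so that the intersection
  of C and \<open>A\<close> is generated by c^g. Its index in \<open>A\<close> is finite because
  elements of \<open>A\<close> in the same coset of C differ by an element of the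
  intersection.\<close>

lemma (in group) virtually_cyclic_subgroup:
  assumes vc: "virtually_cyclic G B" and B: "subgroup B G" and A: "subgroup A G" and AB: "A \<subseteq> B"
  shows "virtually_cyclic G A"
proof -
  obtain c where c: "c \<in> B" "finite_index G (generate G {c}) B" using vc by (auto simp: virtually_cyclic_def)
  have cG: "c \<in> carrier G" using c B by (meson subgroup.mem_carrier)
  define C where "C = generate G {c}"
  have C: "C = {c [^] (k::int) | k. True}" unfolding C_def using generate_pow[OF cG] by auto
  have Csg: "subgroup C G" unfolding C_def using generate_singleton_subgroup[OF cG] .
  define S where "S = {k::int. c [^] k \<in> A}"
  have S0: "0 \<in> S" using A by (simp add: S_def subgroup.one_closed)
  have Sm: "k - l * m \<in> S" if "k \<in> S" "l \<in> S" for k l m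
  proof -
    have pw: "x [^] (j::int) \<in> A" if "x \<in> A" for x j
      using A that subgroup_int_pow_closed by blast
    have "c [^] (k - l * m) = c [^] k \<otimes> inv ((c [^] l) [^] m)"
      using cG by (simp add: int_pow_diff int_pow_pow)
    then show ?thesis using that pw[of "c [^] l" m] A by (simp add: S_def subgroup.m_closed subgroup.m_inv_closed)
  qed
  obtain g where g: "g \<in> S" "\<And>k. k \<in> S \<Longrightarrow> g dvd k"
  proof (cases "\<exists>k\<in>S. k > 0")
    case False
    have "k = 0" if "k \<in> S" for k
      using Sm[OF S0 that, of 1] False that by (metis linorder_neqE_linordered_idom mult.right_neutral neg_0_less_iff_less diff_0)
    then show ?thesis using that[of 0] S0 by auto
  next
    case True
    then obtain k0 where "k0 \<in> S" "k0 > 0" by auto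
    define P where "P = (\<lambda>n. n > 0 \<and> int n \<in> S)"
    have "P (nat k0)" using \<open>k0 \<in> S\<close> \<open>k0 > 0\<close> by (simp add: P_def)
    then have L: "P (LEAST n. P n)" by (rule LeastI)
    define n where "n = (LEAST n. P n)"
    show ?thesis
    proof (rule that[of "int n"])
      show "int n \<in> S" using L by (simp add: P_def n_def)
      fix k assume "k \<in> S"
      then have "k mod int n \<in> S" using Sm[of k "int n" "k div int n"] \<open>int n \<in> S\<close>
        by (simp add: minus_mult_div_eq_mod)
      have "k mod int n = 0"
      proof (rule ccontr)
        assume ne: "k mod int n \<noteq> 0"
        have n0: "int n > 0" using L by (simp add: P_def n_def)
        then have "0 \<le> k mod int n" "k mod int n < int n" by auto
        then have "P (nat (k mod int n))" using ne \<open>k mod int n \<in> S\<close> by (simp add: P_def)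
        then have "n \<le> nat (k mod int n)" unfolding n_def by (rule Least_le)
        then show False using \<open>k mod int n < int n\<close> \<open>0 \<le> k mod int n\<close> by linarith
      qed
      then show "int n dvd k" by auto
    qed
  qed
  define a where "a = c [^] g"
  have aA: "a \<in> A" using g by (simp add: a_def S_def)
  have aG: "a \<in> carrier G" using cG by (simp add: a_def)
  have sub: "C \<inter> A \<subseteq> generate G {a}"
  proof
    fix x assume x: "x \<in> C \<inter> A"
    then obtain k :: int where k: "x = c [^] k" by (auto simp: C)
    then have "k \<in> S" using x by (simp add: S_def)
    then obtain m where "k = g * m" using g by (auto simp: dvd_def)
    then have "x = a [^] m" using k cG by (simp add: a_def int_pow_pow)
    then show "x \<in> generate G {a}" using generate_pow[OF aG] by auto
  qed
  have "finite_index G (generate G {a}) A"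
  proof (rule finite_indexI[where f = "\<lambda>x. C #> x"])
    show "generate G {a} \<subseteq> A" using generate_subgroup_incl[OF _ A, of "{a}"] aA by simp
    show "finite ((\<lambda>x. C #> x) ` A)"
      using finite_index_coset_label(1)[OF c(2) B] Csg AB unfolding C_def by (meson finite_subset image_mono)
    fix x y assume xy: "x \<in> A" "y \<in> A" "C #> x = C #> y"
    then have "x \<otimes> inv y \<in> C" using finite_index_coset_label(2)[OF c(2) B] Csg AB unfolding C_def by blast
    moreover have "x \<otimes> inv y \<in> A" using A xy by (simp add: subgroup.m_closed subgroup.m_inv_closed)
    ultimately show "x \<otimes> inv y \<in> generate G {a}" using sub by blast
  qed (use A generate_singleton_subgroup[OF aG] in auto)
  then show ?thesis using aA by (auto simp: virtually_cyclic_def)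
qed

text \<open>Infinitely many powers of an element meet finitely many cosets, so a positive power lies
  in the cyclic subgroup of finite index. In contrapositive form this is the test for being
  nonelementary.\<close>

lemma (in group) virtually_cyclic_powers_commute:
  assumes vc: "virtually_cyclic G A" and A: "subgroup A G" and x: "x \<in> A" and y: "y \<in> A"
  obtains m n :: nat where "m > 0" "n > 0" "x [^] m \<otimes> y [^] n = y [^] n \<otimes> x [^] m"
proof -
  obtain c where c: "c \<in> A" "finite_index G (generate G {c}) A" using vc by (auto simp: virtually_cyclic_def)
  have cG: "c \<in> carrier G" using c A by (meson subgroup.mem_carrier)
  define C where "C = generate G {c}"
  have Csg: "subgroup C G" unfolding C_def using generate_singleton_subgroup[OF cG] .
  have pw: "\<exists>m::nat. m > 0 \<and> u [^] m \<in> C" if u: "u \<in> A" for u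
  proof -
    have uG: "u \<in> carrier G" using u A by (meson subgroup.mem_carrier)
    have uA: "u [^] (i::nat) \<in> A" for i by (induction i) (use A u in \<open>auto simp: subgroup.one_closed subgroup.m_closed\<close>)
    have "finite (range (\<lambda>i::nat. C #> u [^] i))"
      using finite_index_coset_label(1)[OF c(2) A] Csg uA unfolding C_def
      by (rule_tac finite_subset) auto
    then have "\<not> inj (\<lambda>i::nat. C #> u [^] i)" using finite_imageD by blast
    then obtain i j :: nat where "i \<noteq> j" "C #> u [^] i = C #> u [^] j" by (auto simp: inj_def)
    then obtain i j :: nat where ij: "i < j" "C #> u [^] j = C #> u [^] i" by (metis nat_neq_iff)
    have "u [^] j \<otimes> inv (u [^] i) \<in> C"
      using finite_index_coset_label(2)[OF c(2) A _ uA uA] Csg ij(2) unfolding C_def by blast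
    moreover have "u [^] j \<otimes> inv (u [^] i) = u [^] (j - i)"
    proof -
      have "u [^] j = u [^] (j - i) \<otimes> u [^] i" using ij uG by (simp add: nat_pow_mult)
      then show ?thesis using uG by (simp add: m_assoc)
    qed
    ultimately show ?thesis using ij by (intro exI[of _ "j - i"]) auto
  qed
  obtain m n :: nat where mn: "m > 0" "x [^] m \<in> C" "n > 0" "y [^] n \<in> C" using pw x y by meson
  then obtain k l :: int where "x [^] m = c [^] k" "y [^] n = c [^] l"
    using generate_pow[OF cG] unfolding C_def by auto
  then have "x [^] m \<otimes> y [^] n = y [^] n \<otimes> x [^] m" using cG by (metis int_pow_mult add.commute)
  then show ?thesis using that mn by blast
qed

section \<open>Copies of \<open>SL\<^sub>2(\<real>)\<close> preserving a complex geodesic\<close>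

text \<open>For positive \<open>v\<close> a copy of SU(1,1). The condition is that some
  representative fixes the vector \<open>v\<close> itself, which is stronger than fixing its point
  in the projective plane.\<close>

definition Gv :: "complex^3 \<Rightarrow> (complex^3^3) set set" where
  "Gv v = {cls A | A. A \<in> carrier SU_h \<and> A *v v = v}"

lemma carrier_SL2R: "X \<in> carrier SL2R \<longleftrightarrow> det X = 1" and SL2R_mult: "X \<otimes>\<^bsub>SL2R\<^esub> Y = X ** Y"
  by (simp_all add: SL2R_def)

lemma matrix_matrix_mult_2:
  "(A ** B) $ i $ j = A $ i $ 1 * B $ 1 $ j + A $ i $ (2::2) * B $ 2 $ j"
  by (simp add: matrix_matrix_mult_def sum_2)

lemma matrix_2_eqI:
  fixes A B :: "'a^2^2"
  assumes "A$1$1 = B$1$1" "A$1$2 = B$1$2" "A$2$1 = B$2$1" "A$2$2 = B$2$2" shows "A = B"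
  using assms by (simp add: vec_eq_iff forall_2)

lemma matrix_3_eqI:
  fixes A B :: "'a^3^3"
  assumes "A$1$1 = B$1$1" "A$1$2 = B$1$2" "A$1$3 = B$1$3" "A$2$1 = B$2$1" "A$2$2 = B$2$2" "A$2$3 = B$2$3"
    "A$3$1 = B$3$1" "A$3$2 = B$3$2" "A$3$3 = B$3$3" shows "A = B"
  using assms by (simp add: vec_eq_iff forall_3)

definition mat2 :: "'a::zero \<Rightarrow> 'a \<Rightarrow> 'a \<Rightarrow> 'a \<Rightarrow> 'a^2^2" where
  "mat2 a b c d = vector [vector [a, b], vector [c, d]]"

lemma mat2_nth [simp]: "mat2 a b c d $ 1 $ 1 = a" "mat2 a b c d $ 1 $ 2 = b" "mat2 a b c d $ 2 $ 1 = c" "mat2 a b c d $ 2 $ 2 = d"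
  by (simp_all add: mat2_def)

lemma mat2_mult: "mat2 a b c d ** mat2 a' b' c' d' = (mat2 (a*a' + b*c') (a*b' + b*d') (c*a' + d*c') (c*b' + d*d') :: real^2^2)"
  by (rule matrix_2_eqI) (simp_all add: matrix_matrix_mult_2)

lemma det_mat2: "det (mat2 a b c d :: real^2^2) = a * d - b * c"
  by (simp add: det_2)

text \<open>Elementary matrices are commutators with a diagonal matrix.\<close>

lemma SL2R_character_trivial:
  fixes f :: "real^2^2 \<Rightarrow> complex"
  assumes mult: "\<And>X Y. det X = 1 \<Longrightarrow> det Y = 1 \<Longrightarrow> f (X ** Y) = f X * f Y"
    and nz: "\<And>X. det X = 1 \<Longrightarrow> f X \<noteq> 0" and X: "det X = 1"
  shows "f X = 1"
proof -
  have u: "f (mat2 1 t 0 1) = 1" for t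
  proof -
    have "mat2 2 0 0 (1/2) ** mat2 1 (t/3) 0 1 = mat2 1 t 0 1 ** (mat2 1 (t/3) 0 1 ** mat2 2 0 0 (1/2) :: real^2^2)"
      by (simp add: mat2_mult)
    then have "f (mat2 2 0 0 (1/2)) * f (mat2 1 (t/3) 0 1) = f (mat2 1 t 0 1) * (f (mat2 1 (t/3) 0 1) * f (mat2 2 0 0 (1/2)))"
      using mult[of "mat2 2 0 0 (1/2)" "mat2 1 (t/3) 0 1"] mult[of "mat2 1 (t/3) 0 1" "mat2 2 0 0 (1/2)"]
        mult[of "mat2 1 t 0 1" "mat2 1 (t/3) 0 1 ** mat2 2 0 0 (1/2)"] by (auto simp: det_mat2 det_mul)
    then show ?thesis using nz[of "mat2 2 0 0 (1/2)"] nz[of "mat2 1 (t/3) 0 1"] by (simp add: det_mat2)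
  qed
  have l: "f (mat2 1 0 t 1) = 1" for t
  proof -
    have "mat2 (1/2) 0 0 2 ** mat2 1 0 (t/3) 1 = mat2 1 0 t 1 ** (mat2 1 0 (t/3) 1 ** mat2 (1/2) 0 0 2 :: real^2^2)"
      by (simp add: mat2_mult)
    then have "f (mat2 (1/2) 0 0 2) * f (mat2 1 0 (t/3) 1) = f (mat2 1 0 t 1) * (f (mat2 1 0 (t/3) 1) * f (mat2 (1/2) 0 0 2))"
      using mult[of "mat2 (1/2) 0 0 2" "mat2 1 0 (t/3) 1"] mult[of "mat2 1 0 (t/3) 1" "mat2 (1/2) 0 0 2"]
        mult[of "mat2 1 0 t 1" "mat2 1 0 (t/3) 1 ** mat2 (1/2) 0 0 2"] by (auto simp: det_mat2 det_mul)
    then show ?thesis using nz[of "mat2 (1/2) 0 0 2"] nz[of "mat2 1 0 (t/3) 1"] by (simp add: det_mat2)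
  qed
  have main: "f Y = 1" if Y: "det Y = 1" "Y $ 2 $ 1 \<noteq> 0" for Y
  proof -
    obtain p q r s where pq: "Y $ 1 $ 1 = p" "Y $ 1 $ 2 = q" "Y $ 2 $ 1 = r" "Y $ 2 $ 2 = s" by auto
    have r: "r \<noteq> 0" and d: "p * s - q * r = 1" using Y pq by (auto simp: det_2)
    have "q = p * ((s - 1) / r) + (p - 1) / r" using d r by (simp add: field_simps)
    then have "Y = mat2 1 ((p - 1) / r) 0 1 ** (mat2 1 0 r 1 ** mat2 1 ((s - 1) / r) 0 1)"
      using r by (intro matrix_2_eqI) (simp_all add: pq mat2_mult field_simps)
    then show ?thesis using mult u l by (simp add: det_mul det_mat2)
  qed
  show ?thesis
  proof (cases "X $ 2 $ 1 = 0")
    case False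
    then show ?thesis using main X by blast
  next
    case True
    then have "X $ 1 $ 1 \<noteq> 0" using X by (auto simp: det_2)
    then have "(mat2 1 0 1 1 ** X) $ 2 $ 1 \<noteq> 0" using True by (simp add: matrix_matrix_mult_2)
    moreover have "det (mat2 1 0 1 1 ** X) = 1" using X by (simp add: det_mul det_mat2)
    ultimately have "f (mat2 1 0 1 1 ** X) = 1" using main by blast
    then show ?thesis using mult[of "mat2 1 0 1 1" X] X l[of 1] by (simp add: det_mat2)
  qed
qed

text \<open>The vector exists because two linear conditions in dimension three have a common
  solution, and it is positive because it is orthogonal to the negative x. If a second independent
  one existed, its part y orthogonal to v would be positive too; in the orthogonal frame x, y, v the
  plane would then reduce to the line of x.\<close>

lemma plane_orthogonal_vector:
  assumes V: "vec.dim V = 2" and x: "x \<in> V" "herm x < 0"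
  obtains v where "herm v > 0" "\<And>b. b \<in> V \<Longrightarrow> hp b v = 0"
    "\<And>v'. (\<And>b. b \<in> V \<Longrightarrow> hp b v' = 0) \<Longrightarrow> \<exists>c. v' = c *s v"
proof -
  obtain B where B: "B \<subseteq> V" "V \<subseteq> vec.span B" "card B = 2" using vec.basis_exists[of V] V by metis
  then obtain b1 b2 where b: "B = {b1, b2}" by (meson card_2_iff)
  \<comment> \<open>The rows are the functionals pairing with the two basis vectors of the plane;
    the zero third row makes the matrix singular.\<close>
  define M :: "complex^3^3" where "M = vector [\<chi> i. hp (axis i 1) b1, \<chi> i. hp (axis i 1) b2, 0]"
  have Mv: "(M *v v) $ 1 = hp v b1" "(M *v v) $ 2 = hp v b2" for v
    by (simp_all add: M_def matrix_vector_mult_3 hp_axis) (simp_all add: hp_def algebra_simps)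
  have "det M = 0" by (simp add: M_def det_3)
  then have "\<not> invertible M" by (simp add: invertible_det_nz)
  then have "\<not> (\<exists>N. N ** M = mat 1)" using matrix_left_right_inverse invertible_def by blast
  then obtain v where v: "v \<noteq> 0" "M *v v = 0" by (auto simp: matrix_left_invertible_ker)
  then have vb: "hp v b1 = 0" "hp v b2 = 0" using Mv[of v] by simp_all
  have "vec.subspace {w. hp w v = 0}" by (auto simp: vec.subspace_def)
  moreover have "B \<subseteq> {w. hp w v = 0}" using vb b by (auto simp: cnj_hp[of v, symmetric])
  ultimately have orth: "hp b v = 0" if "b \<in> V" for b
    using vec.span_minimal[of B "{w. hp w v = 0}"] B(2) that by blast
  have vx: "hp v x = 0" using orth[OF x(1)] by (metis cnj_hp complex_cnj_zero)
  have pos: "herm v > 0" by (rule orthogonal_to_negative[OF x(2) vx v(1)])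
  have "\<exists>c. v' = c *s v" if v': "\<And>b. b \<in> V \<Longrightarrow> hp b v' = 0" for v'
  proof (rule ccontr)
    assume no: "\<not> (\<exists>c. v' = c *s v)"
    define y where "y = v' - (hp v' v / hp v v) *s v"
    have y0: "y \<noteq> 0" using no unfolding y_def by (metis eq_iff_diff_eq_0)
    have yV: "hp b y = 0" if "b \<in> V" for b using orth v' that by (simp add: y_def)
    have yv: "hp y v = 0" using pos by (simp add: y_def hp_self)
    have "hp y x = 0" using yV[OF x(1)] by (metis cnj_hp complex_cnj_zero)
    then have "herm y > 0" using orthogonal_to_negative[OF x(2)] y0 by blast
    have "V \<subseteq> vec.span {x}"
    proof
      fix b assume "b \<in> V"
      have "b = (hp b x / hp x x) *s x + (hp b y / hp y y) *s y + (hp b v / hp v v) *s v"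
        by (rule orthogonal_expansion)
           (use orth[OF x(1)] yV[OF x(1)] yv pos x \<open>herm y > 0\<close> in \<open>auto simp: hp_self\<close>)
      then have "b = (hp b x / hp x x) *s x" using yV orth \<open>b \<in> V\<close> by simp
      then show "b \<in> vec.span {x}" by (metis insertI1 vec.span_base vec.span_scale)
    qed
    then have "vec.dim V \<le> card {x}" by (rule vec.dim_le_card) simp
    then show False using V by simp
  qed
  then show ?thesis using that pos orth by blast
qed

lemma C_Fuchsian_image_subset_Gv:
  assumes \<phi>: "\<phi> \<in> hom SL2R PSU_h" and L: "projective_line L" "L \<inter> H2C \<noteq> {}"
    and pres: "\<forall>g \<in> \<phi> ` carrier SL2R. act g ` L = L"
  obtains v where "herm v > 0" "\<phi> ` carrier SL2R \<subseteq> Gv v"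
proof -
  obtain V where V: "vec.subspace V" "vec.dim V = 2" "L = proj ` (V - {0})"
    using L(1) by (auto simp: projective_line_def)
  obtain x0 y0 where "herm x0 < 0" "y0 \<in> V - {0}" "proj x0 = proj y0" using L(2) V(3) by (auto simp: H2C_def)
  then obtain c0 where "c0 \<noteq> 0" "x0 = c0 *s y0" by (auto simp: proj_eq_iff)
  then have x: "x0 \<in> V" "herm x0 < 0" using \<open>y0 \<in> V - {0}\<close> \<open>herm x0 < 0\<close> V(1) by (auto simp: vec.subspace_scale)
  obtain v where v: "herm v > 0" "\<And>b. b \<in> V \<Longrightarrow> hp b v = 0"
    "\<And>v'. (\<And>b. b \<in> V \<Longrightarrow> hp b v' = 0) \<Longrightarrow> \<exists>c. v' = c *s v"
    using plane_orthogonal_vector[OF V(2) x] by blast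
  have v0: "v \<noteq> 0" using v(1) by (auto simp: herm_def)
  have scale: "c = c'" if "c *s v = c' *s v" for c c' using that v0 by simp
  have eigen: "\<exists>c. A *v v = c *s v \<and> c \<noteq> 0" if A: "A \<in> carrier SU_h" "cls A \<in> \<phi> ` carrier SL2R" for A
  proof -
    have AL: "act (cls A) ` L = L" using pres A(2) by blast
    have "hp b (A *v v) = 0" if b: "b \<in> V" for b
    proof (cases "b = 0")
      case False
      then have "proj b \<in> act (cls A) ` L" using b AL V(3) by blast
      then obtain b' where "b' \<in> V - {0}" "proj b = act (cls A) (proj b')" unfolding V(3) by blast
      then have b': "b' \<in> V" "proj b = proj (A *v b')" by (auto simp: act_cls)
      then obtain c where "b = c *s (A *v b')" by (auto simp: proj_eq_iff)
      then show ?thesis using SU_h_hp[OF A(1), of b' v] v(2)[OF b'(1)] by simp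
    qed simp
    then obtain c where c: "A *v v = c *s v" using v(3) by blast
    have "hp (A *v v) (A *v v) \<noteq> 0" using SU_h_hp[OF A(1), of v v] v(1) by (simp add: hp_self)
    then show ?thesis using c by (intro exI[of _ c]) auto
  qed
  have "\<exists>A. A \<in> carrier SU_h \<and> \<phi> X = cls A" if "X \<in> carrier SL2R" for X
    using \<phi> that by (auto simp: hom_def Pi_def carrier_PSU_h)
  then obtain a where a: "\<And>X. det X = 1 \<Longrightarrow> a X \<in> carrier SU_h \<and> \<phi> X = cls (a X)"
    unfolding carrier_SL2R by metis
  have "\<exists>c. a X *v v = c *s v \<and> c \<noteq> 0" if "det X = 1" for X
  proof -
    have "cls (a X) \<in> \<phi> ` carrier SL2R" using a[OF that] that by (metis carrier_SL2R imageI)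
    then show ?thesis using a[OF that] eigen by blast
  qed
  then obtain l where l: "\<And>X. det X = 1 \<Longrightarrow> a X *v v = l X *s v \<and> l X \<noteq> 0" by metis
  \<comment> \<open>The chosen representatives multiply only up to a cube root of unity, and so do
    their eigenvalues on v; cubing produces a genuine character.\<close>
  have one: "l X ^ 3 = 1" if "det X = 1" for X
  proof (rule SL2R_character_trivial[of "\<lambda>X. l X ^ 3"])
    fix X Y :: "real^2^2" assume XY: "det X = 1" "det Y = 1"
    then have XY1: "det (X ** Y) = 1" by (simp add: det_mul)
    have "\<phi> (X ** Y) = \<phi> X \<otimes>\<^bsub>PSU_h\<^esub> \<phi> Y"
      using \<phi> XY by (auto simp: hom_def carrier_SL2R SL2R_mult)
    then have "cls (a (X ** Y)) = cls (a X ** a Y)" using a XY XY1 by (simp add: cls_mult)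
    then obtain w where w: "w ^ 3 = 1" "a (X ** Y) = mat w ** (a X ** a Y)" by (auto simp: cls_eq_iff)
    have "l (X ** Y) *s v = a (X ** Y) *v v" using l[OF XY1] by simp
    also have "\<dots> = w *s (a X *v (a Y *v v))" by (simp only: w(2) mat_mult_mult_vec matrix_vector_mul_assoc)
    also have "\<dots> = (w * (l Y * l X)) *s v" using l[OF XY(1)] l[OF XY(2)] by (simp add: vector_scalar_commute)
    finally have "l (X ** Y) = w * (l Y * l X)" using scale by blast
    then show "l (X ** Y) ^ 3 = l X ^ 3 * l Y ^ 3" using w(1) by (simp add: power_mult_distrib)
  qed (use l that in auto)
  have "\<phi> ` carrier SL2R \<subseteq> Gv v"
  proof
    fix g assume "g \<in> \<phi> ` carrier SL2R"
    then obtain X where X: "det X = 1" "g = \<phi> X" by (auto simp: carrier_SL2R)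
    \<comment> \<open>As the eigenvalue is now a cube root of unity, dividing by it selects another
      representative of the same class, and this one fixes v.\<close>
    define w where "w = inverse (l X)"
    have w3: "w ^ 3 = 1" using one[OF X(1)] by (simp add: w_def power_inverse)
    have eq: "cls (mat w ** a X) = cls (a X)" using w3 by (rule cls_eqI) simp
    have "mat w ** a X \<in> carrier SU_h" using a[OF X(1)] SU_h_mult mat_unit_root_carrier[OF w3] by blast
    moreover have "(mat w ** a X) *v v = v" using l[OF X(1)] by (simp add: mat_mult_mult_vec w_def)
    ultimately have "cls (mat w ** a X) \<in> Gv v" by (auto simp: Gv_def)
    then show "g \<in> Gv v" using eq X a by simp
  qed
  then show ?thesis using that v(1) by blast
qed

text \<open>The substitution \<open>z\<^sub>0 = \<i> y\<^sub>0\<close> turns \<open>- 2 Re (z\<^sub>0 cnj z\<^sub>2)\<close> into \<open>2 Im (y\<^sub>0 cnj y\<^sub>2)\<close>, which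
  \<open>SL\<^sub>2(\<real>)\<close> preserves.\<close>

definition std :: "real^2^2 \<Rightarrow> complex^3^3" where
  "std X = vector [vector [of_real (X$1$1), 0, \<i> * of_real (X$1$2)], vector [0, 1, 0],
                   vector [- \<i> * of_real (X$2$1), 0, of_real (X$2$2)]]"

lemma std_nth [simp]: "std X $ 1 $ 1 = of_real (X$1$1)" "std X $ 1 $ 2 = 0" "std X $ 1 $ 3 = \<i> * of_real (X$1$2)"
  "std X $ 2 $ 1 = 0" "std X $ 2 $ 2 = 1" "std X $ 2 $ 3 = 0"
  "std X $ 3 $ 1 = - \<i> * of_real (X$2$1)" "std X $ 3 $ 2 = 0" "std X $ 3 $ 3 = of_real (X$2$2)"
  by (simp_all add: std_def)

lemma std_mult: "std (X ** Y) = std X ** std Y"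
  by (rule matrix_3_eqI) (simp_all add: matrix_matrix_mult_2 matrix_matrix_mult_3 algebra_simps)

lemma std_carrier: assumes "det X = 1" shows "std X \<in> carrier SU_h"
proof -
  obtain p q r s where pq: "X $ 1 $ 1 = p" "X $ 1 $ 2 = q" "X $ 2 $ 1 = r" "X $ 2 $ 2 = s" by auto
  have d: "p * s - q * r = 1" using assms pq by (auto simp: det_2)
  have "complex_of_real p * of_real s - of_real q * of_real r = of_real (p * s - q * r)" by simp
  then have "det (std X) = 1" unfolding d by (simp add: det_3 pq algebra_simps)
  moreover have "herm (std X *v z) = herm z" for z
  proof -
    have "hp (std X *v z) (std X *v z) = - of_real (p * s - q * r) * (z$1 * cnj (z$3)) - of_real (p * s - q * r) * (z$3 * cnj (z$1)) + z$2 * cnj (z$2)"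
      by (simp add: hp_def matrix_vector_mult_3 pq algebra_simps)
    then have "hp (std X *v z) (std X *v z) = hp z z" unfolding d by (simp add: hp_def)
    then show ?thesis by (simp add: herm_eq_Re)
  qed
  ultimately show ?thesis by (simp add: carrier_SU_h)
qed

definition unstd :: "complex^3^3 \<Rightarrow> real^2^2" where
  "unstd A = mat2 (Re (A$1$1)) (Im (A$1$3)) (- Im (A$3$1)) (Re (A$3$3))"

lemma unstd_std: "unstd (std X) = X"
  by (rule matrix_2_eqI) (simp_all add: unstd_def)

abbreviation e2 :: "complex^3" where "e2 \<equiv> vector [0, 1, 0]"

text \<open>Both \<open>A\<close> and its adjoint fix \<open>e2\<close>, which leaves a 2 by 2 block
  on the outer coordinates. Unitarity and determinant one identify its adjoint with its inverse, and
  comparing entries forces a real diagonal and an imaginary antidiagonal.\<close>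

lemma stabilizer_e2_std:
  assumes A: "A \<in> carrier SU_h" and e: "A *v e2 = e2"
  shows "A = std (unstd A)" "det (unstd A) = 1"
proof -
  have "hadj A *v e2 = e2" using SU_h_inv[OF A, of e2 1] e by simp
  then have 1: "A$1$2 = 0" "A$2$2 = 1" "A$3$2 = 0" "A$2$1 = 0" "A$2$3 = 0"
    using e by (simp_all add: vec_eq_iff forall_3 matrix_vector_mult_3 hadj_def)
  obtain \<alpha> \<beta> \<gamma> \<delta> where g: "A$1$1 = \<alpha>" "A$1$3 = \<beta>" "A$3$1 = \<gamma>" "A$3$3 = \<delta>" by auto
  have "(hadj A ** A) $ i $ j = mat 1 $ i $ j" for i j using SU_h_hadj(2)[OF A] by simp
  from this[of 1 1] this[of 1 3] this[of 3 1] this[of 3 3]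
  have eqs: "cnj \<delta> * \<alpha> + cnj \<beta> * \<gamma> = 1" "cnj \<delta> * \<beta> + cnj \<beta> * \<delta> = 0"
    "cnj \<gamma> * \<alpha> + cnj \<alpha> * \<gamma> = 0" "cnj \<gamma> * \<beta> + cnj \<alpha> * \<delta> = 1"
    by (simp_all add: matrix_matrix_mult_3 hadj_def 1 g mat_def)
  have d: "\<alpha> * \<delta> - \<beta> * \<gamma> = 1" using A by (simp add: carrier_SU_h det_3 1 g)
  have 2: "cnj \<delta> = \<delta>" using eqs d by algebra
  have 3: "cnj \<beta> = - \<beta>" using eqs d by algebra
  have 4: "cnj \<gamma> = - \<gamma>" using eqs d by algebra
  have 5: "cnj \<alpha> = \<alpha>" using eqs d by algebra
  have r: "\<delta> = of_real (Re \<delta>)" "\<alpha> = of_real (Re \<alpha>)" "\<beta> = \<i> * of_real (Im \<beta>)" "\<gamma> = \<i> * of_real (Im \<gamma>)"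
    using 2 3 4 5 by (auto simp: complex_eq_iff)
  show "A = std (unstd A)"
    by (rule matrix_3_eqI) (use r in \<open>simp_all add: 1 g unstd_def\<close>)
  have "Re \<alpha> * Re \<delta> - Im \<beta> * - Im \<gamma> = Re (\<alpha> * \<delta> - \<beta> * \<gamma>)"
    using 2 3 4 5 by (simp add: complex_eq_iff)
  then show "det (unstd A) = 1" using d by (simp add: unstd_def det_mat2 g)
qed

section \<open>Stabilizers of positive vectors as embedded copies of SL(2, R)\<close>

lemma continuous_on_matrix:
  fixes f :: "'a::topological_space \<Rightarrow> 'b::topological_space^'n^'m"
  assumes "\<And>i j. continuous_on S (\<lambda>x. f x $ i $ j)" shows "continuous_on S f"
proof -
  have "continuous_on S (\<lambda>x. \<chi> i j. f x $ i $ j)" by (intro continuous_on_vec_lambda assms)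
  then show ?thesis by simp
qed

lemma closed_SL2R: "closed (carrier SL2R)"
proof -
  have "carrier SL2R = (\<lambda>X. det X) -` {1}" by (auto simp: carrier_SL2R)
  moreover have "continuous_on UNIV (\<lambda>X::real^2^2. det X)" unfolding det_2 by (intro continuous_intros)
  ultimately show ?thesis by (simp add: continuous_closed_vimage continuous_on_eq_continuous_at)
qed

lemma mem_Union_cls_iff:
  assumes "U \<subseteq> carrier PSU_h" shows "A \<in> \<Union>U \<longleftrightarrow> cls A \<in> U"
proof
  assume "A \<in> \<Union>U"
  then obtain C where C: "A \<in> C" "C \<in> U" by blast
  then obtain B where B: "C = cls B" using assms by (auto simp: carrier_PSU_h)
  then obtain w where "w ^ 3 = 1" "A = mat w ** B" using C by (auto simp: cls_def')
  then have "cls A = cls B" by (rule cls_eqI)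
  then show "cls A \<in> U" using B C by simp
qed (use mem_cls_self in blast)

lemma topspace_PSU_h: "topspace PSU_h_topology = carrier PSU_h"
proof
  show "topspace PSU_h_topology \<subseteq> carrier PSU_h"
    using openin_PSU_h_topology openin_topspace by blast
  have "\<Union>(carrier PSU_h) = carrier SU_h"
    using mem_Union_cls_iff[OF order_refl] carrier_of_cls cls_carrier by blast
  then have "openin PSU_h_topology (carrier PSU_h)" by (simp add: openin_PSU_h_topology)
  then show "carrier PSU_h \<subseteq> topspace PSU_h_topology" by (rule openin_subset)
qed

lemma closedin_PSU_h_topologyI:
  assumes F: "F \<subseteq> carrier PSU_h" and c: "closedin (top_of_set (carrier SU_h)) {A \<in> carrier SU_h. cls A \<in> F}"
  shows "closedin PSU_h_topology F"
proof -
  have "A \<in> \<Union>(carrier PSU_h - F) \<longleftrightarrow> A \<in> carrier SU_h - {A \<in> carrier SU_h. cls A \<in> F}" for A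
    using carrier_of_cls[of A] by (subst mem_Union_cls_iff) auto
  then have "\<Union>(carrier PSU_h - F) = carrier SU_h - {A \<in> carrier SU_h. cls A \<in> F}" by blast
  moreover have "openin (top_of_set (carrier SU_h)) (carrier SU_h - {A \<in> carrier SU_h. cls A \<in> F})"
    using c by (simp add: closedin_def)
  ultimately show ?thesis using F by (simp add: closedin_def topspace_PSU_h openin_PSU_h_topology)
qed

text \<open>The isometry \<open>witt\<close> carries \<open>e2\<close> to v / sqrt(h(v)) up to sign.
  Rescaling it to determinant one costs another scalar, so only the line of v is reached exactly;
  this suffices to conjugate stabilizers.\<close>

lemma SU_h_transitive_positive:
  assumes "herm v > 0" obtains g \<kappa> where "g \<in> carrier SU_h" "\<kappa> \<noteq> 0" "g *v e2 = \<kappa> *s v"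
proof -
  define y where "y = (1 / complex_of_real (sqrt (herm v))) *s v"
  have e2: "herm e2 = 1" by (simp add: herm_def)
  have "herm y = 1" using assms by (simp add: y_def herm_scale norm_divide power_divide)
  then have e: "herm e2 = herm y" "herm e2 \<noteq> 0" using e2 by simp_all
  obtain \<epsilon> where \<epsilon>: "\<epsilon> = 1 \<or> \<epsilon> = -1" "witt e2 (\<epsilon> *s y) *v e2 = \<epsilon> *s y"
    "\<And>u. herm (witt e2 (\<epsilon> *s y) *v u) = herm u" using isometry_up_to_sign[OF e] by blast
  obtain c where c: "c \<noteq> 0" "mat c ** witt e2 (\<epsilon> *s y) \<in> carrier SU_h"
    using isometry_scaled_SU_h[OF \<epsilon>(3)] .
  have "(mat c ** witt e2 (\<epsilon> *s y)) *v e2 = (c * \<epsilon> / of_real (sqrt (herm v))) *s v"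
    by (simp only: mat_mult_mult_vec \<epsilon>(2)) (simp add: y_def)
  moreover have "c * \<epsilon> / of_real (sqrt (herm v)) \<noteq> 0" using c \<epsilon>(1) assms by auto
  ultimately show ?thesis using that c(2) by blast
qed

text \<open>The standard copy fixing \<open>e2\<close> is transported by an element moving
  \<open>e2\<close> to the line of v. For the topology it is enough that the continuous injection
  \<phi> is closed, and this can be tested on preimages in \<open>SU_h\<close>.\<close>

lemma Gv_embedding:
  assumes v: "herm v > 0"
  obtains \<phi> L where "Lie_group_embedding \<phi>" "projective_line L" "L \<inter> H2C \<noteq> {}"
    "\<forall>g \<in> \<phi> ` carrier SL2R. act g ` L = L" "\<phi> ` carrier SL2R = Gv v"
proof -
  obtain g \<kappa> where g: "g \<in> carrier SU_h" "\<kappa> \<noteq> 0" "g *v e2 = \<kappa> *s v" using SU_h_transitive_positive[OF v] .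
  have v0: "v \<noteq> 0" using v by (auto simp: herm_def)
  note gi = SU_h_hadj[OF g(1)]
  have gi': "hadj g ** (g ** A) = A" "g ** (hadj g ** A) = A" for A :: "complex^3^3"
    using gi by (simp_all add: matrix_mul_assoc)
  have hv: "hadj g *v v = inverse \<kappa> *s e2"
  proof -
    have "\<kappa> *s (hadj g *v v) = hadj g *v (g *v e2)" by (simp add: g(3) vector_scalar_commute)
    also have "\<dots> = e2" using gi by (simp add: matrix_vector_mul_assoc)
    finally have "inverse \<kappa> *s (\<kappa> *s (hadj g *v v)) = inverse \<kappa> *s e2" by simp
    then show ?thesis using g(2) by simp
  qed
  define \<psi> where "\<psi> X = g ** (std X ** hadj g)" for X
  have std_e2: "std X *v e2 = e2" for X by (simp add: vec_eq_iff forall_3 matrix_vector_mult_3)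
  have \<psi>c: "\<psi> X \<in> carrier SU_h" if "det X = 1" for X
    unfolding \<psi>_def using g gi std_carrier[OF that] by (intro SU_h_mult)
  have \<psi>v: "\<psi> X *v v = v" for X
  proof -
    have "\<psi> X *v v = g *v (std X *v (hadj g *v v))" by (simp add: \<psi>_def matrix_vector_mul_assoc matrix_mul_assoc)
    then show ?thesis using g(2) by (simp add: hv vector_scalar_commute std_e2 g(3))
  qed
  have un: "unstd (hadj g ** (\<psi> X ** g)) = X" for X
  proof -
    have "hadj g ** (\<psi> X ** g) = std X ** (hadj g ** g)" by (simp add: \<psi>_def gi' flip: matrix_mul_assoc)
    then show ?thesis using gi by (simp add: unstd_std)
  qed
  have onto: "A = \<psi> (unstd (hadj g ** (A ** g))) \<and> det (unstd (hadj g ** (A ** g))) = 1"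
    if A: "A \<in> carrier SU_h" "A *v v = v" for A
  proof -
    have c: "hadj g ** (A ** g) \<in> carrier SU_h" using g gi A by (intro SU_h_mult)
    have "(hadj g ** (A ** g)) *v e2 = hadj g *v (A *v (g *v e2))" by (simp add: matrix_vector_mul_assoc matrix_mul_assoc)
    also have "\<dots> = e2" using g(2) by (simp add: g(3) vector_scalar_commute A(2) hv)
    finally have e: "(hadj g ** (A ** g)) *v e2 = e2" .
    note st = stabilizer_e2_std[OF c e]
    have "A = g ** ((hadj g ** (A ** g)) ** hadj g)" using gi by (simp add: matrix_mul_assoc) (simp add: gi flip: matrix_mul_assoc)
    then show ?thesis using st unfolding \<psi>_def by metis
  qed
  define \<phi> where "\<phi> X = cls (\<psi> X)" for X
  have img: "\<phi> ` carrier SL2R = Gv v"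
  proof
    show "\<phi> ` carrier SL2R \<subseteq> Gv v" using \<psi>c \<psi>v by (auto simp: \<phi>_def Gv_def carrier_SL2R)
    show "Gv v \<subseteq> \<phi> ` carrier SL2R" using onto by (force simp: \<phi>_def Gv_def carrier_SL2R)
  qed
  have eq1: "w = 1" if "w *s v = v" for w using that v0 by (metis vector_mul_rcancel vector_smult_lid)
  have hom: "\<phi> \<in> hom SL2R PSU_h"
  proof (rule homI)
    fix X assume "X \<in> carrier SL2R" then show "\<phi> X \<in> carrier PSU_h" using \<psi>c by (simp add: \<phi>_def carrier_SL2R)
  next
    fix X Y assume XY: "X \<in> carrier SL2R" "Y \<in> carrier SL2R"
    have "\<psi> (X ** Y) = \<psi> X ** \<psi> Y" by (simp add: \<psi>_def std_mult gi' flip: matrix_mul_assoc)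
    then show "\<phi> (X \<otimes>\<^bsub>SL2R\<^esub> Y) = \<phi> X \<otimes>\<^bsub>PSU_h\<^esub> \<phi> Y"
      using XY \<psi>c by (simp add: \<phi>_def SL2R_mult carrier_SL2R cls_mult)
  qed
  have inj: "inj_on \<phi> (carrier SL2R)"
  proof (rule inj_onI)
    fix X Y assume "\<phi> X = \<phi> Y"
    then obtain w where w: "\<psi> X = mat w ** \<psi> Y" by (auto simp: \<phi>_def cls_eq_iff)
    then have "w *s v = v" using \<psi>v[of X] \<psi>v[of Y] by (simp add: mat_mult_mult_vec)
    then have "w = 1" by (rule eq1)
    then have "\<psi> X = \<psi> Y" using w by simp
    then show "X = Y" using un by metis
  qed
  have cont\<psi>: "continuous_on S \<psi>" for S
  proof (rule continuous_on_matrix)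
    fix i j show "continuous_on S (\<lambda>X. \<psi> X $ i $ j)"
      unfolding \<psi>_def matrix_matrix_mult_3 std_nth by (intro continuous_intros)
  qed
  have cm: "continuous_map (top_of_set (carrier SL2R)) PSU_h_topology \<phi>"
    unfolding continuous_map_def
  proof (intro conjI allI impI)
    show "\<phi> \<in> topspace (top_of_set (carrier SL2R)) \<rightarrow> topspace PSU_h_topology"
      using hom by (auto simp: topspace_PSU_h hom_def)
    fix U assume U: "openin PSU_h_topology U"
    then have U1: "U \<subseteq> carrier PSU_h" "openin (top_of_set (carrier SU_h)) (\<Union>U)" by (auto simp: openin_PSU_h_topology)
    have "openin (top_of_set (carrier SL2R)) (carrier SL2R \<inter> \<psi> -` (\<Union>U))"
      by (rule continuous_openin_preimage[OF cont\<psi> _ U1(2)]) (use \<psi>c in \<open>auto simp: carrier_SL2R\<close>)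
    moreover have "{X \<in> topspace (top_of_set (carrier SL2R)). \<phi> X \<in> U} = carrier SL2R \<inter> \<psi> -` (\<Union>U)"
      using mem_Union_cls_iff[OF U1(1)] by (auto simp: \<phi>_def)
    ultimately show "openin (top_of_set (carrier SL2R)) {X \<in> topspace (top_of_set (carrier SL2R)). \<phi> X \<in> U}" by simp
  qed
  have "closed_map (top_of_set (carrier SL2R)) PSU_h_topology \<phi>"
    unfolding closed_map_def
  proof (intro allI impI)
    fix C assume "closedin (top_of_set (carrier SL2R)) C"
    then have C: "closed C" "C \<subseteq> carrier SL2R" using closed_SL2R by (auto simp: closedin_closed_eq)
    \<comment> \<open>The preimage of \<phi>(C) is the union of the sets \<open>E w\<close> over the
      three cube roots of unity: w A fixes v, and the real matrix read off from w A after transport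
      back to \<open>e2\<close> lies in C. Both conditions are closed.\<close>
    define E where "E w = {A :: complex^3^3. (mat w ** A) *v v = v} \<inter> (\<lambda>A. unstd (hadj g ** ((mat w ** A) ** g))) -` C" for w
    have "closed (E w)" for w
    proof -
      have "closed {A :: complex^3^3. (mat w ** A) *v v = v}"
      proof (rule closed_Collect_eq)
        have "continuous_on UNIV (\<lambda>A::complex^3^3. (\<chi> i. ((mat w ** A) *v v) $ i))"
          unfolding matrix_vector_mult_3 mat_mult_nth by (intro continuous_intros continuous_on_vec_lambda)
        then show "continuous_on UNIV (\<lambda>A::complex^3^3. (mat w ** A) *v v)" by simp
      qed (intro continuous_intros)
      moreover have "continuous_on UNIV (\<lambda>A::complex^3^3. unstd (hadj g ** ((mat w ** A) ** g)))"
      proof (rule continuous_on_matrix)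
        have 1: "continuous_on UNIV (\<lambda>A::complex^3^3. (hadj g ** ((mat w ** A) ** g)) $ k $ l)" for k l
          unfolding matrix_matrix_mult_3[of "hadj g"] matrix_matrix_mult_3[of _ g] mat_mult_nth by (intro continuous_intros)
        fix i j :: 2
        have "i = 1 \<or> i = 2" "j = 1 \<or> j = 2" using exhaust_2 by blast+
        then show "continuous_on UNIV (\<lambda>A. unstd (hadj g ** ((mat w ** A) ** g)) $ i $ j)"
          by (elim disjE) (simp_all add: unstd_def, (intro continuous_intros 1)+)
      qed
      ultimately show ?thesis unfolding E_def
        using C(1) by (intro closed_Int closed_vimage) auto
    qed
    moreover have "finite {w::complex. w ^ 3 = 1}" by (rule finite_roots_unity) simp
    ultimately have "closed (\<Union>w\<in>{w. w ^ 3 = 1}. E w)" by (intro closed_UN) auto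
    then have "closedin (top_of_set (carrier SU_h)) (carrier SU_h \<inter> (\<Union>w\<in>{w. w ^ 3 = 1}. E w))"
      by (rule closedin_closed_Int)
    moreover have "{A \<in> carrier SU_h. cls A \<in> \<phi> ` C} = carrier SU_h \<inter> (\<Union>w\<in>{w. w ^ 3 = 1}. E w)"
    proof -
      have "cls A \<in> \<phi> ` C \<longleftrightarrow> A \<in> (\<Union>w\<in>{w. w ^ 3 = 1}. E w)" if A: "A \<in> carrier SU_h" for A
      proof
        assume "cls A \<in> \<phi> ` C"
        then obtain X where X: "X \<in> C" "cls (\<psi> X) = cls A" by (auto simp: \<phi>_def)
        then obtain w where w: "w ^ 3 = 1" "\<psi> X = mat w ** A" by (auto simp: cls_eq_iff)
        then have "A \<in> E w" using \<psi>v[of X] un[of X] X(1) by (simp add: E_def)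
        then show "A \<in> (\<Union>w\<in>{w. w ^ 3 = 1}. E w)" using w by blast
      next
        assume "A \<in> (\<Union>w\<in>{w. w ^ 3 = 1}. E w)"
        then obtain w where w: "w ^ 3 = 1" "A \<in> E w" by blast
        have "mat w ** A \<in> carrier SU_h" by (rule SU_h_mult[OF mat_unit_root_carrier[OF w(1)] A])
        then have "mat w ** A = \<psi> (unstd (hadj g ** ((mat w ** A) ** g)))" using onto w(2) by (simp add: E_def)
        moreover have "cls (mat w ** A) = cls A" using w(1) by (rule cls_eqI) simp
        ultimately show "cls A \<in> \<phi> ` C" using w(2) unfolding \<phi>_def E_def by (metis (no_types, lifting) IntD2 image_eqI vimage_eq)
      qed
      then show ?thesis by blast
    qed
    ultimately show "closedin PSU_h_topology (\<phi> ` C)"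
      using C(2) hom by (intro closedin_PSU_h_topologyI) (auto simp: hom_def)
  qed
  then have emb: "Lie_group_embedding \<phi>"
    unfolding Lie_group_embedding_def using hom cm inj by (auto intro: injective_closed_imp_embedding_map)
  define V where "V = {x. hp x v = 0}"
  \<comment> \<open>Images of two orthogonal vectors of norms -2 and 2 in the complement of
    \<open>e2\<close>. They span the complement of v, and the first one shows that its projective
    line meets the complex hyperbolic plane.\<close>
  define x0 y0 where "x0 = g *v vector [1, 0, 1]" and "y0 = g *v vector [1, 0, -1]"
  have gh: "hp (g *v a) (g *v b) = hp a b" for a b by (rule SU_h_hp[OF g(1)])
  have h0: "hp x0 x0 = -2" "hp y0 y0 = 2" "hp x0 y0 = 0" "hp y0 x0 = 0"
    unfolding x0_def y0_def gh by (simp_all add: hp_def)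
  have "hp x0 (\<kappa> *s v) = 0" "hp y0 (\<kappa> *s v) = 0"
    unfolding x0_def y0_def g(3)[symmetric] gh by (simp_all add: hp_def)
  then have xv: "hp x0 v = 0" "hp y0 v = 0" using g(2) by simp_all
  have "vec.subspace V" by (auto simp: V_def vec.subspace_def)
  have Vspan: "V = vec.span {x0, y0}"
  proof
    show "V \<subseteq> vec.span {x0, y0}"
    proof
      fix b assume b: "b \<in> V"
      have "b = (hp b x0 / hp x0 x0) *s x0 + (hp b y0 / hp y0 y0) *s y0 + (hp b v / hp v v) *s v"
        by (rule orthogonal_expansion) (use h0 xv v in \<open>auto simp: hp_self[of v]\<close>)
      then have "b = (hp b x0 / hp x0 x0) *s x0 + (hp b y0 / hp y0 y0) *s y0" using b by (simp add: V_def)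
      then show "b \<in> vec.span {x0, y0}" by (metis insertI1 insertI2 vec.span_add vec.span_base vec.span_scale)
    qed
    show "vec.span {x0, y0} \<subseteq> V"
      by (rule vec.span_minimal) (use xv \<open>vec.subspace V\<close> in \<open>auto simp: V_def\<close>)
  qed
  have ne: "x0 \<noteq> y0" using h0 by force
  have "x0 \<notin> vec.span {y0}"
  proof
    assume "x0 \<in> vec.span {y0}"
    then obtain c where "x0 = c *s y0" by (auto simp: vec.span_singleton)
    then show False using h0 by simp
  qed
  moreover have "y0 \<noteq> 0" using h0 by auto
  ultimately have "vec.independent {x0, y0}" using ne by (simp add: vec.independent_insert)
  then have "vec.dim V = card {x0, y0}" unfolding Vspan by (rule vec.dim_span_eq_card_independent)
  then have dim: "vec.dim V = 2" using ne by simp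
  define L where "L = proj ` (V - {0})"
  have "projective_line L" unfolding projective_line_def L_def using \<open>vec.subspace V\<close> dim by blast
  moreover have "L \<inter> H2C \<noteq> {}"
  proof -
    have "x0 \<in> V - {0}" using xv h0 by (auto simp: V_def)
    then have "proj x0 \<in> L" unfolding L_def by (rule imageI)
    moreover have "herm x0 < 0" using h0 by (simp add: herm_eq_Re)
    then have "proj x0 \<in> H2C" by (auto simp: H2C_def)
    ultimately show ?thesis by blast
  qed
  moreover have "\<forall>h \<in> \<phi> ` carrier SL2R. act h ` L = L"
  proof
    fix h assume "h \<in> \<phi> ` carrier SL2R"
    then obtain A where A: "A \<in> carrier SU_h" "A *v v = v" "h = cls A" unfolding img Gv_def by auto
    have maps: "B *v x \<in> V - {0}" if "B \<in> carrier SU_h" "B *v v = v" "x \<in> V - {0}" for B x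
      using that SU_h_mult_nonzero SU_h_hp[of B x v] by (auto simp: V_def)
    have "hadj A *v v = v" using SU_h_inv[OF A(1), of v 1] A(2) by simp
    then have ret: "hadj A *v x \<in> V - {0}" if "x \<in> V - {0}" for x
      using maps[OF SU_h_hadj(1)[OF A(1)]] that by blast
    have inv: "A *v (hadj A *v x) = x" for x using SU_h_hadj(3)[OF A(1)] by (simp add: matrix_vector_mul_assoc)
    show "act h ` L = L"
    proof
      show "act h ` L \<subseteq> L"
      proof (rule image_subsetI)
        fix p assume "p \<in> L"
        then obtain x where x: "x \<in> V - {0}" "p = proj x" unfolding L_def by blast
        then have "act h p = proj (A *v x)" by (simp add: A(3) act_cls)
        then show "act h p \<in> L" using maps[OF A(1,2) x(1)] unfolding L_def by blast
      qed
      show "L \<subseteq> act h ` L"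
      proof
        fix p assume "p \<in> L"
        then obtain x where x: "x \<in> V - {0}" "p = proj x" unfolding L_def by blast
        then have "act h (proj (hadj A *v x)) = p" by (simp add: A(3) act_cls inv)
        moreover have "proj (hadj A *v x) \<in> L" using ret[OF x(1)] unfolding L_def by blast
        ultimately show "p \<in> act h ` L" by blast
      qed
    qed
  qed
  ultimately show ?thesis using that emb img by blast
qed

section \<open>Stabilizers in the Picard modular group\<close>

lemma matrix_add_rdistrib3: "((A :: complex^3^3) + B) ** C = A ** C + B ** C"
  by (simp add: vec_eq_iff matrix_matrix_mult_3 algebra_simps)

lemma mat_pull: "(A :: complex^3^3) ** (mat c ** B) = mat c ** (A ** B)"
  by (metis mat_commute matrix_mul_assoc)

lemma mat_comb: "mat c ** (mat e ** (A :: complex^3^3)) = mat (c * e) ** A"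
  by (simp add: matrix_mul_assoc mat_mult_mat)

lemma (in group) conjugate_subgroup:
  assumes A: "subgroup A G" and g: "g \<in> carrier G"
  shows "subgroup (conjugate G g A) G"
proof (rule subgroupI)
  have AG: "x \<in> carrier G" if "x \<in> A" for x using A that by (rule subgroup.mem_carrier)
  show "conjugate G g A \<subseteq> carrier G" using g AG by (auto simp: conjugate_def)
  show "conjugate G g A \<noteq> {}" using subgroup.one_closed[OF A] by (auto simp: conjugate_def)
  fix a assume "a \<in> conjugate G g A"
  then obtain x where x: "x \<in> A" "a = g \<otimes> x \<otimes> inv g" by (auto simp: conjugate_def)
  have "inv a = g \<otimes> inv x \<otimes> inv g" using x g AG[OF x(1)] by (simp add: inv_mult_group m_assoc)
  then show "inv a \<in> conjugate G g A" using x subgroup.m_inv_closed[OF A] by (auto simp: conjugate_def)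
  fix b assume "b \<in> conjugate G g A"
  then obtain y where y: "y \<in> A" "b = g \<otimes> y \<otimes> inv g" by (auto simp: conjugate_def)
  have "inv g \<otimes> (g \<otimes> (y \<otimes> inv g)) = y \<otimes> inv g" using g AG[OF y(1)] by (simp add: m_assoc[symmetric])
  then have "a \<otimes> b = g \<otimes> (x \<otimes> y) \<otimes> inv g" using x y g AG[OF x(1)] AG[OF y(1)] by (simp add: m_assoc)
  then show "a \<otimes> b \<in> conjugate G g A" using x y subgroup.m_closed[OF A] by (auto simp: conjugate_def)
qed

lemma (in group) conjugate_conjugate:
  assumes "A \<subseteq> carrier G" "g \<in> carrier G" "h \<in> carrier G"
  shows "conjugate G g (conjugate G h A) = conjugate G (g \<otimes> h) A"
  unfolding conjugate_def image_image
proof (rule image_cong)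
  fix x assume "x \<in> A"
  then show "g \<otimes> (h \<otimes> x \<otimes> inv h) \<otimes> inv g = g \<otimes> h \<otimes> x \<otimes> inv (g \<otimes> h)"
    using assms by (simp add: subset_iff m_assoc inv_mult_group)
qed simp

lemma subgroup_Gv: "subgroup (Gv v) PSU_h"
proof -
  interpret group PSU_h by (rule group_PSU_h)
  show ?thesis
  proof (rule subgroupI)
    show "Gv v \<subseteq> carrier PSU_h" by (auto simp: Gv_def)
    show "Gv v \<noteq> {}" using SU_h_one by (auto simp: Gv_def intro!: exI[of _ "mat 1"])
    fix a assume "a \<in> Gv v"
    then obtain A where A: "A \<in> carrier SU_h" "A *v v = v" "a = cls A" by (auto simp: Gv_def)
    have "hadj A *v v = v" using SU_h_inv[OF A(1), of v 1] A(2) by simp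
    then show "inv\<^bsub>PSU_h\<^esub> a \<in> Gv v" using SU_h_hadj(1)[OF A(1)] A by (auto simp: Gv_def cls_inv)
    fix b assume "b \<in> Gv v"
    then obtain B where B: "B \<in> carrier SU_h" "B *v v = v" "b = cls B" by (auto simp: Gv_def)
    have "(A ** B) *v v = v" using A B by (simp flip: matrix_vector_mul_assoc)
    then show "a \<otimes>\<^bsub>PSU_h\<^esub> b \<in> Gv v" using A B SU_h_mult by (auto simp: Gv_def cls_mult)
  qed
qed

lemma finite_matrices:
  assumes "finite (S :: 'a set)" shows "finite {A :: 'a^'n::finite^'m::finite. \<forall>i j. A $ i $ j \<in> S}"
proof -
  have "finite (UNIV \<rightarrow>\<^sub>E S :: ('m \<times> 'n \<Rightarrow> 'a) set)" using assms by (intro finite_PiE) auto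
  then have "finite ((\<lambda>f. \<chi> i j. f (i, j)) ` (UNIV \<rightarrow>\<^sub>E S :: ('m \<times> 'n \<Rightarrow> 'a) set))" by (rule finite_imageI)
  moreover have "{A :: 'a^'n^'m. \<forall>i j. A $ i $ j \<in> S} \<subseteq> (\<lambda>f. \<chi> i j. f (i, j)) ` (UNIV \<rightarrow>\<^sub>E S)"
  proof
    fix A :: "'a^'n^'m" assume "A \<in> {A. \<forall>i j. A $ i $ j \<in> S}"
    then have "(\<lambda>(i, j). A $ i $ j) \<in> UNIV \<rightarrow>\<^sub>E S" by auto
    moreover have "A = (\<chi> i j. (\<lambda>(i, j). A $ i $ j) (i, j))" by simp
    ultimately show "A \<in> (\<lambda>f. \<chi> i j. f (i, j)) ` (UNIV \<rightarrow>\<^sub>E S)" by blast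
  qed
  ultimately show ?thesis by (rule rev_finite_subset)
qed

section \<open>Integral matrices and the stabilizers of vectors\<close>

context imaginary_quadratic
begin

definition int_mat :: "complex^3^3 \<Rightarrow> bool" where "int_mat A \<longleftrightarrow> (\<forall>i j. A $ i $ j \<in> OK)"
definition int_vec :: "complex^3 \<Rightarrow> bool" where "int_vec v \<longleftrightarrow> (\<forall>i. v $ i \<in> OK)"

lemma int_mat_1: "int_mat (mat 1)" by (auto simp: int_mat_def mat_def)

lemma int_mat_mult: "int_mat A \<Longrightarrow> int_mat B \<Longrightarrow> int_mat (A ** B)"
  unfolding int_mat_def matrix_matrix_mult_3 by (intro allI OK_add OK_mult) auto

lemma int_mat_add: "int_mat A \<Longrightarrow> int_mat B \<Longrightarrow> int_mat (A + B)"
  unfolding int_mat_def by auto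

lemma int_mat_hadj: "int_mat A \<Longrightarrow> int_mat (hadj A)"
  unfolding int_mat_def forall_3 by (simp add: hadj_def)

lemma int_mat_vec: "int_mat A \<Longrightarrow> int_vec v \<Longrightarrow> int_vec (A *v v)"
  unfolding int_mat_def int_vec_def matrix_vector_mult_3 by (intro allI OK_add OK_mult) auto

lemma int_vec_add: "int_vec x \<Longrightarrow> int_vec y \<Longrightarrow> int_vec (x + y)"
  and int_vec_diff: "int_vec x \<Longrightarrow> int_vec y \<Longrightarrow> int_vec (x - y)"
  and int_vec_scale: "c \<in> OK \<Longrightarrow> int_vec y \<Longrightarrow> int_vec (c *s y)"
  by (auto simp: int_vec_def)

lemma hp_OK: "int_vec x \<Longrightarrow> int_vec y \<Longrightarrow> hp x y \<in> OK"
  unfolding hp_def int_vec_def by (intro OK_add OK_diff OK_mult OK_minus OK_cnj) auto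

text \<open>The trace only shows that twice the value is an integer. The value is therefore
  rational, and being an algebraic integer as well it lies in Z.\<close>

lemma herm_Ints: assumes "int_vec x" shows "herm x \<in> \<int>"
proof -
  have "complex_of_real (herm x) \<in> OK" using hp_OK[OF assms assms] by (simp add: hp_self)
  then have "algebraic_int (complex_of_real (herm x))" by (simp add: ring_of_integers_def)
  have "complex_of_real (2 * herm x) \<in> \<int>"
    using \<open>complex_of_real (herm x) \<in> OK\<close> unfolding OK_iff by simp
  then have "complex_of_real (2 * herm x) / 2 \<in> \<rat>" by (intro Rats_divide Ints_subset_Rats[THEN subsetD]) auto
  then have "complex_of_real (herm x) \<in> \<rat>" by simp
  then have "complex_of_real (herm x) \<in> \<int>"
    using rational_algebraic_int_is_int \<open>algebraic_int (complex_of_real (herm x))\<close> by blast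
  then show ?thesis by (simp only: of_real_in_Ints_iff)
qed

lemma int_vec_cr: "int_vec x \<Longrightarrow> int_vec y \<Longrightarrow> int_vec (cr x y)"
  unfolding int_vec_def forall_3 cr_def by simp

lemma Picard_eq: "Picard K = {cls A | A. A \<in> carrier SU_h \<and> int_mat A}"
  by (simp add: Picard_def int_mat_def cls_def)

lemma subgroup_Picard: "subgroup (Picard K) PSU_h"
proof -
  interpret group PSU_h by (rule group_PSU_h)
  show ?thesis
  proof (rule subgroupI)
    show "Picard K \<subseteq> carrier PSU_h" by (auto simp: Picard_eq)
    show "Picard K \<noteq> {}" using SU_h_one int_mat_1 by (auto simp: Picard_eq intro!: exI[of _ "mat 1"])
    fix a assume "a \<in> Picard K"
    then obtain A where A: "A \<in> carrier SU_h" "int_mat A" "a = cls A" by (auto simp: Picard_eq)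
    show "inv\<^bsub>PSU_h\<^esub> a \<in> Picard K" using SU_h_hadj(1)[OF A(1)] A int_mat_hadj by (auto simp: Picard_eq cls_inv)
    fix b assume "b \<in> Picard K"
    then obtain B where B: "B \<in> carrier SU_h" "int_mat B" "b = cls B" by (auto simp: Picard_eq)
    show "a \<otimes>\<^bsub>PSU_h\<^esub> b \<in> Picard K" using A B SU_h_mult int_mat_mult by (auto simp: Picard_eq cls_mult)
  qed
qed

definition Gam :: "complex^3 \<Rightarrow> (complex^3^3) set set" where "Gam v = Picard K \<inter> Gv v"

lemma subgroup_Gam: "subgroup (Gam v) PSU_h"
  unfolding Gam_def by (rule group.subgroups_Inter_pair[OF group_PSU_h subgroup_Picard subgroup_Gv])

text \<open>The integral representative and the one fixing \<open>v\<close> need not coincide; their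
  ratio is a cube root of unity, which becomes the eigenvalue of the integral one.\<close>

lemma GamE:
  assumes "g \<in> Gam v"
  obtains A w where "A \<in> carrier SU_h" "int_mat A" "g = cls A" "w ^ 3 = 1" "A *v v = w *s v"
proof -
  obtain A B where AB: "A \<in> carrier SU_h" "int_mat A" "g = cls A" "B *v v = v" "g = cls B"
    using assms by (auto simp: Gam_def Picard_eq Gv_def)
  then obtain w where w: "w ^ 3 = 1" "A = mat w ** B" using cls_eq_iff by metis
  then have "A *v v = w *s v" using AB(4) by (simp add: mat_mult_mult_vec)
  then show ?thesis using that AB w by blast
qed

lemma GamI:
  assumes "A \<in> carrier SU_h" "int_mat A" "w ^ 3 = 1" "A *v v = w *s v"
  shows "cls A \<in> Gam v"
proof -
  have w0: "w \<noteq> 0" using assms(3) by auto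
  have w3: "inverse w ^ 3 = 1" using assms(3) by (simp add: power_inverse)
  have eq: "cls (mat (inverse w) ** A) = cls A" using w3 by (rule cls_eqI) simp
  have "mat (inverse w) ** A \<in> carrier SU_h" using mat_unit_root_carrier[OF w3] assms(1) SU_h_mult by blast
  moreover have "(mat (inverse w) ** A) *v v = v" using assms(4) w0 by (simp add: mat_mult_mult_vec)
  ultimately have "cls A \<in> Gv v" using eq unfolding Gv_def by blast
  then show ?thesis using assms by (auto simp: Gam_def Picard_eq)
qed

lemma C_Fuchsian_Gam: assumes "herm v > 0" shows "C_Fuchsian K (Gam v)"
proof -
  obtain \<phi> L where "Lie_group_embedding \<phi>" "projective_line L" "L \<inter> H2C \<noteq> {}"
    "\<forall>g \<in> \<phi> ` carrier SL2R. act g ` L = L" "\<phi> ` carrier SL2R = Gv v" using Gv_embedding[OF assms] .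
  then show ?thesis unfolding C_Fuchsian_def Gam_def by metis
qed

lemma C_Fuchsian_subgroup:
  assumes "C_Fuchsian K \<Gamma>"
  obtains v where "herm v > 0" "\<Gamma> \<subseteq> Gam v" "subgroup \<Gamma> PSU_h"
proof -
  obtain \<phi> L where \<phi>: "Lie_group_embedding \<phi>" "projective_line L" "L \<inter> H2C \<noteq> {}"
    "\<forall>g \<in> \<phi> ` carrier SL2R. act g ` L = L" "\<Gamma> = Picard K \<inter> \<phi> ` carrier SL2R"
    using assms by (auto simp: C_Fuchsian_def)
  have hom: "\<phi> \<in> hom SL2R PSU_h" using \<phi>(1) by (simp add: Lie_group_embedding_def)
  obtain v where v: "herm v > 0" "\<phi> ` carrier SL2R \<subseteq> Gv v"
    using C_Fuchsian_image_subset_Gv[OF hom \<phi>(2-4)] .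
  have "group_hom SL2R PSU_h \<phi>"
    using hom group_SL2R group_PSU_h by (simp add: group_hom_def group_hom_axioms_def)
  then have "subgroup (\<phi> ` carrier SL2R) PSU_h" by (rule group_hom.img_is_subgroup)
  then have "subgroup \<Gamma> PSU_h"
    unfolding \<phi>(5) by (rule group.subgroups_Inter_pair[OF group_PSU_h subgroup_Picard])
  then show ?thesis using that v \<phi>(5) by (auto simp: Gam_def)
qed

text \<open>All elements act on the orthogonal frame v, z, \<open>cr v z\<close> by scalars of
  modulus one. Their matrix entries are thus bounded uniformly, and a disc contains finitely many
  elements of \<open>OK\<close>.\<close>

lemma finite_two_orthogonal_fixed_points:
  assumes v: "herm v > 0" and z: "herm z > 0" and vz: "hp v z = 0"
    and \<Gamma>: "\<And>g. g \<in> \<Gamma> \<Longrightarrow> \<exists>A \<mu> l. g = cls A \<and> A \<in> carrier SU_h \<and> int_mat A \<and> A *v v = \<mu> *s v \<and> A *v z = l *s z"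
  shows "finite \<Gamma>"
proof -
  define u where "u = cr v z"
  have hu: "herm u < 0" using v z vz by (simp add: u_def herm_cr)
  have o: "hp v z = 0" "hp v u = 0" "hp z u = 0" using vz by (simp_all add: u_def)
  have o': "hp z v = 0" "hp u v = 0" "hp u z = 0" using o by (metis cnj_hp complex_cnj_zero)+
  note ex = orthogonal_expansion[OF o, unfolded hp_self]
  \<comment> \<open>The triangle inequality bound for the entry in row i and column j, obtained by
    expanding the j-th basis vector in the frame.\<close>
  define R where "R i j = cmod (hp (axis j 1) v / hp v v * v $ i) + cmod (hp (axis j 1) z / hp z z * z $ i)
      + cmod (hp (axis j 1) u / hp u u * u $ i)" for i j
  define S where "S = (\<Sum>i\<in>UNIV. \<Sum>j\<in>UNIV. R i j)"
  have R0: "R i j \<ge> 0" for i j by (simp add: R_def)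
  have RS: "R i j \<le> S" for i j
  proof -
    have "R i j \<le> (\<Sum>j\<in>UNIV. R i j)" by (rule member_le_sum) (use R0 in auto)
    also have "\<dots> \<le> S" unfolding S_def by (rule member_le_sum) (use R0 in \<open>auto intro: sum_nonneg\<close>)
    finally show ?thesis .
  qed
  have bound: "cmod (A $ i $ j) \<le> S" if A: "A \<in> carrier SU_h" "A *v v = \<mu> *s v" "A *v z = l *s z" for A \<mu> l i j
  proof -
    have e1: "cmod c = 1" if c: "A *v b = c *s b" "herm b \<noteq> 0" for b c
    proof -
      have "herm (A *v b) = herm b" using A(1) by (simp add: carrier_SU_h)
      then have "(cmod c)\<^sup>2 = 1" using c by (simp add: herm_scale)
      then show ?thesis using power2_eq_iff_nonneg[of "cmod c" 1] by simp
    qed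
    have tri: "cmod (p + q + r) \<le> cmod p + cmod q + cmod r" for p q r
      using norm_triangle_ineq[of "p + q" r] norm_triangle_ineq[of p q] by linarith
    have m: "cmod \<mu> = 1" "cmod l = 1" using e1 A v z by auto
    have "\<mu> \<noteq> 0" "l \<noteq> 0" using m by auto
    have "cnj \<mu> * hp (A *v u) v = hp (A *v u) (A *v v)" by (simp add: A)
    then have uv: "hp (A *v u) v = 0" using o' \<open>\<mu> \<noteq> 0\<close> by (simp add: SU_h_hp[OF A(1)])
    have "cnj l * hp (A *v u) z = hp (A *v u) (A *v z)" by (simp add: A)
    then have uz: "hp (A *v u) z = 0" using o' \<open>l \<noteq> 0\<close> by (simp add: SU_h_hp[OF A(1)])
    define \<nu> where "\<nu> = hp (A *v u) u / hp u u"
    have "A *v u = (hp (A *v u) v / hp v v) *s v + (hp (A *v u) z / hp z z) *s z + (hp (A *v u) u / hp u u) *s u"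
      by (rule orthogonal_expansion[OF o]) (use v z hu in \<open>auto simp: hp_self\<close>)
    then have Au: "A *v u = \<nu> *s u" by (simp add: uv uz \<nu>_def)
    then have n: "cmod \<nu> = 1" using e1 hu by auto
    have "axis j 1 = (hp (axis j 1) v / hp v v) *s v + (hp (axis j 1) z / hp z z) *s z + (hp (axis j 1) u / hp u u) *s u"
      by (rule orthogonal_expansion[OF o]) (use v z hu in \<open>auto simp: hp_self\<close>)
    then have "A *v axis j 1 = (hp (axis j 1) v / hp v v) *s (A *v v) + (hp (axis j 1) z / hp z z) *s (A *v z) + (hp (axis j 1) u / hp u u) *s (A *v u)"
      by (metis (no_types) matrix_vector_right_distrib vector_scalar_commute)
    then have "(A *v axis j 1) $ i = \<mu> * (hp (axis j 1) v / hp v v * v $ i) + l * (hp (axis j 1) z / hp z z * z $ i) + \<nu> * (hp (axis j 1) u / hp u u * u $ i)"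
      by (simp add: A(2,3) Au mult_ac)
    moreover have "(A *v axis j 1) $ i = A $ i $ j" using exhaust_3[of j] by (auto simp: matrix_vector_mult_3 axis_def)
    ultimately have "cmod (A $ i $ j) \<le> cmod (\<mu> * (hp (axis j 1) v / hp v v * v $ i)) + cmod (l * (hp (axis j 1) z / hp z z * z $ i)) + cmod (\<nu> * (hp (axis j 1) u / hp u u * u $ i))"
      using tri by metis
    also have "\<dots> = R i j" unfolding R_def norm_mult[of \<mu>] norm_mult[of l] norm_mult[of \<nu>] m n by simp
    finally show ?thesis using RS order_trans by blast
  qed
  have "\<Gamma> \<subseteq> cls ` {A. \<forall>i j. A $ i $ j \<in> {x \<in> OK. cmod x \<le> S}}"
  proof
    fix g assume "g \<in> \<Gamma>"
    then obtain A \<mu> l where A: "g = cls A" "A \<in> carrier SU_h" "int_mat A" "A *v v = \<mu> *s v" "A *v z = l *s z" using \<Gamma> by blast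
    then have "\<forall>i j. A $ i $ j \<in> {x \<in> OK. cmod x \<le> S}" using bound by (auto simp: int_mat_def)
    then show "g \<in> cls ` {A. \<forall>i j. A $ i $ j \<in> {x \<in> OK. cmod x \<le> S}}" using A(1) by blast
  qed
  moreover have "finite {A :: complex^3^3. \<forall>i j. A $ i $ j \<in> {x \<in> OK. cmod x \<le> S}}"
    by (rule finite_matrices[OF finite_OK_disc])
  ultimately show ?thesis by (meson finite_imageI finite_subset)
qed

text \<open>\<open>\<Gamma>\<close> fixes some positive vector \<open>v\<close>. If \<open>v\<close> were orthogonal to \<open>z\<close>, then \<open>\<Gamma>\<close> would be finite; otherwise the
  eigenvalues on \<open>z\<close> and \<open>v\<close> agree, so that \<open>\<Gamma>\<close> lies in \<open>Gam z\<close>. Whether \<open>v\<close> and \<open>z\<close> are proportional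
  is immaterial.\<close>

lemma maximal_eq_Gam:
  assumes max: "maximal_nonelementary_C_Fuchsian K \<Gamma>" and z: "herm z > 0"
    and fix_z: "\<And>g. g \<in> \<Gamma> \<Longrightarrow> act g (proj z) = proj z"
  shows "\<Gamma> = Gam z"
proof -
  interpret group PSU_h by (rule group_PSU_h)
  have ne: "C_Fuchsian K \<Gamma>" "\<not> virtually_cyclic PSU_h \<Gamma>"
    using max by (auto simp: maximal_nonelementary_C_Fuchsian_def nonelementary_C_Fuchsian_def)
  obtain v where v: "herm v > 0" "\<Gamma> \<subseteq> Gam v" "subgroup \<Gamma> PSU_h" using C_Fuchsian_subgroup[OF ne(1)] .
  have z0: "z \<noteq> 0" using z by (auto simp: herm_def)
  have vz: "hp v z \<noteq> 0"
  proof
    assume vz: "hp v z = 0"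
    have "finite \<Gamma>"
    proof (rule finite_two_orthogonal_fixed_points[OF v(1) z vz])
      fix g assume g: "g \<in> \<Gamma>"
      then obtain A w where A: "A \<in> carrier SU_h" "int_mat A" "g = cls A" "A *v v = w *s v" using v(2) GamE by blast
      moreover have "\<exists>c. A *v z = c *s z" using fix_z[OF g] act_cls_fixes_iff[OF A(1) z0] A(3) by blast
      ultimately show "\<exists>A \<mu> l. g = cls A \<and> A \<in> carrier SU_h \<and> int_mat A \<and> A *v v = \<mu> *s v \<and> A *v z = l *s z" by blast
    qed
    then show False using virtually_cyclic_finite[OF v(3)] ne(2) by blast
  qed
  have "\<Gamma> \<subseteq> Gam z"
  proof
    fix g assume g: "g \<in> \<Gamma>"
    then have "g \<in> Gv v" "g \<in> Picard K" using v(2) by (auto simp: Gam_def)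
    then obtain A where A: "A \<in> carrier SU_h" "A *v v = v" "g = cls A" by (auto simp: Gv_def)
    obtain c where c: "A *v z = c *s z" using fix_z[OF g] act_cls_fixes_iff[OF A(1) z0] A(3) by blast
    have "cnj c * hp v z = hp v z" using SU_h_hp[OF A(1), of v z] A(2) c by simp
    then have "c = 1" using vz by simp
    then have "A *v z = z" using c by simp
    then show "g \<in> Gam z" using \<open>g \<in> Picard K\<close> A by (auto simp: Gam_def Gv_def)
  qed
  moreover have "\<not> virtually_cyclic PSU_h (Gam z)"
    using virtually_cyclic_subgroup[OF _ subgroup_Gam v(3) \<open>\<Gamma> \<subseteq> Gam z\<close>] ne(2) by blast
  then have "nonelementary_C_Fuchsian K (Gam z)" using C_Fuchsian_Gam[OF z] by (simp add: nonelementary_C_Fuchsian_def)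
  ultimately show ?thesis using max by (auto simp: maximal_nonelementary_C_Fuchsian_def)
qed

section \<open>Commensurability with the stabilizers of the points [-2D : 0 : 1]\<close>

lemma common_denominator:
  assumes "finite F" "F \<subseteq> K"
  shows "\<exists>N::nat. N > 0 \<and> (\<forall>x\<in>F. of_nat N * x \<in> OK)"
  using assms
proof (induction F rule: finite_induct)
  case empty
  show ?case by (rule exI[of _ 1]) simp
next
  case (insert x F)
  then obtain N :: nat where N: "N > 0" "\<forall>x\<in>F. of_nat N * x \<in> OK" by auto
  obtain c :: int where c: "c > 0" "of_int c * x \<in> Zs" using K_denominator insert.prems by blast
  have "of_int c * x \<in> OK" using c(2) by (auto simp: Zs_def)
  then have 1: "of_nat (nat c) * x \<in> OK" using c(1) by simp
  have "of_nat (N * nat c) * y \<in> OK" if "y \<in> insert x F" for y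
  proof (cases "y = x")
    case True
    then show ?thesis using OK_mult[OF OK_of_nat[of N] 1] by (simp add: mult.assoc)
  next
    case False
    then have "of_nat N * y \<in> OK" using N that by blast
    from OK_mult[OF OK_of_nat[of "nat c"] this] show ?thesis by (simp add: mult_ac)
  qed
  then show ?case using N c by (intro exI[of _ "N * nat c"]) auto
qed

lemma matrix_common_denominator:
  assumes "\<And>i j. (A :: complex^3^3) $ i $ j \<in> K"
  obtains N :: nat where "N > 0" "int_mat (mat (of_nat N) ** A)"
proof -
  have "finite (range (\<lambda>(i, j). A $ i $ j))" by simp
  moreover have "range (\<lambda>(i, j). A $ i $ j) \<subseteq> K" using assms by auto
  ultimately obtain N :: nat where "N > 0" "\<forall>x\<in>range (\<lambda>(i, j). A $ i $ j). of_nat N * x \<in> OK"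
    using common_denominator by blast
  then show ?thesis using that by (auto simp: int_mat_def mat_mult_nth)
qed

lemma matrix_residue_label:
  assumes "M > 0"
  obtains lab :: "complex^3^3 \<Rightarrow> (int \<times> int)^3^3" where "finite (range lab)"
    "\<And>A B. int_mat A \<Longrightarrow> int_mat B \<Longrightarrow> lab A = lab B \<Longrightarrow> \<exists>W. int_mat W \<and> A = B + mat (of_nat M) ** W"
proof -
  obtain l :: "complex \<Rightarrow> int \<times> int" where l: "finite (range l)"
    "\<And>x y. x \<in> OK \<Longrightarrow> y \<in> OK \<Longrightarrow> l x = l y \<Longrightarrow> \<exists>w\<in>OK. x - y = of_nat M * w"
    using OK_residue_label[OF assms] by blast
  define lab where "lab A = (\<chi> i j. l (A $ i $ j))" for A :: "complex^3^3"
  show ?thesis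
  proof
    have "range lab \<subseteq> {B. \<forall>i j. B $ i $ j \<in> range l}" by (auto simp: lab_def)
    then show "finite (range lab)" using finite_matrices[OF l(1)] by (rule finite_subset)
    fix A B assume AB: "int_mat A" "int_mat B" "lab A = lab B"
    have "\<exists>w. w \<in> OK \<and> A $ i $ j - B $ i $ j = of_nat M * w" for i j
    proof -
      have "lab A $ i $ j = lab B $ i $ j" using AB(3) by simp
      then have "l (A $ i $ j) = l (B $ i $ j)" by (simp add: lab_def)
      then show ?thesis using l(2)[of "A $ i $ j" "B $ i $ j"] AB(1,2) unfolding int_mat_def by blast
    qed
    then obtain w where w: "\<And>i j. w i j \<in> OK \<and> A $ i $ j - B $ i $ j = of_nat M * w i j" by metis
    have "A $ i $ j = B $ i $ j + of_nat M * w i j" for i j using w[of i j] by (simp add: algebra_simps)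
    then have "A = B + mat (of_nat M) ** (\<chi> i j. w i j)" by (simp add: vec_eq_iff mat_mult_nth)
    moreover have "int_mat (\<chi> i j. w i j)" using w by (simp add: int_mat_def)
    ultimately show "\<exists>W. int_mat W \<and> A = B + mat (of_nat M) ** W" by blast
  qed
qed

text \<open>The deviation of the conjugate from the identity is (N P) W (N Q): a congruence modulo
  N^2 provides one factor N for the denominators of \<open>P\<close> and one for those of
  \<open>Q\<close>.\<close>

lemma int_mat_conj_congruent:
  assumes W: "int_mat W" and X: "X = mat 1 + mat (of_nat (N * N)) ** W"
    and P: "int_mat (mat (of_nat N) ** P)" and Q: "int_mat (mat (of_nat N) ** Q)" and PQ: "P ** Q = mat 1"
  shows "int_mat (P ** (X ** Q))"
proof -
  have "P ** ((mat (of_nat (N * N)) ** W) ** Q) = (mat (of_nat N) ** P) ** (W ** (mat (of_nat N) ** Q))"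
    by (simp add: mat_pull[of P] mat_pull[of W] mat_comb flip: matrix_mul_assoc)
  then have "P ** (X ** Q) = mat 1 + (mat (of_nat N) ** P) ** (W ** (mat (of_nat N) ** Q))"
    by (simp add: X matrix_add_ldistrib matrix_add_rdistrib3 PQ)
  then show ?thesis using int_mat_add[OF int_mat_1] int_mat_mult W P Q by simp
qed

lemma int_mat_congruent_quotient:
  assumes "int_mat A" "int_mat B" "B \<in> carrier SU_h" "int_mat W" "A = B + mat c ** W"
  shows "int_mat (W ** hadj B)" "A ** hadj B = mat 1 + mat c ** (W ** hadj B)"
  using assms SU_h_hadj[OF assms(3)] int_mat_mult int_mat_hadj
  by (simp_all add: matrix_add_rdistrib3 matrix_mul_assoc)

lemma subgroup_Picard_stab: "subgroup (Picard_stab K n) PSU_h"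
proof -
  interpret group PSU_h by (rule group_PSU_h)
  let ?z = "vector [- of_nat n, 0, 1] :: complex^3"
  have z0: "?z \<noteq> 0" by (simp add: vec_eq_iff forall_3)
  show ?thesis
  proof (rule subgroupI)
    show "Picard_stab K n \<subseteq> carrier PSU_h" by (auto simp: Picard_stab_def Picard_eq)
    have "cls (mat 1) \<in> Picard_stab K n" using SU_h_one int_mat_1 by (auto simp: Picard_stab_def Picard_eq act_cls)
    then show "Picard_stab K n \<noteq> {}" by blast
    fix a assume "a \<in> Picard_stab K n"
    then have a: "a \<in> Picard K" "act a (proj ?z) = proj ?z" by (auto simp: Picard_stab_def)
    then obtain A where A: "A \<in> carrier SU_h" "a = cls A" by (auto simp: Picard_eq)
    obtain c where c: "A *v ?z = c *s ?z" using a(2) act_cls_fixes_iff[OF A(1) z0] A(2) by blast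
    have c0: "c \<noteq> 0" using SU_h_mult_nonzero[OF A(1) z0] c by auto
    have "inv\<^bsub>PSU_h\<^esub> a \<in> Picard K" using a(1) subgroup_Picard by (simp add: subgroup.m_inv_closed)
    moreover have "act (inv\<^bsub>PSU_h\<^esub> a) (proj ?z) = proj ?z"
      using SU_h_inv[OF A(1) c c0] act_cls_fixes_iff[OF SU_h_hadj(1)[OF A(1)] z0] A by (auto simp: cls_inv)
    ultimately show "inv\<^bsub>PSU_h\<^esub> a \<in> Picard_stab K n" by (simp add: Picard_stab_def)
    fix b assume "b \<in> Picard_stab K n"
    then have b: "b \<in> Picard K" "act b (proj ?z) = proj ?z" by (auto simp: Picard_stab_def)
    then obtain B where B: "B \<in> carrier SU_h" "b = cls B" by (auto simp: Picard_eq)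
    obtain c' where c': "B *v ?z = c' *s ?z" using b(2) act_cls_fixes_iff[OF B(1) z0] B(2) by blast
    have "(A ** B) *v ?z = (c' * c) *s ?z" by (simp only: matrix_vector_mul_assoc[symmetric] c' vector_scalar_commute c vector_smult_assoc)
    then have "act (cls (A ** B)) (proj ?z) = proj ?z" using act_cls_fixes_iff[OF SU_h_mult[OF A(1) B(1)] z0] by blast
    moreover have "a \<otimes>\<^bsub>PSU_h\<^esub> b \<in> Picard K" using a(1) b(1) subgroup_Picard by (simp add: subgroup.m_closed)
    ultimately show "a \<otimes>\<^bsub>PSU_h\<^esub> b \<in> Picard_stab K n" using A B by (simp add: Picard_stab_def cls_mult)
  qed
qed

text \<open>The scalar c may lie outside \<open>K\<close>, but it cancels in the conjugation, which
  is therefore computed by \<open>T\<close>, whose entries lie in \<open>K\<close> in the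
  application.\<close>

lemma conj_scaled_isometry:
  assumes T: "\<And>u. herm (T *v u) = herm u" and c: "c \<noteq> 0" "mat c ** T \<in> carrier SU_h" and X: "X \<in> carrier SU_h"
  shows "cls (mat c ** T) \<otimes>\<^bsub>PSU_h\<^esub> cls X \<otimes>\<^bsub>PSU_h\<^esub> inv\<^bsub>PSU_h\<^esub> cls (mat c ** T) = cls (T ** (X ** hadj T))"
proof -
  have "(mat c ** T) ** (mat (inverse c) ** hadj T) = mat 1"
    using c(1) isometry_hadj(2)[OF T] by (simp add: mat_pull[of T] mat_comb mat_mult_mat flip: matrix_mul_assoc)
  then have "hadj (mat c ** T) = hadj (mat c ** T) ** ((mat c ** T) ** (mat (inverse c) ** hadj T))" by simp
  also have "\<dots> = mat (inverse c) ** hadj T" using SU_h_hadj(2)[OF c(2)] by (simp add: matrix_mul_assoc)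
  finally have h: "hadj (mat c ** T) = mat (inverse c) ** hadj T" .
  have "((mat c ** T) ** X) ** hadj (mat c ** T) = T ** (X ** hadj T)"
    unfolding h using c(1) by (simp add: mat_pull[of T] mat_pull[of X] mat_comb flip: matrix_mul_assoc)
  then show ?thesis using c X SU_h_mult SU_h_hadj(1) by (simp add: cls_inv cls_mult)
qed

text \<open>Residues modulo N^2, with N a common denominator of the isometry and its inverse, label
  the elements of both groups. Two elements with equal labels have a quotient whose conjugate is
  integral again, and this quotient gives an element of the intersection.\<close>

lemma commensurable_Gam:
  assumes D: "D > 0" and z: "int_vec z" "herm z = real D"
  shows "commensurable_up_to_conjugacy PSU_h (Gam z) (Picard_stab K (2 * D))"
proof -
  interpret group PSU_h by (rule group_PSU_h)
  define z' :: "complex^3" where "z' = vector [- of_nat (2 * D), 0, 1]"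
  have z'0: "z' \<noteq> 0" by (simp add: z'_def vec_eq_iff forall_3)
  have z'int: "int_vec z'" by (simp add: int_vec_def forall_3 z'_def)
  have hz': "herm z' = 4 * real D" by (simp add: herm_def z'_def)
  have h: "herm (2 *s z) = herm z'" "herm (2 *s z) \<noteq> 0" using D z(2) hz' by (simp_all add: herm_scale)
  obtain \<epsilon> where \<epsilon>: "\<epsilon> = 1 \<or> \<epsilon> = -1" "witt (2 *s z) (\<epsilon> *s z') *v (2 *s z) = \<epsilon> *s z'"
    "\<And>u. herm (witt (2 *s z) (\<epsilon> *s z') *v u) = herm u"
    using isometry_up_to_sign[OF h] by blast
  define T where "T = witt (2 *s z) (\<epsilon> *s z')"
  define U where "U = hadj T"
  have T: "herm (T *v u) = herm u" for u using \<epsilon>(3) by (simp add: T_def)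
  have TU: "T ** U = mat 1" "U ** T = mat 1" unfolding U_def using isometry_hadj[OF T] by auto
  have U: "herm (U *v u) = herm u" for u using isometry_inverse[OF T TU(1)] .
  have TU': "T ** (U ** A) = A" "U ** (T ** A) = A" for A :: "complex^3^3" using TU by (simp_all add: matrix_mul_assoc)
  have TUv: "T *v (U *v x) = x" "U *v (T *v x) = x" for x using TU by (simp_all add: matrix_vector_mul_assoc)
  have e0: "\<epsilon> \<noteq> 0" "\<epsilon> \<in> K" using \<epsilon>(1) K_Rats[of "-1"] by auto
  have Tz: "T *v z = (\<epsilon> / 2) *s z'"
  proof -
    have "2 *s (T *v z) = \<epsilon> *s z'" using \<epsilon>(2) by (simp add: T_def vector_scalar_commute)
    then have "(1/2) *s (2 *s (T *v z)) = (1/2) *s (\<epsilon> *s z')" by (simp only:)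
    then show ?thesis by simp
  qed
  have Uz': "U *v z' = (2 / \<epsilon>) *s z"
  proof -
    have "(2 / \<epsilon>) *s (U *v (T *v z)) = U *v z'" unfolding Tz using e0 by (simp add: vector_scalar_commute)
    then show ?thesis by (simp add: TUv)
  qed
  have xK: "(2 *s z - \<epsilon> *s z') $ i \<in> K" for i
    using z(1) z'int OK_imp_K e0(2) by (auto simp: int_vec_def)
  have hpK: "hp x y \<in> K" if xy: "\<And>i. x $ i \<in> K" "\<And>i. y $ i \<in> K" for x y
    unfolding hp_def using xy by (intro K_add K_diff K_mult K_minus K_cnj)
  have TK: "T $ i $ j \<in> K" for i j
  proof -
    have "hp (axis j 1) (2 *s z - \<epsilon> *s z') \<in> K" by (rule hpK) (auto simp: axis_def xK[simplified] intro: xK)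
    moreover have "hp (2 *s z) (2 *s z - \<epsilon> *s z') \<in> K"
      by (rule hpK[OF _ xK]) (use z(1) OK_imp_K in \<open>auto simp: int_vec_def\<close>)
    ultimately show ?thesis unfolding T_def witt_def using xK[of i] by (simp del: vector_minus_component)
  qed
  have UK: "U $ i $ j \<in> K" for i j
  proof -
    have "\<forall>i j. U $ i $ j \<in> K" unfolding forall_3 U_def hadj_def using TK by simp
    then show ?thesis by blast
  qed
  obtain N1 :: nat where N1: "N1 > 0" "int_mat (mat (of_nat N1) ** T)" using matrix_common_denominator[OF TK] .
  obtain N2 :: nat where N2: "N2 > 0" "int_mat (mat (of_nat N2) ** U)" using matrix_common_denominator[OF UK] .
  define N where "N = N1 * N2"
  have NT: "int_mat (mat (of_nat N) ** T)" "int_mat (mat (of_nat N) ** U)"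
  proof -
    have "of_nat N * T $ i $ j = of_nat N2 * (of_nat N1 * T $ i $ j)" "of_nat N * U $ i $ j = of_nat N1 * (of_nat N2 * U $ i $ j)" for i j
      by (simp_all add: N_def mult_ac)
    then show "int_mat (mat (of_nat N) ** T)" "int_mat (mat (of_nat N) ** U)"
      using N1(2) N2(2) unfolding int_mat_def mat_mult_nth by (metis OK_mult OK_of_nat)+
  qed
  have "N * N > 0" using N1 N2 by (simp add: N_def)
  then obtain lab :: "complex^3^3 \<Rightarrow> (int \<times> int)^3^3" where lab: "finite (range lab)"
    "\<And>A B. int_mat A \<Longrightarrow> int_mat B \<Longrightarrow> lab A = lab B \<Longrightarrow> \<exists>W. int_mat W \<and> A = B + mat (of_nat (N * N)) ** W"
    using matrix_residue_label by blast
  \<comment> \<open>Equal labels make the quotient congruent to the identity modulo N^2, so that its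
    conjugates in both directions are integral.\<close>
  have key: "int_mat (T ** ((A ** hadj B) ** U))" "int_mat (U ** ((A ** hadj B) ** T))"
    if AB: "int_mat A" "int_mat B" "lab A = lab B" "B \<in> carrier SU_h" for A B
  proof -
    obtain W where W: "int_mat W" "A = B + mat (of_nat (N * N)) ** W" using lab(2)[OF AB(1-3)] by blast
    note q = int_mat_congruent_quotient[OF AB(1,2,4) W]
    show "int_mat (T ** ((A ** hadj B) ** U))" by (rule int_mat_conj_congruent[OF q NT TU(1)])
    show "int_mat (U ** ((A ** hadj B) ** T))" by (rule int_mat_conj_congruent[OF q NT(2,1) TU(2)])
  qed
  have detTU: "det T * det U = 1" using TU(1) by (metis det_I det_mul)
  have TXU: "T ** (X ** U) \<in> carrier SU_h" "U ** (X ** T) \<in> carrier SU_h" if X: "X \<in> carrier SU_h" for X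
  proof -
    have "det (T ** (X ** U)) = 1" "det (U ** (X ** T)) = 1"
      using X detTU by (simp_all add: det_mul carrier_SU_h mult.commute)
    then show "T ** (X ** U) \<in> carrier SU_h" "U ** (X ** T) \<in> carrier SU_h"
      using X T U by (simp_all add: carrier_SU_h flip: matrix_vector_mul_assoc)
  qed
  obtain c where c: "c \<noteq> 0" "mat c ** T \<in> carrier SU_h" using isometry_scaled_SU_h[OF T] .
  define g where "g = cls (mat c ** T)"
  have g: "g \<in> carrier PSU_h" using c by (simp add: g_def)
  have conj: "g \<otimes>\<^bsub>PSU_h\<^esub> cls X \<otimes>\<^bsub>PSU_h\<^esub> inv\<^bsub>PSU_h\<^esub> g = cls (T ** (X ** U))" if "X \<in> carrier SU_h" for X
    unfolding g_def U_def by (rule conj_scaled_isometry[OF T c that])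
  define A where "A = conjugate PSU_h g (Gam z)"
  define B where "B = Picard_stab K (2 * D)"
  have Asg: "subgroup A PSU_h" unfolding A_def by (rule conjugate_subgroup[OF subgroup_Gam g])
  have Bsg: "subgroup B PSU_h" unfolding B_def by (rule subgroup_Picard_stab)
  have ABsg: "subgroup (A \<inter> B) PSU_h" by (rule subgroups_Inter_pair[OF Asg Bsg])
  have BI: "cls Y \<in> B" if Y: "Y \<in> carrier SU_h" "int_mat Y" "Y *v z' = l *s z'" for Y l
  proof -
    have "act (cls Y) (proj z') = proj z'" using act_cls_fixes_iff[OF Y(1) z'0] Y(3) by blast
    then show ?thesis using Y(1,2) unfolding B_def Picard_stab_def Picard_eq z'_def by blast
  qed
  define PA where "PA x X \<longleftrightarrow> X \<in> carrier SU_h \<and> int_mat X \<and> x = cls (T ** (X ** U)) \<and> (\<exists>w. w ^ 3 = 1 \<and> X *v z = w *s z)" for x X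
  have PA: "\<exists>X. PA x X" if x: "x \<in> A" for x
  proof -
    obtain y where y: "y \<in> Gam z" "x = g \<otimes>\<^bsub>PSU_h\<^esub> y \<otimes>\<^bsub>PSU_h\<^esub> inv\<^bsub>PSU_h\<^esub> g" using x by (auto simp: A_def conjugate_def)
    obtain X w where X: "X \<in> carrier SU_h" "int_mat X" "y = cls X" "w ^ 3 = 1" "X *v z = w *s z" using GamE[OF y(1)] .
    then show ?thesis unfolding PA_def using conj[OF X(1)] y(2) by blast
  qed
  have AI: "x \<in> A" if "PA x X" for x X
  proof -
    obtain w where X: "X \<in> carrier SU_h" "int_mat X" "x = cls (T ** (X ** U))" "w ^ 3 = 1" "X *v z = w *s z"
      using \<open>PA x X\<close> by (auto simp: PA_def)
    have "cls X \<in> Gam z" using X by (intro GamI)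
    then show ?thesis unfolding A_def conjugate_def X(3) conj[OF X(1), symmetric] by blast
  qed
  define ch where "ch x = (SOME X. PA x X)" for x
  have ch: "PA x (ch x)" if "x \<in> A" for x unfolding ch_def by (rule someI_ex[OF PA[OF that]])
  have fA: "finite_index PSU_h (A \<inter> B) A"
  proof (rule finite_indexI[OF Asg ABsg, where f = "\<lambda>x. lab (ch x)"])
    show "finite ((\<lambda>x. lab (ch x)) ` A)" using lab(1) by (rule rev_finite_subset) auto
    fix x y assume xy: "x \<in> A" "y \<in> A" "lab (ch x) = lab (ch y)"
    obtain cx where cx: "PA x cx" "lab cx = lab (ch x)" using ch[OF xy(1)] by blast
    obtain cy where cy: "PA y cy" "lab cy = lab (ch y)" using ch[OF xy(2)] by blast
    have labs: "lab cx = lab cy" using cx cy xy(3) by simp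
    have X: "cx \<in> carrier SU_h" "int_mat cx" "x = cls (T ** (cx ** U))" using cx(1) by (auto simp: PA_def)
    have Y: "cy \<in> carrier SU_h" "int_mat cy" "y = cls (T ** (cy ** U))" using cy(1) by (auto simp: PA_def)
    obtain w w' where w: "w ^ 3 = 1" "cx *v z = w *s z" "w' ^ 3 = 1" "cy *v z = w' *s z"
      using cx(1) cy(1) by (auto simp: PA_def)
    have w'0: "w' \<noteq> 0" using w(3) by auto
    define Q where "Q = cx ** hadj cy"
    have Q: "Q \<in> carrier SU_h" unfolding Q_def by (rule SU_h_mult[OF X(1) SU_h_hadj(1)[OF Y(1)]])
    have "cls (T ** (Q ** U)) \<otimes>\<^bsub>PSU_h\<^esub> y = x"
    proof -
      have "(T ** (Q ** U)) ** (T ** (cy ** U)) = T ** (cx ** ((hadj cy ** cy) ** U))"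
        unfolding Q_def by (simp add: TU' flip: matrix_mul_assoc)
      also have "\<dots> = T ** (cx ** U)" using SU_h_hadj(2)[OF Y(1)] by simp
      finally show ?thesis unfolding X(3) Y(3) cls_mult[OF TXU(1)[OF Q] TXU(1)[OF Y(1)]] by (rule arg_cong)
    qed
    moreover have "cls (T ** (Q ** U)) \<in> carrier PSU_h" "y \<in> carrier PSU_h"
      unfolding Y(3) using TXU(1)[OF Q] TXU(1)[OF Y(1)] by auto
    ultimately have eq: "x \<otimes>\<^bsub>PSU_h\<^esub> inv\<^bsub>PSU_h\<^esub> y = cls (T ** (Q ** U))"
      by (auto simp: m_assoc)
    have "int_mat (T ** (Q ** U))" unfolding Q_def by (rule key(1)[OF X(2) Y(2) labs Y(1)])
    moreover have "Q *v z = (inverse w' * w) *s z"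
      unfolding Q_def by (simp only: matrix_vector_mul_assoc[symmetric] SU_h_inv[OF Y(1) w(4) w'0] vector_scalar_commute w(2) vector_smult_assoc)
    then have "(T ** (Q ** U)) *v z' = (inverse w' * w) *s z'"
      by (simp only: matrix_vector_mul_assoc[symmetric] Uz' vector_scalar_commute Tz vector_smult_assoc)
         (use e0 in \<open>simp add: field_simps\<close>)
    ultimately have "x \<otimes>\<^bsub>PSU_h\<^esub> inv\<^bsub>PSU_h\<^esub> y \<in> B" unfolding eq using BI TXU(1)[OF Q] by blast
    moreover have "x \<otimes>\<^bsub>PSU_h\<^esub> inv\<^bsub>PSU_h\<^esub> y \<in> A" using Asg xy(1,2) by (simp add: subgroup.m_closed subgroup.m_inv_closed)
    ultimately show "x \<otimes>\<^bsub>PSU_h\<^esub> inv\<^bsub>PSU_h\<^esub> y \<in> A \<inter> B" by blast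
  qed auto
  define PB where "PB x Yl \<longleftrightarrow> fst Yl \<in> carrier SU_h \<and> int_mat (fst Yl) \<and> x = cls (fst Yl) \<and> fst Yl *v z' = snd Yl *s z'"
    for x :: "(complex^3^3) set" and Yl :: "(complex^3^3) \<times> complex"
  have PB: "\<exists>Yl. PB x Yl" if x: "x \<in> B" for x
  proof -
    obtain Y where Y: "Y \<in> carrier SU_h" "int_mat Y" "x = cls Y" "act x (proj z') = proj z'"
      using x by (auto simp: B_def Picard_stab_def Picard_eq z'_def)
    then obtain l where "Y *v z' = l *s z'" using act_cls_fixes_iff[OF Y(1) z'0] by blast
    then show ?thesis using Y by (intro exI[of _ "(Y, l)"]) (simp add: PB_def)
  qed
  define cb where "cb x = (SOME Yl. PB x Yl)" for x
  have cb: "PB x (cb x)" if "x \<in> B" for x unfolding cb_def by (rule someI_ex[OF PB[OF that]])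
  \<comment> \<open>The last coordinate of z' is 1, so the eigenvalue is a coordinate of an integral
    vector. It has modulus one because h(z') is nonzero, which leaves finitely many values.\<close>
  have cb2: "snd (cb x) \<in> {l \<in> OK. cmod l \<le> 1} \<and> snd (cb x) \<noteq> 0" if x: "x \<in> B" for x
  proof -
    have Y: "fst (cb x) \<in> carrier SU_h" "int_mat (fst (cb x))" "fst (cb x) *v z' = snd (cb x) *s z'" using cb[OF x] by (auto simp: PB_def)
    have "snd (cb x) = (fst (cb x) *v z') $ 3" unfolding Y(3) by (simp add: z'_def)
    then have O: "snd (cb x) \<in> OK" using int_mat_vec[OF Y(2) z'int] by (simp add: int_vec_def)
    have "herm (fst (cb x) *v z') = herm z'" using Y(1) by (simp add: carrier_SU_h)
    then have "(cmod (snd (cb x)))\<^sup>2 = 1" using D hz' unfolding Y(3) herm_scale by simp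
    then have "cmod (snd (cb x)) = 1" using power2_eq_iff_nonneg[of "cmod (snd (cb x))" 1] by simp
    then show ?thesis using O by auto
  qed
  have fB: "finite_index PSU_h (A \<inter> B) B"
  \<comment> \<open>Stabilizing the point z' allows eigenvalues other than cube roots of unity.
    Including the eigenvalue in the label makes the quotient of two elements fix the vector z', as
    membership in the conjugate of \<open>Gam z\<close> requires.\<close>
  proof (rule finite_indexI[OF Bsg ABsg, where f = "\<lambda>x. (lab (fst (cb x)), snd (cb x))"])
    have "(\<lambda>x. (lab (fst (cb x)), snd (cb x))) ` B \<subseteq> range lab \<times> {l \<in> OK. cmod l \<le> 1}" using cb2 by auto
    then show "finite ((\<lambda>x. (lab (fst (cb x)), snd (cb x))) ` B)"
      using lab(1) finite_OK_disc by (meson finite_SigmaI finite_subset)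
    fix x y assume xy: "x \<in> B" "y \<in> B" "(lab (fst (cb x)), snd (cb x)) = (lab (fst (cb y)), snd (cb y))"
    define X Y l where "X = fst (cb x)" and "Y = fst (cb y)" and "l = snd (cb y)"
    have X: "X \<in> carrier SU_h" "int_mat X" "x = cls X" "X *v z' = l *s z'" using cb[OF xy(1)] xy(3) by (auto simp: PB_def X_def l_def)
    have Y: "Y \<in> carrier SU_h" "int_mat Y" "y = cls Y" "Y *v z' = l *s z'" using cb[OF xy(2)] by (auto simp: PB_def Y_def l_def)
    have labs: "lab X = lab Y" using xy(3) by (simp add: X_def Y_def)
    have l0: "l \<noteq> 0" using cb2[OF xy(2)] by (simp add: l_def)
    define Q where "Q = X ** hadj Y"
    have Q: "Q \<in> carrier SU_h" unfolding Q_def by (rule SU_h_mult[OF X(1) SU_h_hadj(1)[OF Y(1)]])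
    have eq: "x \<otimes>\<^bsub>PSU_h\<^esub> inv\<^bsub>PSU_h\<^esub> y = cls Q" unfolding X(3) Y(3) Q_def using X(1) Y(1) SU_h_hadj(1) by (simp add: cls_inv cls_mult)
    have "hadj Y *v z' = inverse l *s z'" by (rule SU_h_inv[OF Y(1,4) l0])
    then have "Q *v z' = z'" unfolding Q_def using l0 by (simp add: X(4) vector_scalar_commute flip: matrix_vector_mul_assoc)
    then have "(U ** (Q ** T)) *v z = z"
      by (simp only: matrix_vector_mul_assoc[symmetric] Tz vector_scalar_commute Uz' vector_smult_assoc)
         (use e0 in simp)
    moreover have "int_mat (U ** (Q ** T))" unfolding Q_def by (rule key(2)[OF X(2) Y(2) labs Y(1)])
    moreover have "cls Q = cls (T ** ((U ** (Q ** T)) ** U))" by (simp add: TU' TU flip: matrix_mul_assoc)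
    ultimately have "PA (cls Q) (U ** (Q ** T))" unfolding PA_def using TXU(2)[OF Q] by (auto intro!: exI[of _ 1])
    then have "x \<otimes>\<^bsub>PSU_h\<^esub> inv\<^bsub>PSU_h\<^esub> y \<in> A" unfolding eq by (rule AI)
    moreover have "x \<otimes>\<^bsub>PSU_h\<^esub> inv\<^bsub>PSU_h\<^esub> y \<in> B" using Bsg xy(1,2) by (simp add: subgroup.m_closed subgroup.m_inv_closed)
    ultimately show "x \<otimes>\<^bsub>PSU_h\<^esub> inv\<^bsub>PSU_h\<^esub> y \<in> A \<inter> B" by blast
  qed auto
  show ?thesis unfolding commensurable_up_to_conjugacy_def commensurable_def
    using fA fB g unfolding A_def B_def by blast
qed

end

section \<open>Pell's equation\<close>

lemma sqrt_irrational_of_nonsquare: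
  assumes "\<nexists>k::nat. k ^ 2 = M" shows "sqrt (real M) \<notin> \<rat>"
proof
  assume r: "sqrt (real M) \<in> \<rat>"
  have "algebraic_int (sqrt (real M))" by (intro algebraic_int_sqrt int_imp_algebraic_int) auto
  then have "sqrt (real M) \<in> \<int>" using r by (rule rational_algebraic_int_is_int)
  then obtain i :: int where i: "sqrt (real M) = of_int i" by (auto elim: Ints_cases)
  then have "real_of_int (i ^ 2) = real M" by (metis of_int_power of_nat_0_le_iff real_sqrt_pow2)
  then have "i ^ 2 = int M" by (metis of_int_eq_iff of_int_of_nat_eq)
  then have "int (nat \<bar>i\<bar> ^ 2) = int M" by simp
  then have "nat \<bar>i\<bar> ^ 2 = M" by (simp only: of_nat_eq_iff)
  then show False using assms by blast
qed

text \<open>Dirichlet's argument: the infinitely many good approximations p/q of sqrt(M) have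
  bounded nonzero norms p^2 - M q^2. Two of them agree in the norm k and modulo k, and their
  quotient is an integral element of norm one.\<close>

lemma pell_solution:
  fixes M :: nat
  assumes "\<nexists>k::nat. k ^ 2 = M"
  obtains x y :: nat where "y > 0" "x ^ 2 = 1 + M * y ^ 2"
proof -
  define \<theta> where "\<theta> = sqrt (real M)"
  have irr: "\<theta> \<notin> \<rat>" unfolding \<theta>_def by (rule sqrt_irrational_of_nonsquare[OF assms])
  have \<theta>0: "\<theta> \<ge> 0" by (simp add: \<theta>_def)
  have \<theta>2: "\<theta> * \<theta> = real M" by (simp add: \<theta>_def)
  define nrm where "nrm = (\<lambda>(p::int, q::int). p ^ 2 - int M * q ^ 2)"
  \<comment> \<open>With |p - \<theta> q| \<le> 1/q and |p + \<theta> q| \<le> 1/q + 2 \<theta> q,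
    the norm is bounded by 1/q^2 + 2 \<theta> \<le> 1 + 2 \<theta>.\<close>
  define C where "C = \<lceil>1 + 2 * \<theta>\<rceil>"
  have bd: "\<bar>nrm pq\<bar> \<le> C" if "pq \<in> approx_set \<theta>" for pq
  proof -
    obtain p q where pq: "pq = (p, q)" by fastforce
    have q: "q > 0" and ap: "\<bar>\<theta> - of_int p / of_int q\<bar> < 1 / (of_int q)\<^sup>2" using that by (auto simp: approx_set_def pq)
    have "\<bar>\<theta> * of_int q - of_int p\<bar> = \<bar>\<theta> - of_int p / of_int q\<bar> * of_int q"
      using q by (simp add: abs_mult_pos field_simps)
    also have "\<dots> \<le> 1 / (of_int q)\<^sup>2 * of_int q" using ap q by (intro mult_right_mono) auto
    also have "\<dots> = 1 / of_int q" using q by (simp add: power2_eq_square)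
    finally have 1: "\<bar>\<theta> * of_int q - of_int p\<bar> \<le> 1 / of_int q" .
    have q1: "1 / real_of_int q \<le> 1" using q by simp
    have "\<bar>of_int p + \<theta> * of_int q\<bar> \<le> \<bar>\<theta> * of_int q - of_int p\<bar> + 2 * (\<theta> * of_int q)"
    proof -
      have "0 \<le> \<theta> * of_int q" using q \<theta>0 by simp
      then show ?thesis by linarith
    qed
    then have 2: "\<bar>of_int p + \<theta> * of_int q\<bar> \<le> 1 / of_int q + 2 * (\<theta> * of_int q)" using 1 by linarith
    have "real_of_int (nrm pq) = (of_int p - \<theta> * of_int q) * (of_int p + \<theta> * of_int q)"
      using \<theta>2 by (simp add: nrm_def pq power2_eq_square algebra_simps)
    then have "\<bar>real_of_int (nrm pq)\<bar> = \<bar>\<theta> * of_int q - of_int p\<bar> * \<bar>of_int p + \<theta> * of_int q\<bar>"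
      by (simp add: abs_mult abs_minus_commute)
    also have "\<dots> \<le> (1 / of_int q) * (1 / of_int q + 2 * (\<theta> * of_int q))"
      using 1 2 q \<theta>0 by (intro mult_mono) auto
    also have "\<dots> = (1 / of_int q) * (1 / of_int q) + 2 * \<theta>" using q by (simp add: algebra_simps)
    also have "\<dots> \<le> 1 * 1 + 2 * \<theta>" using mult_mono[OF q1 q1] q by simp
    finally have "real_of_int \<bar>nrm pq\<bar> \<le> 1 + 2 * \<theta>" by simp
    also have "\<dots> \<le> of_int C" by (simp add: C_def)
    finally show ?thesis by (simp only: of_int_le_iff)
  qed
  have nz: "nrm (p, q) \<noteq> 0" if "q > 0" for p q
  proof
    assume "nrm (p, q) = 0"
    then have "p ^ 2 = int M * q ^ 2" by (simp add: nrm_def)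
    then have "real_of_int (p ^ 2) = real_of_int (int M * q ^ 2)" by (simp only:)
    then have "(of_int \<bar>p\<bar>)\<^sup>2 = (\<theta> * of_int q)\<^sup>2" using \<theta>2 by (simp add: power2_eq_square algebra_simps)
    then have "of_int \<bar>p\<bar> = \<theta> * of_int q" using \<theta>0 that by (subst (asm) power2_eq_iff_nonneg) auto
    then have "\<theta> = of_int \<bar>p\<bar> / of_int q" using that by (simp add: field_simps)
    then show False using irr by simp
  qed
  define lab where "lab pq = (nrm pq, fst pq mod nrm pq, snd pq mod nrm pq)" for pq :: "int \<times> int"
  have "lab ` approx_set \<theta> \<subseteq> {-C..C} \<times> {-C..C} \<times> {-C..C}"
  proof
    fix l assume "l \<in> lab ` approx_set \<theta>"
    then obtain pq where pq: "pq \<in> approx_set \<theta>" "l = lab pq" by blast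
    have n: "nrm pq \<noteq> 0" using pq nz by (auto simp: approx_set_def)
    have "\<bar>x mod nrm pq\<bar> \<le> \<bar>nrm pq\<bar>" for x using abs_mod_less[OF n, of x] by linarith
    then have "\<bar>x mod nrm pq\<bar> \<le> C" for x using bd[OF pq(1)] order_trans by blast
    then have "x mod nrm pq \<in> {-C..C}" for x by (meson abs_le_iff atLeastAtMost_iff minus_le_iff)
    moreover have "nrm pq \<in> {-C..C}" using bd[OF pq(1)] by auto
    ultimately show "l \<in> {-C..C} \<times> {-C..C} \<times> {-C..C}" by (simp add: pq(2) lab_def)
  qed
  then have "finite (lab ` approx_set \<theta>)" by (rule finite_subset) simp
  moreover have "infinite (approx_set \<theta>)" using irr rational_iff_finite_approx_set by blast
  ultimately have "\<not> inj_on lab (approx_set \<theta>)" using finite_imageD by blast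
  then obtain a b where ab: "a \<in> approx_set \<theta>" "b \<in> approx_set \<theta>" "a \<noteq> b" "lab a = lab b"
    by (auto simp: inj_on_def)
  obtain p q p' q' where pq: "a = (p, q)" "b = (p', q')" by fastforce
  have q: "q > 0" "q' > 0" using ab by (auto simp: approx_set_def pq)
  define k where "k = nrm (p, q)"
  have k: "p ^ 2 - int M * q ^ 2 = k" "p' ^ 2 - int M * q' ^ 2 = k" "k \<noteq> 0"
    using ab(4) nz q by (auto simp: k_def lab_def pq nrm_def)
  have "k dvd p' - p" "k dvd q' - q" using ab(4) by (auto simp: lab_def pq k_def mod_eq_dvd_iff dvd_diff_commute)
  then obtain i j where "p' - p = k * i" "q' - q = k * j" by (auto simp: dvd_def)
  then have ij: "p' = p + k * i" "q' = q + k * j" by auto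
  \<comment> \<open>X + Y sqrt(M) is (p - q sqrt(M)) (p' + q' sqrt(M)) / k, and the congruences
    modulo k make its coordinates integral.\<close>
  define X Y where "X = 1 + p * i - int M * q * j" and "Y = p * j - q * i"
  have X: "p * p' - int M * q * q' = k * X" using k(1) unfolding X_def ij by (simp add: algebra_simps power2_eq_square)
  have Y: "p * q' - q * p' = k * Y" unfolding Y_def ij by (simp add: algebra_simps)
  have "k ^ 2 * (X ^ 2 - int M * Y ^ 2) = (k * X) ^ 2 - int M * (k * Y) ^ 2" by (simp add: algebra_simps power_mult_distrib)
  also have "\<dots> = (p ^ 2 - int M * q ^ 2) * (p' ^ 2 - int M * q' ^ 2)"
    unfolding X[symmetric] Y[symmetric] by (simp add: algebra_simps power2_eq_square)
  also have "\<dots> = k ^ 2 * 1" using k by (simp add: power2_eq_square)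
  finally have XY: "X ^ 2 - int M * Y ^ 2 = 1" using k(3) by simp
  have "Y \<noteq> 0"
  proof
    assume "Y = 0"
    then have e: "p * q' = q * p'" using Y by simp
    have "k * q' ^ 2 = (p * q') ^ 2 - int M * q ^ 2 * q' ^ 2" unfolding k(1)[symmetric] by (simp add: algebra_simps power_mult_distrib)
    also have "\<dots> = k * q ^ 2" unfolding e k(2)[symmetric] by (simp add: algebra_simps power_mult_distrib)
    finally have "q' ^ 2 = q ^ 2" using k(3) by simp
    then have "q' = q" using q power2_eq_iff_nonneg[of q' q] by simp
    then have "p = p'" using e q by simp
    then show False using ab(3) pq \<open>q' = q\<close> by simp
  qed
  then have "nat \<bar>Y\<bar> > 0" by simp
  moreover have "nat \<bar>X\<bar> ^ 2 = 1 + M * nat \<bar>Y\<bar> ^ 2"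
  proof -
    have "int (nat \<bar>X\<bar> ^ 2) = int (1 + M * nat \<bar>Y\<bar> ^ 2)" using XY by simp
    then show ?thesis by (simp only: of_nat_eq_iff)
  qed
  ultimately show ?thesis using that by blast
qed

lemma nonsquare_times_square:
  assumes "\<nexists>k::nat. k ^ 2 = M" "m > 0" shows "\<nexists>k::nat. k ^ 2 = M * m ^ 2"
proof
  assume "\<exists>k. k ^ 2 = M * m ^ 2"
  then obtain k where k: "k ^ 2 = M * m ^ 2" by blast
  then have "m ^ 2 dvd k ^ 2" by simp
  then have "m dvd k" by simp
  then obtain j where "k = m * j" by (auto simp: dvd_def)
  then have "j ^ 2 = M" using k assms(2) by (simp add: power_mult_distrib)
  then show False using assms(1) by blast
qed

section \<open>A nonelementary subgroup of every discriminant\<close>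

text \<open>\<open>fz D\<close> is a primitive integral vector of norm \<open>D\<close>. The columns of \<open>fB D\<close> are orthogonal of norms
  \<open>1, - D, D\<close>, the last one being \<open>fz D\<close>; \<open>fC D\<close> is the inverse of \<open>fB D\<close>. In this frame \<open>fM D a b\<close> is the
  general element of \<open>SU(1,1)\<close> fixing \<open>fz D\<close>, when \<open>|a|\<^sup>2 - D |b|\<^sup>2 = 1\<close>.\<close>

definition fe :: "nat \<Rightarrow> complex" where "fe D = of_nat (D mod 2)"
definition fq :: "nat \<Rightarrow> complex" where "fq D = of_nat (D div 2)"

lemma fe_simps: "fe D * fe D = fe D" "cnj (fe D) = fe D" "cnj (fq D) = fq D" "of_nat D = fe D + 2 * fq D"
proof -
  have "D mod 2 = 0 \<or> D mod 2 = 1" by auto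
  then show "fe D * fe D = fe D" by (auto simp: fe_def)
  have "of_nat D = complex_of_nat (D mod 2 + 2 * (D div 2))" by simp
  then show "of_nat D = fe D + 2 * fq D" by (simp only: fe_def fq_def of_nat_add of_nat_mult of_nat_numeral)
qed (auto simp: fe_def fq_def)

definition fz :: "nat \<Rightarrow> complex^3" where "fz D = vector [- fq D, fe D, 1]"

definition fB :: "nat \<Rightarrow> complex^3^3" where
  "fB D = vector [vector [fe D, fe D + fq D, - fq D], vector [1, fe D, fe D], vector [0, 1, 1]]"

definition fC :: "nat \<Rightarrow> complex^3^3" where
  "fC D = vector [vector [0, 1, - fe D],
     vector [1 / of_nat D, - fe D / of_nat D, (fe D + fq D) / of_nat D],
     vector [- 1 / of_nat D, fe D / of_nat D, fq D / of_nat D]]"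

definition fM :: "nat \<Rightarrow> complex \<Rightarrow> complex \<Rightarrow> complex^3^3" where
  "fM D a b = vector [vector [a, of_nat D * cnj b, 0], vector [b, cnj a, 0], vector [0, 0, 1]]"

definition fS :: "nat \<Rightarrow> complex \<Rightarrow> complex \<Rightarrow> complex^3^3" where
  "fS D a b = fB D ** (fM D a b ** fC D)"

lemma fC_fB: assumes "D > 0" shows "fC D ** fB D = mat 1" "fB D ** fC D = mat 1"
proof -
  have D: "of_nat D \<noteq> (0::complex)" "fe D + 2 * fq D \<noteq> 0" using assms fe_simps(4)[of D] by (auto simp flip: fe_simps(4))
  show "fC D ** fB D = mat 1"
  proof -
    have "fe D = 0 \<or> fe D = 1" using fe_simps(1)[of D] by auto
    then show ?thesis
    proof
      assume e: "fe D = 0"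
      show ?thesis
        by (rule matrix_3_eqI)
           (use D e in \<open>simp_all add: matrix_matrix_mult_3 fC_def fB_def mat_def fe_simps(4) field_simps\<close>)
    next
      assume e: "fe D = 1"
      have q: "fq D = (of_nat D - 1) / 2" using fe_simps(4)[of D] e by simp
      show ?thesis
        by (rule matrix_3_eqI)
           (use D(1) in \<open>simp_all add: matrix_matrix_mult_3 fC_def fB_def mat_def e q field_simps\<close>)
    qed
  qed
  then show "fB D ** fC D = mat 1" by (simp add: matrix_left_right_inverse)
qed

lemma fB_axis3: "fB D *v vector [0, 0, y] = y *s fz D"
  by (simp add: vec_eq_iff forall_3 matrix_vector_mult_3 fB_def fz_def)

lemma hp_fB: "hp (fB D *v y) (fB D *v y) = y $ 1 * cnj (y $ 1) - of_nat D * (y $ 2 * cnj (y $ 2)) + of_nat D * (y $ 3 * cnj (y $ 3))"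
proof -
  define x :: "complex^3" where "x = vector [fe D, 1, 0]"
  define w :: "complex^3" where "w = vector [fe D + fq D, fe D, 1]"
  have B: "fB D *v y = y $ 1 *s x + y $ 2 *s w + y $ 3 *s fz D"
    by (simp add: vec_eq_iff forall_3 matrix_vector_mult_3 fB_def fz_def x_def w_def mult.commute)
  have h: "hp x x = 1" "hp x w = 0" "hp x (fz D) = 0" "hp w x = 0" "hp w w = - of_nat D" "hp w (fz D) = 0"
    "hp (fz D) x = 0" "hp (fz D) w = 0" "hp (fz D) (fz D) = of_nat D"
    by (simp_all add: hp_def x_def w_def fz_def fe_simps algebra_simps)
  show ?thesis unfolding B by (simp add: h algebra_simps)
qed

lemma fM_mult: "fM D a b ** fM D a' b' = fM D (a * a' + of_nat D * cnj b * b') (b * a' + cnj a * b')"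
  by (rule matrix_3_eqI) (simp_all add: fM_def matrix_matrix_mult_3 algebra_simps)

lemma fS_mult: assumes "D > 0" shows "fS D a b ** fS D a' b' = fS D (a * a' + of_nat D * cnj b * b') (b * a' + cnj a * b')"
proof -
  have "fS D a b ** fS D a' b' = fB D ** ((fM D a b ** ((fC D ** fB D) ** fM D a' b')) ** fC D)"
    by (simp add: fS_def matrix_mul_assoc)
  then show ?thesis by (simp add: fC_fB[OF assms] fM_mult fS_def)
qed

lemma fS_fB: assumes "D > 0" shows "fS D a b *v (fB D *v y) = fB D *v (fM D a b *v y)"
proof -
  have "fS D a b ** fB D = fB D ** (fM D a b ** (fC D ** fB D))" by (simp add: fS_def matrix_mul_assoc)
  then show ?thesis by (simp add: fC_fB[OF assms] matrix_vector_mul_assoc)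
qed

lemma fS_fz: assumes "D > 0" shows "fS D a b *v fz D = fz D"
  using fS_fB[OF assms, of a b "vector [0, 0, 1]"] fB_axis3[of D 1]
  by (simp add: fM_def matrix_vector_mult_3 vec_eq_iff forall_3)

lemma fS_carrier:
  assumes "D > 0" "a * cnj a - of_nat D * (b * cnj b) = 1"
  shows "fS D a b \<in> carrier SU_h"
proof -
  have "det (fS D a b) = det (fM D a b) * det (fC D ** fB D)" by (simp add: fS_def det_mul)
  also have "\<dots> = a * cnj a - of_nat D * (b * cnj b)" by (simp add: fC_fB[OF assms(1)]) (simp add: fM_def det_3 algebra_simps)
  finally have "det (fS D a b) = 1" using assms(2) by simp
  moreover have "herm (fS D a b *v x) = herm x" for x
  proof -
    define y where "y = fC D *v x"
    have x: "x = fB D *v y" by (simp add: y_def matrix_vector_mul_assoc fC_fB[OF assms(1)])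
    have My: "(fM D a b *v y) $ 1 = a * y $ 1 + of_nat D * cnj b * y $ 2" "(fM D a b *v y) $ 2 = b * y $ 1 + cnj a * y $ 2"
      "(fM D a b *v y) $ 3 = y $ 3" by (simp_all add: fM_def matrix_vector_mult_3)
    have "hp (fS D a b *v x) (fS D a b *v x) =
      (a * cnj a - of_nat D * (b * cnj b)) * (y $ 1 * cnj (y $ 1)) - (a * cnj a - of_nat D * (b * cnj b)) * (of_nat D * (y $ 2 * cnj (y $ 2))) + of_nat D * (y $ 3 * cnj (y $ 3))"
      unfolding x fS_fB[OF assms(1)] hp_fB My by (simp add: algebra_simps)
    also have "\<dots> = hp x x" unfolding x hp_fB assms(2) by simp
    finally show ?thesis by (simp add: herm_eq_Re)
  qed
  ultimately show ?thesis by (simp add: carrier_SU_h)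
qed

text \<open>In coordinates of the frame, a nonzero third coordinate forces the eigenvalue 1; the
  block of the first element has determinant 1 and trace 2 a different from 2, so 1 is not among its
  eigenvalues and the other two coordinates vanish. With third coordinate zero, eliminating the
  eigenvalues gives \<open>D * cnj b * y\<^sub>2\<^sup>2 = b * y\<^sub>1\<^sup>2\<close> and the
  same for b', which is impossible for y \<noteq> 0 since b and b' have different real
  directions.\<close>

lemma fS_common_eigenvector:
  assumes D: "D > 0" and a: "a * a - of_nat D * (b * cnj b) = 1" "cnj a = a" "a \<noteq> 1" and b: "b \<noteq> 0"
    and a': "cnj a' = a'" and bb: "b * cnj b' \<noteq> b' * cnj b"
    and x: "x \<noteq> 0" and e: "fS D a b *v x = l *s x" and e': "fS D a' b' *v x = l' *s x"
  shows "\<exists>c. c \<noteq> 0 \<and> x = c *s fz D"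
proof -
  define y where "y = fC D *v x"
  have xy: "x = fB D *v y" by (simp add: y_def matrix_vector_mul_assoc fC_fB[OF D])
  have inj: "u = v" if "fB D *v u = fB D *v v" for u v
  proof -
    have "fC D *v (fB D *v u) = fC D *v (fB D *v v)" using that by simp
    then show ?thesis by (simp add: matrix_vector_mul_assoc fC_fB[OF D])
  qed
  have "fB D *v (fM D a b *v y) = fB D *v (l *s y)" using e by (simp add: xy fS_fB[OF D] vector_scalar_commute)
  then have "fM D a b *v y = l *s y" by (rule inj)
  then have 1: "a * y $ 1 + of_nat D * cnj b * y $ 2 = l * y $ 1" "b * y $ 1 + a * y $ 2 = l * y $ 2" "y $ 3 = l * y $ 3"
    using a(2) by (simp_all add: fM_def vec_eq_iff forall_3 matrix_vector_mult_3)
  have "fB D *v (fM D a' b' *v y) = fB D *v (l' *s y)" using e' by (simp add: xy fS_fB[OF D] vector_scalar_commute)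
  then have "fM D a' b' *v y = l' *s y" by (rule inj)
  then have 2: "a' * y $ 1 + of_nat D * cnj b' * y $ 2 = l' * y $ 1" "b' * y $ 1 + a' * y $ 2 = l' * y $ 2"
    using a' by (simp_all add: fM_def vec_eq_iff forall_3 matrix_vector_mult_3)
  have D0: "of_nat D \<noteq> (0::complex)" using D by simp
  have "y $ 1 = 0 \<and> y $ 2 = 0"
  proof (cases "y $ 3 = 0")
    case False
    then have "l = 1" using 1(3) by simp
    then have 3: "(a - 1) * y $ 1 = - (of_nat D * cnj b * y $ 2)" "(a - 1) * y $ 2 = - (b * y $ 1)"
      using 1 by (simp_all add: algebra_simps add_eq_0_iff2)
    have "(a - 1) * ((a - 1) * y $ 1) = of_nat D * (b * cnj b) * y $ 1"
    proof -
      have "(a - 1) * ((a - 1) * y $ 1) = - (of_nat D * cnj b * ((a - 1) * y $ 2))" unfolding 3(1) by (simp add: mult_ac)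
      then show ?thesis unfolding 3(2) by (simp add: mult_ac)
    qed
    also have "of_nat D * (b * cnj b) = a * a - 1" using a(1) by (simp add: algebra_simps)
    finally have "2 * ((a - 1) * y $ 1) = 0" by (simp add: algebra_simps)
    then have "y $ 1 = 0" using a(3) by simp
    then show ?thesis using 3(2) a(3) by simp
  next
    case True
    have "of_nat D * cnj b * (y $ 2 * y $ 2) = b * (y $ 1 * y $ 1)" using 1(1,2) by algebra
    moreover have "of_nat D * cnj b' * (y $ 2 * y $ 2) = b' * (y $ 1 * y $ 1)" using 2 by algebra
    ultimately have "(b * cnj b' - b' * cnj b) * (of_nat D * (y $ 2 * y $ 2)) = 0" by algebra
    then have "y $ 2 = 0" using bb D0 by simp
    then have "b * y $ 1 = 0" using 1(2) by simp
    then show ?thesis using b \<open>y $ 2 = 0\<close> by simp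
  qed
  then have "y = vector [0, 0, y $ 3]" by (simp add: vec_eq_iff forall_3)
  then have "x = y $ 3 *s fz D" using xy fB_axis3 by metis
  then show ?thesis using x by (intro exI[of _ "y $ 3"]) auto
qed

text \<open>A power multiplies b by a positive real number only, so noncommuting directions persist
  for all powers. The exponent is a successor because the power zero has b = 0 and hence no
  direction.\<close>

lemma fS_powers:
  assumes D: "D > 0" and S: "fS D (of_real a) b \<in> carrier SU_h" and a: "a > 0"
  shows "\<exists>a' y. a' > 0 \<and> y > 0 \<and> fS D (of_real a') (of_real y * b) \<in> carrier SU_h
     \<and> cls (fS D (of_real a) b) [^]\<^bsub>PSU_h\<^esub> (Suc m) = cls (fS D (of_real a') (of_real y * b))"
proof (induction m)
  case 0
  interpret group PSU_h by (rule group_PSU_h)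
  show ?case using S a by (intro exI[of _ a] exI[of _ 1]) simp
next
  case (Suc m)
  interpret group PSU_h by (rule group_PSU_h)
  obtain a' y where y: "a' > 0" "y > 0" "fS D (of_real a') (of_real y * b) \<in> carrier SU_h"
    "cls (fS D (of_real a) b) [^]\<^bsub>PSU_h\<^esub> (Suc m) = cls (fS D (of_real a') (of_real y * b))" using Suc by blast
  define a2 where "a2 = a' * a + real D * (y * (cmod b)\<^sup>2)"
  define y2 where "y2 = y * a + a'"
  have bb: "cnj b * b = complex_of_real ((cmod b)\<^sup>2)" by (metis complex_norm_square mult.commute)
  have eq: "fS D (of_real a') (of_real y * b) ** fS D (of_real a) b = fS D (of_real a2) (of_real y2 * b)"
  proof -
    have "of_real a' * of_real a + of_nat D * cnj (of_real y * b) * b = of_real a' * of_real a + of_nat D * (of_real y * (cnj b * b))"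
      by (simp add: mult_ac)
    also have "\<dots> = complex_of_real a2" unfolding bb a2_def by simp
    finally have "of_real a' * of_real a + of_nat D * cnj (of_real y * b) * b = complex_of_real a2" .
    moreover have "of_real y * b * of_real a + cnj (of_real a') * b = of_real y2 * b" by (simp add: y2_def algebra_simps)
    ultimately show ?thesis by (simp only: fS_mult[OF D])
  qed
  have "fS D (of_real a2) (of_real y2 * b) \<in> carrier SU_h" unfolding eq[symmetric] using y(3) S by (rule SU_h_mult)
  moreover have "cls (fS D (of_real a) b) [^]\<^bsub>PSU_h\<^esub> (Suc (Suc m)) = cls (fS D (of_real a2) (of_real y2 * b))"
    unfolding nat_pow_Suc[of _ "Suc m"] y(4) eq[symmetric] using y(3) S by (simp add: cls_mult)
  moreover have "a2 > 0" "y2 > 0" using y a by (auto simp: a2_def y2_def add_pos_nonneg add_pos_pos)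
  ultimately show ?case by blast
qed

text \<open>Commuting classes leave a cube root of unity between the two products of matrices;
  evaluation at \<open>fz D\<close>, which both products fix, shows that it is 1. Comparison of the
  upper left entries in the frame then gives the claim.\<close>

lemma fS_commute:
  assumes D: "D > 0" and S: "fS D a b \<in> carrier SU_h" "fS D a' b' \<in> carrier SU_h"
    and c: "cls (fS D a b) \<otimes>\<^bsub>PSU_h\<^esub> cls (fS D a' b') = cls (fS D a' b') \<otimes>\<^bsub>PSU_h\<^esub> cls (fS D a b)"
  shows "b * cnj b' = b' * cnj b"
proof -
  have "cls (fS D a b ** fS D a' b') = cls (fS D a' b' ** fS D a b)" using c S by (simp add: cls_mult)
  then obtain w where w: "fS D a b ** fS D a' b' = mat w ** (fS D a' b' ** fS D a b)" by (auto simp: cls_eq_iff)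
  have z: "(fS D a b ** fS D a' b') *v fz D = fz D" for a b a' b' by (simp add: fS_fz[OF D] flip: matrix_vector_mul_assoc)
  have "fz D = w *s fz D" using z[of a b a' b'] z[of a' b' a b] unfolding w mat_mult_mult_vec by simp
  then have "fz D $ 3 = w * fz D $ 3" by (metis vector_smult_component)
  then have "w = 1" by (simp add: fz_def)
  then have eq: "fS D a b ** fS D a' b' = fS D a' b' ** fS D a b" using w by simp
  have "fC D ** (fS D a b ** fB D) = fM D a b" for a b
  proof -
    have "fC D ** (fS D a b ** fB D) = (fC D ** fB D) ** (fM D a b ** (fC D ** fB D))" by (simp add: fS_def matrix_mul_assoc)
    then show ?thesis by (simp add: fC_fB[OF D])
  qed
  then have "fM D (a * a' + of_nat D * cnj b * b') (b * a' + cnj a * b') = fM D (a' * a + of_nat D * cnj b' * b) (b' * a + cnj a' * b)"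
    using eq unfolding fS_mult[OF D] by metis
  then have "a * a' + of_nat D * cnj b * b' = a' * a + of_nat D * cnj b' * b" by (simp add: fM_def vec_eq_iff forall_3)
  then have "of_nat D * (cnj b * b') = of_nat D * (cnj b' * b)" by (simp add: mult_ac)
  then show ?thesis using D by (simp add: mult_ac)
qed

context imaginary_quadratic
begin

lemma int_vec_fz: "int_vec (fz D)"
  by (simp add: int_vec_def forall_3 fz_def fe_def fq_def)

text \<open>The norm is e^2 + 2 q with e = D mod 2 and q = D div 2. Since the last coordinate is 1,
  the first one contributes an even number, and the middle one supplies the parity of D.\<close>

lemma herm_fz: "herm (fz D) = real D"
proof -
  have "hp (fz D) (fz D) = of_nat D" by (simp add: hp_def fz_def fe_simps)
  then show ?thesis by (simp add: herm_eq_Re)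
qed

text \<open>\<open>a\<close> and \<open>b\<close> are the entries of the square of the block with entries \<open>n, \<beta>\<close>, which is what makes \<open>D\<close>
  divide \<open>a - 1\<close>.\<close>

lemma fS_integral:
  assumes D: "D > 0" and \<beta>: "\<beta> \<in> OK" and n: "of_nat (n * n) = 1 + of_nat D * (\<beta> * cnj \<beta>)"
  defines "a \<equiv> 1 + 2 * of_nat D * (\<beta> * cnj \<beta>)" and "b \<equiv> 2 * of_nat n * \<beta>"
  shows "int_mat (fS D a b)" "fS D a b \<in> carrier SU_h" "a * a - of_nat D * (b * cnj b) = 1"
proof -
  \<comment> \<open>The product \<open>P ** Q\<close> equals (M - 1) \<open>fC D\<close>, where M is
    \<open>fM D a b\<close>: the denominators D in the second row of \<open>fC D\<close> cancel
    against the second column of M - 1, whose entries are divisible by D.\<close>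
  define P :: "complex^3^3" where "P = vector [vector [2 * of_nat D * (\<beta> * cnj \<beta>), cnj b, 0], vector [b, 2 * (\<beta> * cnj \<beta>), 0], 0]"
  define Q :: "complex^3^3" where "Q = vector [vector [0, 1, - fe D], vector [1, - fe D, fe D + fq D], 0]"
  have ca: "cnj a = a" by (simp add: a_def mult_ac)
  have D0: "complex_of_nat D \<noteq> 0" using D by simp
  have "fM D a b ** fC D = fC D + P ** Q"
    by (rule matrix_3_eqI) (use D0 in \<open>simp_all add: fM_def fC_def P_def Q_def ca a_def matrix_matrix_mult_3 field_simps\<close>)
  then have S: "fS D a b = mat 1 + fB D ** (P ** Q)" by (simp add: fS_def matrix_add_ldistrib fC_fB[OF D])
  have ef: "fe D \<in> OK" "fq D \<in> OK" by (auto simp: fe_def fq_def)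
  have bO: "b \<in> OK" using \<beta> by (auto simp: b_def)
  have "int_mat P" using \<beta> bO unfolding int_mat_def forall_3 P_def by simp
  moreover have "int_mat Q" using ef unfolding int_mat_def forall_3 Q_def by simp
  moreover have "int_mat (fB D)" using ef unfolding int_mat_def forall_3 fB_def by simp
  ultimately show "int_mat (fS D a b)" unfolding S by (intro int_mat_add int_mat_1 int_mat_mult)
  define t where "t = \<beta> * cnj \<beta>"
  have "b * cnj b = 4 * (of_nat (n * n) * t)" by (simp add: b_def t_def mult_ac)
  then have "b * cnj b = 4 * ((1 + of_nat D * t) * t)" unfolding n t_def by simp
  then show 1: "a * a - of_nat D * (b * cnj b) = 1" unfolding a_def t_def[symmetric] by (simp add: algebra_simps)
  show "fS D a b \<in> carrier SU_h" using 1 ca by (intro fS_carrier[OF D]) simp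
qed

text \<open>The factors 1 + d and (1 + s)^2 have the same norm (1 + d)^2 but a nonreal ratio, so one
  solution of a Pell equation serves both directions. The factor c is there to make D N(c) a
  nonsquare when D is a square.\<close>

lemma exists_two_directions:
  assumes "D > 0"
  obtains \<beta> \<beta>' n where "\<beta> \<in> OK" "\<beta>' \<in> OK" "of_nat (n * n) = 1 + of_nat D * (\<beta> * cnj \<beta>)"
    "of_nat (n * n) = 1 + of_nat D * (\<beta>' * cnj \<beta>')" "\<beta> * cnj \<beta>' \<noteq> \<beta>' * cnj \<beta>"
proof -
  have "\<exists>c g. c \<in> OK \<and> c \<noteq> 0 \<and> c * cnj c = of_nat g \<and> (\<nexists>k::nat. k ^ 2 = D * g)"
  proof (cases "\<exists>k::nat. k ^ 2 = D")
    case False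
    then show ?thesis by (intro exI[of _ 1]) simp
  next
    case True
    then obtain k where k: "k ^ 2 = D" by blast
    \<comment> \<open>This is the norm of d + s, which lies strictly between the consecutive squares
      d^2 and (d + 1)^2.\<close>
    have ns: "\<nexists>i::nat. i ^ 2 = d * d + d"
    proof
      assume "\<exists>i::nat. i ^ 2 = d * d + d"
      then obtain i where i: "i ^ 2 = d * d + d" by blast
      have "d ^ 2 < i ^ 2" unfolding i using d_pos by (simp add: power2_eq_square)
      then have "d < i" by (rule power_less_imp_less_base) simp
      moreover have "i ^ 2 < (d + 1) ^ 2" unfolding i by (simp add: power2_eq_square)
      then have "i < d + 1" by (rule power_less_imp_less_base) simp
      ultimately show False by simp
    qed
    have "\<nexists>i::nat. i ^ 2 = (d * d + d) * k ^ 2"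
      by (rule nonsquare_times_square[OF ns]) (use k assms in \<open>auto intro: gr0I\<close>)
    then have "\<nexists>i::nat. i ^ 2 = D * (d * d + d)" using k by (simp add: mult.commute)
    moreover have "(of_nat d + s) * cnj (of_nat d + s) = of_nat (d * d + d)"
      using s_imaginary(3,4) by (simp add: algebra_simps)
    moreover have "Im (of_nat d + s) \<noteq> 0" using s_imaginary(2) by simp
    then have "of_nat d + s \<noteq> 0" by (metis zero_complex.sel(2))
    ultimately show ?thesis by (intro exI[of _ "of_nat d + s"] exI[of _ "d * d + d"]) auto
  qed
  then obtain c g where c: "c \<in> OK" "c \<noteq> 0" "c * cnj c = of_nat g" "\<nexists>k::nat. k ^ 2 = D * g" by blast
  have "\<nexists>k::nat. k ^ 2 = D * g * (1 + d) ^ 2" by (rule nonsquare_times_square[OF c(4)]) simp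
  then obtain n y :: nat where ny: "y > 0" "n ^ 2 = 1 + D * g * (1 + d) ^ 2 * y ^ 2" using pell_solution by blast
  define \<beta> where "\<beta> = c * of_nat (1 + d) * of_nat y"
  define \<beta>' where "\<beta>' = c * (1 + s) ^ 2 * of_nat y"
  have sn: "(1 + s) * cnj (1 + s) = of_nat (1 + d)" using s_imaginary(3,4) by (simp add: algebra_simps)
  have n: "of_nat (n * n) = 1 + of_nat D * (of_nat g * of_nat (1 + d) ^ 2 * of_nat y ^ 2 :: complex)"
  proof -
    have "complex_of_nat (n * n) = of_nat (1 + D * g * (1 + d) ^ 2 * y ^ 2)" using ny(2) by (metis power2_eq_square)
    then show ?thesis by (simp only: of_nat_add of_nat_mult of_nat_power of_nat_1 mult.assoc)
  qed
  have b: "\<beta> * cnj \<beta> = of_nat g * of_nat (1 + d) ^ 2 * of_nat y ^ 2"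
    unfolding \<beta>_def c(3)[symmetric] by (simp add: power2_eq_square mult_ac)
  have "\<beta>' * cnj \<beta>' = (c * cnj c) * ((1 + s) * cnj (1 + s)) ^ 2 * of_nat y ^ 2"
    unfolding \<beta>'_def by (simp add: power2_eq_square mult_ac)
  then have b': "\<beta>' * cnj \<beta>' = of_nat g * of_nat (1 + d) ^ 2 * of_nat y ^ 2" unfolding sn c(3) .
  have "\<beta>' * cnj \<beta> - \<beta> * cnj \<beta>' = (c * cnj c) * of_nat (1 + d) * of_nat y ^ 2 * ((1 + s) ^ 2 - cnj ((1 + s) ^ 2))"
    unfolding \<beta>'_def \<beta>_def by (simp add: power2_eq_square algebra_simps)
  also have "(1 + s) ^ 2 - cnj ((1 + s) ^ 2) = 4 * s"
    using s_imaginary(3) by (simp add: power2_eq_square algebra_simps)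
  also have "c * cnj c * of_nat (1 + d) * of_nat y ^ 2 * (4 * s) \<noteq> 0"
    using c(2) ny(1) s_imaginary(5) by (simp del: of_nat_Suc)
  finally have ne: "\<beta> * cnj \<beta>' \<noteq> \<beta>' * cnj \<beta>" by auto
  have O: "\<beta> \<in> OK" "\<beta>' \<in> OK" unfolding \<beta>_def \<beta>'_def
    by (intro OK_mult OK_power OK_add c(1) OK_of_nat OK_1 OK_s)+
  show ?thesis by (rule that[of \<beta> \<beta>' n, OF O _ _ ne]) (simp_all only: n b b')
qed

text \<open>Everything follows from the two elements of \<open>exists_two_directions\<close>.
  Noncommuting powers exclude virtual cyclicity, and the common eigenline is the unique fixed point.
  A larger C-Fuchsian group lies in some \<open>Gam v\<close>, where v is an eigenvector of both
  elements and thus a multiple of \<open>fz D\<close>.\<close>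

lemma Gam_fz_maximal:
  assumes D: "D > 0"
  shows "Gam (fz D) \<in> max_C_Fuchsian_of_discriminant K D"
proof -
  interpret group PSU_h by (rule group_PSU_h)
  obtain \<beta> \<beta>' n where \<beta>: "\<beta> \<in> OK" "\<beta>' \<in> OK" "of_nat (n * n) = 1 + of_nat D * (\<beta> * cnj \<beta>)"
    "of_nat (n * n) = 1 + of_nat D * (\<beta>' * cnj \<beta>')" "\<beta> * cnj \<beta>' \<noteq> \<beta>' * cnj \<beta>"
    using exists_two_directions[OF D] .
  define r where "r = 1 + 2 * real D * (cmod \<beta>)\<^sup>2"
  define r' where "r' = 1 + 2 * real D * (cmod \<beta>')\<^sup>2"
  define b where "b = 2 * of_nat n * \<beta>"
  define b' where "b' = 2 * of_nat n * \<beta>'"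
  have r: "complex_of_real r = 1 + 2 * of_nat D * (\<beta> * cnj \<beta>)" "complex_of_real r' = 1 + 2 * of_nat D * (\<beta>' * cnj \<beta>')"
    unfolding r_def r'_def by (simp_all add: complex_norm_square[symmetric])
  note S = fS_integral[OF D \<beta>(1,3), folded b_def r] and S' = fS_integral[OF D \<beta>(2,4), folded b'_def r]
  have "\<beta> \<noteq> 0" "\<beta>' \<noteq> 0" using \<beta>(5) by auto
  have "n \<noteq> 0"
  proof
    assume "n = 0"
    then have "1 + complex_of_real (real D * (cmod \<beta>)\<^sup>2) = 0" using \<beta>(3) by (simp add: complex_norm_square del: of_real_power)
    then have "complex_of_real (1 + real D * (cmod \<beta>)\<^sup>2) = 0" by simp
    then have "1 + real D * (cmod \<beta>)\<^sup>2 = 0" by (simp only: of_real_eq_0_iff)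
    moreover have "real D * (cmod \<beta>)\<^sup>2 \<ge> 0" by simp
    ultimately show False by linarith
  qed
  have b0: "b \<noteq> 0" using \<open>n \<noteq> 0\<close> \<open>\<beta> \<noteq> 0\<close> by (simp add: b_def)
  have bb: "b * cnj b' \<noteq> b' * cnj b"
  proof
    assume "b * cnj b' = b' * cnj b"
    then have "(4 * of_nat n * of_nat n) * (\<beta> * cnj \<beta>') = (4 * of_nat n * of_nat n) * (\<beta>' * cnj \<beta>)" by (simp add: b_def b'_def mult_ac)
    then show False using \<beta>(5) \<open>n \<noteq> 0\<close> by simp
  qed
  have rp: "r > 1" "r' > 0" using D \<open>\<beta> \<noteq> 0\<close> by (auto simp: r_def r'_def add_pos_nonneg)
  then have r1: "complex_of_real r \<noteq> 1" by simp
  let ?z = "fz D" let ?S = "fS D (of_real r) b" let ?S' = "fS D (of_real r') b'"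
  have z0: "?z \<noteq> 0" and hz: "herm ?z > 0" using herm_fz[of D] D by (auto simp: herm_def)
  have mem: "cls ?S \<in> Gam ?z" "cls ?S' \<in> Gam ?z"
    using GamI[OF S(2,1), of 1 ?z] GamI[OF S'(2,1), of 1 ?z] by (simp_all add: fS_fz[OF D])
  have uniq: "\<exists>c. c \<noteq> 0 \<and> x = c *s ?z" if "x \<noteq> 0" "?S *v x = l *s x" "?S' *v x = l' *s x" for x l l'
    by (rule fS_common_eigenvector[OF D S(3) _ r1 b0 _ bb that]) simp_all
  have nvc: "\<not> virtually_cyclic PSU_h (Gam ?z)"
  proof
    assume "virtually_cyclic PSU_h (Gam ?z)"
    then obtain m k :: nat where mk: "m > 0" "k > 0"
      "cls ?S [^]\<^bsub>PSU_h\<^esub> m \<otimes>\<^bsub>PSU_h\<^esub> cls ?S' [^]\<^bsub>PSU_h\<^esub> k = cls ?S' [^]\<^bsub>PSU_h\<^esub> k \<otimes>\<^bsub>PSU_h\<^esub> cls ?S [^]\<^bsub>PSU_h\<^esub> m"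
      using virtually_cyclic_powers_commute[OF _ subgroup_Gam mem] by blast
    obtain m' k' where mk': "m = Suc m'" "k = Suc k'" using mk(1,2) by (metis Suc_pred)
    obtain a1 y1 where 1: "y1 > 0" "fS D (of_real a1) (of_real y1 * b) \<in> carrier SU_h"
      "cls ?S [^]\<^bsub>PSU_h\<^esub> m = cls (fS D (of_real a1) (of_real y1 * b))" using fS_powers[OF D S(2), of m'] rp mk' by auto
    obtain a2 y2 where 2: "y2 > 0" "fS D (of_real a2) (of_real y2 * b') \<in> carrier SU_h"
      "cls ?S' [^]\<^bsub>PSU_h\<^esub> k = cls (fS D (of_real a2) (of_real y2 * b'))" using fS_powers[OF D S'(2), of k'] rp mk' by auto
    have "(of_real y1 * b) * cnj (of_real y2 * b') = (of_real y2 * b') * cnj (of_real y1 * b)"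
      using fS_commute[OF D 1(2) 2(2)] mk(3) unfolding 1(3) 2(3) by blast
    then have "complex_of_real (y1 * y2) * (b * cnj b') = complex_of_real (y1 * y2) * (b' * cnj b)" by (simp add: mult_ac)
    then show False using bb 1(1) 2(1) by simp
  qed
  have ne: "nonelementary_C_Fuchsian K (Gam ?z)"
    using nvc C_Fuchsian_Gam[OF hz] by (simp add: nonelementary_C_Fuchsian_def)
  have max: "\<Gamma>' = Gam ?z" if \<Gamma>': "nonelementary_C_Fuchsian K \<Gamma>'" "Gam ?z \<subseteq> \<Gamma>'" for \<Gamma>'
  proof -
    obtain v where v: "herm v > 0" "\<Gamma>' \<subseteq> Gam v"
      using C_Fuchsian_subgroup \<Gamma>'(1) unfolding nonelementary_C_Fuchsian_def by metis
    have v0: "v \<noteq> 0" using v(1) by (auto simp: herm_def)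
    have eig: "\<exists>l. S *v v = l *s v" if S: "cls S \<in> Gam ?z" for S
    proof -
      have "cls S \<in> Gam v" using S \<Gamma>'(2) v(2) by blast
      then obtain A w where A: "cls S = cls A" "A *v v = w *s v" using GamE by metis
      then obtain t where "S = mat t ** A" by (auto simp: cls_eq_iff)
      then have "S *v v = (t * w) *s v" using A(2) by (simp add: mat_mult_mult_vec)
      then show ?thesis by blast
    qed
    obtain c where c: "c \<noteq> 0" "v = c *s ?z" using eig[OF mem(1)] eig[OF mem(2)] uniq[OF v0] by blast
    have "A *v ?z = ?z" if A: "A *v v = v" for A
    proof -
      have "c *s (A *v ?z) = c *s ?z" using A c(2) by (simp add: vector_scalar_commute)
      then show ?thesis using c(1) by simp
    qed
    then have "Gv v \<subseteq> Gv ?z" unfolding Gv_def by blast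
    then show ?thesis using v(2) \<Gamma>'(2) unfolding Gam_def by blast
  qed
  have fixed: "act g (proj ?z) = proj ?z" if g: "g \<in> Gam ?z" for g
  proof -
    obtain A w where A: "A \<in> carrier SU_h" "g = cls A" "A *v ?z = w *s ?z" using GamE[OF g] by metis
    then show ?thesis using act_cls_fixes_iff[OF A(1) z0] by blast
  qed
  have "{p \<in> P2 K. \<forall>g\<in>Gam ?z. act g p = p} = {proj ?z}"
  proof
    show "{proj ?z} \<subseteq> {p \<in> P2 K. \<forall>g\<in>Gam ?z. act g p = p}"
      using fixed z0 int_vec_fz[of D] OK_imp_K by (auto simp: P2_def int_vec_def)
    show "{p \<in> P2 K. \<forall>g\<in>Gam ?z. act g p = p} \<subseteq> {proj ?z}"
    proof
      fix p assume p: "p \<in> {p \<in> P2 K. \<forall>g\<in>Gam ?z. act g p = p}"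
      then obtain x where x: "p = proj x" "x \<noteq> 0" by (auto simp: P2_def)
      have "act (cls ?S) (proj x) = proj x" "act (cls ?S') (proj x) = proj x" using p mem x(1) by auto
      then obtain l l' where "?S *v x = l *s x" "?S' *v x = l' *s x"
        using act_cls_fixes_iff[OF S(2) x(2)] act_cls_fixes_iff[OF S'(2) x(2)] by blast
      then have "proj x = proj ?z" using uniq[OF x(2)] proj_eq_iff by blast
      then show "p \<in> {proj ?z}" using x(1) by simp
    qed
  qed
  moreover have "relatively_prime K ?z"
  proof -
    \<comment> \<open>A common divisor divides the last coordinate, which is 1.\<close>
    have "\<exists>u\<in>OK. c * u = 1" if h: "\<forall>i. \<exists>w\<in>OK. ?z $ i = c * w" for c
    proof -
      obtain w where "w \<in> OK" "?z $ 3 = c * w" using h by blast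
      then show ?thesis by (intro bexI[of _ w]) (simp_all add: fz_def)
    qed
    then show ?thesis by (simp add: relatively_prime_def)
  qed
  ultimately have "has_discriminant K (Gam ?z) D"
    unfolding has_discriminant_def using int_vec_fz[of D] herm_fz[of D] by (auto simp: int_vec_def)
  then show ?thesis using ne max
    by (auto simp: max_C_Fuchsian_of_discriminant_def maximal_nonelementary_C_Fuchsian_def)
qed

end

section \<open>Finiteness of the number of conjugacy classes\<close>

lemma finite_image_of_label:
  assumes "finite (l ` S)" "\<And>x y. x \<in> S \<Longrightarrow> y \<in> S \<Longrightarrow> l x = l y \<Longrightarrow> f x = f y"
  shows "finite (f ` S)"
proof -
  have "f ` S \<subseteq> (\<lambda>c. f (SOME x. x \<in> S \<and> l x = c)) ` l ` S"
  proof (rule image_subsetI)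
    fix x assume x: "x \<in> S"
    have "(SOME y. y \<in> S \<and> l y = l x) \<in> S \<and> l (SOME y. y \<in> S \<and> l y = l x) = l x"
      by (rule someI[of _ x]) (use x in auto)
    then have "f x = f (SOME y. y \<in> S \<and> l y = l x)" using x by (intro assms(2)) auto
    then show "f x \<in> (\<lambda>c. f (SOME x. x \<in> S \<and> l x = c)) ` l ` S" using x by blast
  qed
  then show ?thesis using assms(1) by (meson finite_imageI finite_subset)
qed

lemma herm_add_scale: "herm (x + of_int k *s y) = herm x + 2 * real_of_int k * Re (hp x y) + (real_of_int k)\<^sup>2 * herm y"
proof -
  have "hp (x + of_int k *s y) (x + of_int k *s y) = hp x x + of_int k * (hp x y + cnj (hp x y)) + (of_int k * of_int k) * hp y y"
    by (simp add: cnj_hp algebra_simps)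
  moreover have "Re (hp y x) = Re (hp x y)" by (subst cnj_hp[symmetric]) simp
  ultimately show ?thesis unfolding herm_eq_Re by (simp add: power2_eq_square algebra_simps)
qed

text \<open>The vector is D times the projection to the complement of z; the factor D = h(z) clears
  the denominator and keeps integral vectors integral.\<close>

lemma herm_orthogonal_projection:
  assumes "herm z = real D"
  defines "x \<equiv> \<lambda>w. of_nat D *s w - hp w z *s z"
  shows "hp (x w) z = 0" "herm (x w) = real D * (real D * herm w - (cmod (hp w z))\<^sup>2)"
proof -
  have zz: "hp z z = of_nat D" using assms by (simp add: hp_self)
  show o: "hp (x w) z = 0" by (simp add: x_def zz)
  have zx: "hp z (x w) = 0" using o by (metis cnj_hp complex_cnj_zero)
  have "hp (x w) (x w) = hp (x w) (of_nat D *s w) - hp (x w) (hp w z *s z)" by (simp add: x_def)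
  also have "\<dots> = of_nat D * hp (x w) w" by (simp add: o)
  also have "hp (x w) w = of_nat D * hp w w - hp w z * hp z w" by (simp add: x_def)
  also have "hp w z * hp z w = of_real ((cmod (hp w z))\<^sup>2)" by (metis cnj_hp complex_norm_square)
  finally have "hp (x w) (x w) = complex_of_real (real D * (real D * herm w - (cmod (hp w z))\<^sup>2))" by (simp add: hp_self)
  then show "herm (x w) = real D * (real D * herm w - (cmod (hp w z))\<^sup>2)" by (simp only: herm_eq_Re Re_complex_of_real)
qed

context imaginary_quadratic
begin

lemma int_vec_axis: "int_vec (axis i 1)"
  by (simp add: int_vec_def axis_def)

lemma int_vec_of_hp_axis: assumes "\<And>i. hp (axis i 1) y \<in> OK" shows "int_vec y"
proof -
  have "cnj (hp (axis i 1) y) \<in> OK" for i using assms by blast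
  from this[of 1] this[of 2] this[of 3] have "- y $ 3 \<in> OK" "y $ 2 \<in> OK" "- y $ 1 \<in> OK"
    by (simp_all add: hp_axis)
  then have "y $ 3 \<in> OK" "y $ 2 \<in> OK" "y $ 1 \<in> OK" using OK_minus by fastforce+
  then show ?thesis by (simp add: int_vec_def forall_3)
qed

text \<open>The values \<open>\<langle>w, y\<rangle>\<close> for integral \<open>w\<close> form an ideal, and its rescaling is the argument proving that the
  class number is finite.\<close>

lemma rescale_functional:
  assumes DP: "\<And>\<theta>. \<exists>j\<in>{1..N0::nat}. \<exists>\<beta>\<in>OK. (cmod (of_nat j * \<theta> - \<beta>))\<^sup>2 \<le> 1/2"
    and y: "int_vec y" "y \<noteq> 0"
  obtains w c where "int_vec w" "c \<noteq> 0" "int_vec (c *s y)" "hp w (c *s y) = of_nat (fact N0)"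
proof -
  define P where "P w \<longleftrightarrow> int_vec w \<and> hp w y \<noteq> 0" for w
  \<comment> \<open>Squared moduli of elements of \<open>OK\<close> are natural numbers, so a
    nonzero value \<langle>w, y\<rangle> of least modulus exists.\<close>
  define f where "f w = nat \<lfloor>(cmod (hp w y))\<^sup>2\<rfloor>" for w
  have ex: "\<exists>w. P w"
  proof (rule ccontr)
    assume "\<nexists>w. P w"
    then have "hp (axis i 1) y = 0" for i using int_vec_axis by (auto simp: P_def)
    from this[of 1] this[of 2] this[of 3] have "y = 0" by (simp add: hp_axis vec_eq_iff forall_3)
    then show False using y by simp
  qed
  then obtain w where w: "P w" "\<And>w'. P w' \<Longrightarrow> f w \<le> f w'" using ex_has_least_nat[of P _ f] by blast
  have fi: "real (f w) = (cmod (hp w y))\<^sup>2" if w: "int_vec w" for w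
  proof -
    have "(cmod (hp w y))\<^sup>2 \<in> \<int>" using OK_norm_Ints(1)[OF hp_OK[OF w y(1)]] .
    then obtain i where i: "(cmod (hp w y))\<^sup>2 = of_int i" by (auto elim: Ints_cases)
    then have "i \<ge> 0" by (metis of_int_0_le_iff zero_le_power2)
    then show ?thesis by (simp add: f_def i)
  qed
  have wi: "int_vec w" using w(1) by (simp add: P_def)
  define \<mu> where "\<mu> = hp w y"
  have \<mu>: "\<mu> \<noteq> 0" using w(1) by (simp add: \<mu>_def P_def)
  have int: "of_nat (fact N0) / \<mu> * hp w' y \<in> OK" if w': "int_vec w'" for w'
  proof -
    obtain j \<beta> where j: "j \<in> {1..N0}" "\<beta> \<in> OK" "(cmod (of_nat j * (hp w' y / \<mu>) - \<beta>))\<^sup>2 \<le> 1/2" using DP by blast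
    define v where "v = of_nat j *s w' - \<beta> *s w"
    have vi: "int_vec v" unfolding v_def by (intro int_vec_diff int_vec_scale w' wi j(2) OK_of_nat)
    have hv: "hp v y = (of_nat j * (hp w' y / \<mu>) - \<beta>) * \<mu>" using \<mu> by (simp add: v_def \<mu>_def field_simps)
    \<comment> \<open>The squared modulus of this value is at most half of the least nonzero
      one.\<close>
    have "hp v y = 0"
    proof (rule ccontr)
      assume "hp v y \<noteq> 0"
      then have "f w \<le> f v" using w(2) vi by (simp add: P_def)
      then have "real (f w) \<le> real (f v)" by simp
      then have "(cmod \<mu>)\<^sup>2 \<le> (cmod (hp v y))\<^sup>2" using fi[OF wi] fi[OF vi] unfolding \<mu>_def by linarith
      also have "\<dots> = (cmod (of_nat j * (hp w' y / \<mu>) - \<beta>))\<^sup>2 * (cmod \<mu>)\<^sup>2" by (simp add: hv norm_mult power_mult_distrib)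
      also have "\<dots> \<le> 1/2 * (cmod \<mu>)\<^sup>2" using j(3) by (rule mult_right_mono) simp
      finally show False using \<mu> by simp
    qed
    then have e: "of_nat j * (hp w' y / \<mu>) = \<beta>" using hv \<mu> by simp
    \<comment> \<open>The multiplier depends on w', and the factorial is a common multiple of all
      multipliers that the approximation can return.\<close>
    have "j dvd fact N0" using j(1) by (intro dvd_fact) auto
    then obtain k where k: "fact N0 = j * k" by (auto simp: dvd_def)
    have "of_nat (fact N0) / \<mu> * hp w' y = of_nat k * (of_nat j * (hp w' y / \<mu>))" by (simp add: k)
    also have "\<dots> = of_nat k * \<beta>" by (simp only: e)
    finally show ?thesis using j(2) by simp
  qed
  define c where "c = cnj (of_nat (fact N0) / \<mu>)"
  have c: "hp w' (c *s y) = of_nat (fact N0) / \<mu> * hp w' y" for w' by (simp add: c_def)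
  have "int_vec (c *s y)" by (rule int_vec_of_hp_axis) (use int[OF int_vec_axis] c in simp)
  moreover have "hp w (c *s y) = of_nat (fact N0)" unfolding c using \<mu> by (simp add: \<mu>_def)
  moreover have "c \<noteq> 0" using \<mu> by (simp add: c_def)
  ultimately show ?thesis using that wi by blast
qed

text \<open>If the lattice orthogonal to \<open>z\<close> contains an isotropic vector, then adding multiples of a rescaled one
  reduces the norm modulo a bounded number. Otherwise a vector \<open>x\<close> of minimal norm is compared with
  \<open>j w - \<beta> x\<close>, as in Hermite reduction, the Dirichlet approximation replacing Euclidean division.\<close>

lemma short_orthogonal_vector:
  assumes D: "D > 0"
  obtains C :: nat where
    "\<And>z. int_vec z \<Longrightarrow> herm z = real D \<Longrightarrow> \<exists>x. int_vec x \<and> hp z x = 0 \<and> herm x \<noteq> 0 \<and> \<bar>herm x\<bar> \<le> real C"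
proof -
  obtain N0 :: nat where N0: "N0 > 0" and DP: "\<And>\<theta>. \<exists>j\<in>{1..N0}. \<exists>\<beta>\<in>OK. (cmod (of_nat j * \<theta> - \<beta>))\<^sup>2 \<le> 1/2"
    using Dirichlet_approx_OK by blast
  define N :: nat where "N = fact N0"
  have N: "N > 0" by (simp add: N_def)
  \<comment> \<open>The first summand bounds the isotropic case, the second one the anisotropic
    case.\<close>
  define C where "C = 2 * D * D * N + 2 * (N0 * D * N) ^ 2"
  show ?thesis
  proof (rule that[of C])
    fix z assume z: "int_vec z" "herm z = real D"
    have zz: "hp z z = of_nat D" using z by (simp add: hp_self)
    have sym: "hp z x = 0" if "hp x z = 0" for x using that by (metis cnj_hp complex_cnj_zero)
    define \<pi> where "\<pi> w = of_nat D *s w - hp w z *s z" for w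
    note \<pi> = herm_orthogonal_projection[OF z(2), folded \<pi>_def]
    have \<pi>i: "int_vec (\<pi> w)" if "int_vec w" for w
      unfolding \<pi>_def by (intro int_vec_diff int_vec_scale z(1) that hp_OK OK_of_nat)
    show "\<exists>x. int_vec x \<and> hp z x = 0 \<and> herm x \<noteq> 0 \<and> \<bar>herm x\<bar> \<le> real C"
    proof (cases "\<exists>n. int_vec n \<and> n \<noteq> 0 \<and> hp n z = 0 \<and> herm n = 0")
      case True
      then obtain n where n: "int_vec n" "n \<noteq> 0" "hp n z = 0" "herm n = 0" by blast
      obtain w c where w: "int_vec w" "c \<noteq> 0" "int_vec (c *s n)" "hp w (c *s n) = of_nat N"
        using rescale_functional[OF DP n(1,2), folded N_def] .
      define F where "F = real D * herm w - (cmod (hp w z))\<^sup>2"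
      define m where "m = 2 * real D * real N"
      have m: "m > 0" using D N by (simp add: m_def)
      \<comment> \<open>Adding the rescaled isotropic vector once to w changes F by m. This k moves
        F into the half-open interval from 0, excluded, to m, included, so the resulting norm is
        nonzero as well as bounded.\<close>
      define k where "k = \<lfloor>- F / m\<rfloor> + 1"
      have k1: "- F / m < of_int k" "of_int k \<le> - F / m + 1" unfolding k_def by linarith+
      have "F + m * of_int k > 0" using k1(1) m by (simp add: field_simps)
      moreover have "m * of_int k \<le> m * (- F / m + 1)" using k1(2) m by (intro mult_left_mono) auto
      then have "F + m * of_int k \<le> m" using m by (simp add: algebra_simps)
      ultimately have Fk: "0 < F + m * of_int k" "F + m * of_int k \<le> m" by auto
      define v where "v = w + of_int k *s (c *s n)"
      have vi: "int_vec v" unfolding v_def by (intro int_vec_add int_vec_scale w OK_of_int)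
      have "herm v = herm w + 2 * of_int k * real N"
        unfolding v_def herm_add_scale w(4) by (simp add: herm_scale n(4))
      moreover have "hp v z = hp w z" by (simp add: v_def n(3))
      ultimately have "real D * herm v - (cmod (hp v z))\<^sup>2 = F + m * of_int k" by (simp add: F_def m_def algebra_simps)
      then have hv: "herm (\<pi> v) = real D * (F + m * of_int k)" by (simp only: \<pi>(2))
      have "real D * (F + m * of_int k) > 0" using D Fk by simp
      moreover have "real D * (F + m * of_int k) \<le> real D * m" using D Fk by simp
      moreover have "real D * m = real (2 * D * D * N)" by (simp add: m_def)
      moreover have "real (2 * D * D * N) \<le> real C" unfolding C_def of_nat_le_iff by simp
      ultimately have "herm (\<pi> v) \<noteq> 0" "\<bar>herm (\<pi> v)\<bar> \<le> real C" unfolding hv by linarith+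
      then show ?thesis using \<pi>i[OF vi] sym[OF \<pi>(1)] by blast
    next
      case False
      define P where "P x \<longleftrightarrow> int_vec x \<and> x \<noteq> 0 \<and> hp x z = 0" for x
      have Pn: "herm x \<noteq> 0" if "P x" for x using False that by (auto simp: P_def)
      define f where "f x = nat \<lfloor>\<bar>herm x\<bar>\<rfloor>" for x
      have fi: "real (f x) = \<bar>herm x\<bar>" if x: "P x" for x
      proof -
        have "herm x \<in> \<int>" using herm_Ints x by (simp add: P_def)
        then obtain i where "herm x = of_int i" by (auto elim: Ints_cases)
        then show ?thesis by (simp add: f_def)
      qed
      have ex: "\<exists>x. P x"
      proof -
        \<comment> \<open>A vector of norm -2: its cross product with the positive vector z has norm
          at least 2 D and is therefore nonzero.\<close>
        define a :: "complex^3" where "a = vector [1, 0, 1]"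
        have "herm a = -2" by (simp add: a_def herm_def)
        then have "herm (cr z a) > 0" using D z(2) by (simp add: herm_cr add_nonneg_pos)
        then have "cr z a \<noteq> 0" by (auto simp: herm_def)
        moreover have "int_vec (cr z a)" by (rule int_vec_cr[OF z(1)]) (simp add: int_vec_def forall_3 a_def)
        moreover have "hp (cr z a) z = 0" by (metis cnj_hp complex_cnj_zero hp_cr_0(1))
        ultimately show ?thesis by (auto simp: P_def)
      qed
      obtain x where x: "P x" "\<And>x'. P x' \<Longrightarrow> f x \<le> f x'" using ex ex_has_least_nat[of P _ f] by blast
      have min: "\<bar>herm x\<bar> \<le> \<bar>herm x'\<bar>" if "P x'" for x'
        using x(2)[OF that] fi[OF x(1)] fi[OF that] by linarith
      have xi: "int_vec x" "hp x z = 0" using x(1) by (auto simp: P_def)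
      define m where "m = \<bar>herm x\<bar>"
      have m1: "m \<ge> 1"
      proof -
        have "m = real (f x)" "m \<noteq> 0" using fi[OF x(1)] Pn[OF x(1)] by (auto simp: m_def)
        then show ?thesis by simp
      qed
      define y where "y = cr z x"
      have yi: "int_vec y" unfolding y_def by (rule int_vec_cr[OF z(1) xi(1)])
      have zy: "hp z y = 0" "hp x y = 0" by (simp_all add: y_def)
      have hy: "herm y = - real D * herm x" by (simp add: y_def herm_cr z(2) sym[OF xi(2)])
      then have "herm y \<noteq> 0" using D Pn[OF x(1)] by simp
      then have y0: "y \<noteq> 0" by (auto simp: herm_def)
      obtain w c where w: "int_vec w" "c \<noteq> 0" "int_vec (c *s y)" "hp w (c *s y) = of_nat N"
        using rescale_functional[OF DP yi y0, folded N_def] .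
      define y' where "y' = c *s y"
      have y'o: "hp z y' = 0" "hp x y' = 0" "hp y' z = 0" "hp y' x = 0"
        using zy by (simp_all add: y'_def) (metis cnj_hp complex_cnj_zero)+
      have y'0: "y' \<noteq> 0" using y0 w(2) by (simp add: y'_def)
      have Py: "P y'" using w(3) y'o y'0 by (simp add: P_def y'_def)
      have "hp w y' = of_nat N" using w(4) by (simp only: y'_def)
      then have wy: "hp (\<pi> w) y' = of_nat (D * N)" using y'o by (simp add: \<pi>_def)
      obtain j \<beta> where j: "j \<in> {1..N0}" "\<beta> \<in> OK" "(cmod (of_nat j * (hp (\<pi> w) x / hp x x) - \<beta>))\<^sup>2 \<le> 1/2" using DP by blast
      define \<delta> where "\<delta> = of_nat j * (hp (\<pi> w) x / hp x x) - \<beta>"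
      \<comment> \<open>The component along x is reduced to \<delta> with |\<delta>|^2 \<le> 1/2,
        while the nonzero pairing j D N with y' keeps v nonzero. By minimality of m = |h(x)| both
        |h(v)| and |h(y')| are at least m, and expansion of h(v) gives m \<le> m/2 + (N0 D N)^2 /
        m.\<close>
      define v where "v = of_nat j *s \<pi> w - \<beta> *s x"
      have vi: "int_vec v" unfolding v_def by (intro int_vec_diff int_vec_scale \<pi>i w(1) xi j(2) OK_of_nat)
      have vz: "hp v z = 0" by (simp add: v_def \<pi>(1) xi(2))
      have vy: "hp v y' = of_nat (j * D * N)" by (simp add: v_def wy y'o)
      have xx: "hp x x \<noteq> 0" using Pn[OF x(1)] by (simp add: hp_self)
      have vx: "hp v x / hp x x = \<delta>" using xx by (simp add: v_def \<delta>_def field_simps)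
      have "v \<noteq> 0" using vy j(1) D N by auto
      then have Pv: "P v" using vi vz by (simp add: P_def)
      have yy: "hp y' y' \<noteq> 0" using Pn[OF Py] by (simp add: hp_self)
      define \<eta> where "\<eta> = hp v y' / hp y' y'"
      have "v = (hp v x / hp x x) *s x + (hp v y' / hp y' y') *s y' + (hp v z / hp z z) *s z"
        by (rule orthogonal_expansion) (use y'o xi xx yy zz D in auto)
      then have v: "v = \<delta> *s x + \<eta> *s y'" by (simp add: vx \<eta>_def vz)
      have "hp v v = \<delta> * cnj \<delta> * hp x x + \<eta> * cnj \<eta> * hp y' y'" unfolding v by (simp add: y'o algebra_simps)
      also have "\<dots> = complex_of_real ((cmod \<delta>)\<^sup>2 * herm x + (cmod \<eta>)\<^sup>2 * herm y')" unfolding hp_self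
        by (simp add: complex_norm_square[symmetric])
      finally have "herm v = (cmod \<delta>)\<^sup>2 * herm x + (cmod \<eta>)\<^sup>2 * herm y'" by (simp only: herm_eq_Re Re_complex_of_real)
      then have "\<bar>herm v\<bar> \<le> \<bar>(cmod \<delta>)\<^sup>2 * herm x\<bar> + \<bar>(cmod \<eta>)\<^sup>2 * herm y'\<bar>" by linarith
      also have "\<bar>(cmod \<delta>)\<^sup>2 * herm x\<bar> = (cmod \<delta>)\<^sup>2 * m" by (simp add: abs_mult m_def)
      also have "(cmod \<delta>)\<^sup>2 * m \<le> 1/2 * m" using j(3) m1 unfolding \<delta>_def by (intro mult_right_mono) auto
      also have "\<bar>(cmod \<eta>)\<^sup>2 * herm y'\<bar> = (real (j * D * N))\<^sup>2 / \<bar>herm y'\<bar>"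
      proof -
        have "cmod \<eta> = real (j * D * N) / \<bar>herm y'\<bar>" unfolding \<eta>_def vy hp_self norm_divide norm_of_real norm_of_nat by simp
        then show ?thesis using Pn[OF Py] by (simp add: abs_mult power_divide power2_eq_square)
      qed
      also have "(real (j * D * N))\<^sup>2 / \<bar>herm y'\<bar> \<le> (real (N0 * D * N))\<^sup>2 / m"
      proof (rule frac_le)
        have "j * D * N \<le> N0 * D * N" using j(1) by (intro mult_right_mono) auto
        then show "(real (j * D * N))\<^sup>2 \<le> (real (N0 * D * N))\<^sup>2" by (intro power_mono) (simp_all only: of_nat_le_iff of_nat_0_le_iff)
        show "m \<le> \<bar>herm y'\<bar>" using min[OF Py] by (simp add: m_def)
      qed (use m1 in auto)
      finally have "m \<le> 1/2 * m + (real (N0 * D * N))\<^sup>2 / m" using min[OF Pv] by (simp add: m_def)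
      then have "m / 2 * m \<le> (real (N0 * D * N))\<^sup>2" using m1 by (simp add: field_simps)
      moreover have "m \<le> m * m" using mult_left_mono[of 1 m m] m1 by simp
      ultimately have "m \<le> 2 * (real (N0 * D * N))\<^sup>2" by (simp add: field_simps)
      also have "\<dots> = real (2 * (N0 * D * N) ^ 2)" by simp
      also have "\<dots> \<le> real C" unfolding C_def of_nat_le_iff by simp
      finally have "\<bar>herm x\<bar> \<le> real C" by (simp add: m_def)
      then show ?thesis using xi sym Pn[OF x(1)] by blast
    qed
  qed
qed

text \<open>Frames \<open>(z, x, cr z x)\<close> with the same norms that agree modulo a multiple of these norms differ by an
  integral isometry of determinant one.\<close>

lemma finitely_many_orbits:
  assumes D: "D > 0"
  obtains lab :: "complex^3 \<Rightarrow> real \<times> ((int \<times> int)^3^3)" where "finite (lab ` {z. int_vec z \<and> herm z = real D})"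
    "\<And>z z'. int_vec z \<Longrightarrow> herm z = real D \<Longrightarrow> int_vec z' \<Longrightarrow> herm z' = real D \<Longrightarrow> lab z = lab z' \<Longrightarrow>
       \<exists>g. g \<in> carrier SU_h \<and> int_mat g \<and> g *v z = z'"
proof -
  obtain C :: nat where C: "\<And>z. int_vec z \<Longrightarrow> herm z = real D \<Longrightarrow>
      \<exists>x. int_vec x \<and> hp z x = 0 \<and> herm x \<noteq> 0 \<and> \<bar>herm x\<bar> \<le> real C"
    using short_orthogonal_vector[OF D] by blast
  define Z where "Z = {z. int_vec z \<and> herm z = real D}"
  have "\<forall>z\<in>Z. \<exists>x. int_vec x \<and> hp z x = 0 \<and> herm x \<noteq> 0 \<and> \<bar>herm x\<bar> \<le> real C" using C by (auto simp: Z_def)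
  then obtain x where x: "\<And>z. z \<in> Z \<Longrightarrow> int_vec (x z) \<and> hp z (x z) = 0 \<and> herm (x z) \<noteq> 0 \<and> \<bar>herm (x z)\<bar> \<le> real C"
    by metis
  define y where "y z = cr z (x z)" for z
  define B :: "complex^3 \<Rightarrow> complex^3^3" where "B z = transpose (vector [z, x z, y z])" for z
  have Bv: "B z *v u = u $ 1 *s z + u $ 2 *s x z + u $ 3 *s y z" for z u
    by (simp add: B_def vec_eq_iff matrix_vector_mult_3 transpose_def)
  have hy: "herm (y z) = - real D * herm (x z)" if z: "z \<in> Z" for z
    using x[OF z] z by (simp add: y_def herm_cr Z_def)
  have Bint: "int_mat (B z)" if z: "z \<in> Z" for z
  proof -
    have "int_vec z" "int_vec (x z)" "int_vec (y z)" using x[OF z] z int_vec_cr by (auto simp: y_def Z_def)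
    then have "\<forall>i j. B z $ i $ j \<in> OK" unfolding forall_3 B_def transpose_def int_vec_def by simp
    then show ?thesis by (simp add: int_mat_def)
  qed
  have orth: "hp z (x z) = 0" "hp z (y z) = 0" "hp (x z) (y z) = 0" "hp (x z) z = 0" "hp (y z) z = 0" "hp (y z) (x z) = 0"
    if z: "z \<in> Z" for z
  proof -
    show "hp z (x z) = 0" "hp z (y z) = 0" "hp (x z) (y z) = 0" using x[OF z] by (simp_all add: y_def)
    then show "hp (x z) z = 0" "hp (y z) z = 0" "hp (y z) (x z) = 0" by (metis cnj_hp complex_cnj_zero)+
  qed
  have hB: "hp (B z *v u) (B z *v u) = of_nat D * (u $ 1 * cnj (u $ 1)) + of_real (herm (x z)) * (u $ 2 * cnj (u $ 2))
      + of_real (- real D * herm (x z)) * (u $ 3 * cnj (u $ 3))" if z: "z \<in> Z" for z u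
  proof -
    have "hp z z = of_nat D" using z by (simp add: hp_self Z_def)
    then show ?thesis unfolding Bv hy[OF z, symmetric] using orth[OF z] by (simp add: hp_self[of "x z"] hp_self[of "y z"] algebra_simps)
  qed
  have detB: "det (B z) = of_real (- real D * herm (x z))" if z: "z \<in> Z" for z
  proof -
    have "det (B z) = det (vector [z, x z, y z] :: complex^3^3)" by (simp add: B_def)
    also have "\<dots> = det (vector [y z, z, x z] :: complex^3^3)" by (simp add: det_3 algebra_simps)
    also have "\<dots> = hp (y z) (y z)" unfolding hp_cr[symmetric] y_def ..
    finally show ?thesis by (simp add: hp_self hy[OF z])
  qed
  \<comment> \<open>A common multiple of the three norms D, h(x) and -D h(x) of any frame, as 0 <
    |h(x)| \<le> C.\<close>
  define M where "M = D * fact C"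
  have M: "M > 0" using D by (simp add: M_def)
  obtain lab :: "complex^3^3 \<Rightarrow> (int \<times> int)^3^3" where lab: "finite (range lab)"
    "\<And>A B. int_mat A \<Longrightarrow> int_mat B \<Longrightarrow> lab A = lab B \<Longrightarrow> \<exists>W. int_mat W \<and> A = B + mat (of_nat M) ** W"
    using matrix_residue_label[OF M] by blast
  \<comment> \<open>The inverse of \<open>B z\<close>: by orthogonality its rows are the pairings
    with the frame vectors divided by their norms, so \<open>M\<close> clears all
    denominators.\<close>
  define E :: "complex^3 \<Rightarrow> complex^3^3" where
    "E z = vector [\<chi> j. hp (axis j 1) z / of_nat D, \<chi> j. hp (axis j 1) (x z) / of_real (herm (x z)),
             \<chi> j. hp (axis j 1) (y z) / of_real (herm (y z))]" for z
  have lin: "(\<Sum>j\<in>UNIV. hp (axis j 1) b * u $ j / c) = hp u b / c" for b c u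
  proof -
    have "(\<Sum>j\<in>UNIV. hp (axis j 1) b * u $ j / c) = (hp (axis 1 1) b * u $ 1 + hp (axis 2 1) b * u $ 2 + hp (axis 3 1) b * u $ 3) / c"
      by (simp add: sum_3 add_divide_distrib)
    also have "\<dots> = hp u b / c" unfolding hp_axis by (simp add: hp_def algebra_simps)
    finally show ?thesis .
  qed
  have Ev: "(E z *v u) $ 1 = hp u z / of_nat D" "(E z *v u) $ 2 = hp u (x z) / of_real (herm (x z))"
    "(E z *v u) $ 3 = hp u (y z) / of_real (herm (y z))" for z u
    by (simp_all add: E_def matrix_vector_mult_def lin)
  have BE: "B z ** E z = mat 1" if z: "z \<in> Z" for z
  proof -
    have "B z *v (E z *v u) = u" for u
    proof -
      have "hp z z = of_nat D" using z by (simp add: hp_self Z_def)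
      moreover have "u = (hp u z / hp z z) *s z + (hp u (x z) / hp (x z) (x z)) *s x z + (hp u (y z) / hp (y z) (y z)) *s y z"
        by (rule orthogonal_expansion) (use orth[OF z] x[OF z] hy[OF z] D calculation in \<open>auto simp: hp_self[of "x z"] hp_self[of "y z"]\<close>)
      ultimately show ?thesis unfolding Bv Ev hp_self by simp
    qed
    then show ?thesis by (simp add: matrix_eq matrix_vector_mul_assoc)
  qed
  have EB: "E z ** B z = mat 1" if "z \<in> Z" for z using BE[OF that] by (simp add: matrix_left_right_inverse)
  have ME: "int_mat (mat (of_nat M) ** E z)" if z: "z \<in> Z" for z
  proof -
    obtain i :: int where i: "herm (x z) = of_int i" using herm_Ints x[OF z] by (meson Ints_cases)
    have i0: "i \<noteq> 0" using x[OF z] i by auto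
    have "\<bar>i\<bar> \<le> int C" using x[OF z] unfolding i by linarith
    then have "nat \<bar>i\<bar> dvd fact C" using i0 by (intro dvd_fact) auto
    then obtain k where k: "fact C = nat \<bar>i\<bar> * k" by (auto simp: dvd_def)
    obtain t :: int where t: "int (fact C) = i * t"
    proof -
      have "i dvd int (fact C)" unfolding k using i0 by (simp add: dvd_mult2)
      then show ?thesis using that by (auto simp: dvd_def)
    qed
    have ct: "of_nat (fact C) = complex_of_int i * of_int t" using arg_cong[OF t, of complex_of_int] by simp
    have D0: "complex_of_nat D \<noteq> 0" "complex_of_int i \<noteq> 0" using D i0 by auto
    have 1: "of_nat M * (h / of_nat D) = of_nat (fact C) * h" for h :: complex using D0 by (simp add: M_def)
    have 2: "of_nat M * (h / of_real (herm (x z))) = of_nat D * of_int t * h" for h :: complex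
      using D0 by (simp add: M_def i ct del: of_nat_fact)
    have 3: "of_nat M * (h / of_real (herm (y z))) = - of_int t * h" for h :: complex
      using D0 by (simp add: M_def hy[OF z] i ct del: of_nat_fact)
    have v: "int_vec z" "int_vec (x z)" "int_vec (y z)" using x[OF z] z int_vec_cr by (auto simp: y_def Z_def)
    have O: "hp (axis j 1) z \<in> OK" "hp (axis j 1) (x z) \<in> OK" "hp (axis j 1) (y z) \<in> OK" for j
      using v by (auto intro: hp_OK int_vec_axis)
    have "\<forall>i j. (mat (of_nat M) ** E z) $ i $ j \<in> OK"
    proof (unfold forall_3[of "\<lambda>i. \<forall>j. _ i j"], intro conjI allI)
      fix j
      show "(mat (of_nat M) ** E z) $ 1 $ j \<in> OK" unfolding mat_mult_nth using O(1)[of j] by (simp add: E_def 1 del: times_divide_eq_right of_nat_fact)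
      show "(mat (of_nat M) ** E z) $ 2 $ j \<in> OK" unfolding mat_mult_nth using O(2)[of j] by (simp add: E_def 2 del: times_divide_eq_right)
      show "(mat (of_nat M) ** E z) $ 3 $ j \<in> OK" unfolding mat_mult_nth using O(3)[of j] OK_minus[OF OK_of_int[of t]] by (simp add: E_def 3 del: times_divide_eq_right)
    qed
    then show ?thesis by (simp add: int_mat_def)
  qed
  \<comment> \<open>The norm of \<open>x z\<close> is part of the label: it makes the two frames
    have equal norms and equal determinants, so the matrix carrying one to the other is an isometry
    of determinant one.\<close>
  define L where "L z = (herm (x z), lab (B z))" for z
  show ?thesis
  proof (rule that[of L])
    have "L ` Z \<subseteq> real_of_int ` {- int C..int C} \<times> range lab"
    proof (rule image_subsetI)
      fix z assume z: "z \<in> Z"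
      obtain i :: int where i: "herm (x z) = of_int i" using herm_Ints x[OF z] by (meson Ints_cases)
      have "\<bar>i\<bar> \<le> int C" using x[OF z] unfolding i by linarith
      then have "i \<in> {- int C..int C}" by auto
      then show "L z \<in> real_of_int ` {- int C..int C} \<times> range lab" unfolding L_def i by blast
    qed
    then have "finite (L ` Z)" by (rule finite_subset) (simp add: lab(1))
    then show "finite (L ` {z. int_vec z \<and> herm z = real D})" by (simp add: Z_def)
    fix z z' assume "int_vec z" "herm z = real D" "int_vec z'" "herm z' = real D" and L: "L z = L z'"
    then have z: "z \<in> Z" "z' \<in> Z" by (auto simp: Z_def)
    have h: "herm (x z) = herm (x z')" and l: "lab (B z') = lab (B z)" using L by (auto simp: L_def)
    obtain W where W: "int_mat W" "B z' = B z + mat (of_nat M) ** W" using lab(2)[OF Bint[OF z(2)] Bint[OF z(1)] l] by blast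
    define g where "g = B z' ** E z"
    \<comment> \<open>The congruence modulo \<open>M\<close> of the frames absorbs the denominators
      of \<open>E z\<close>.\<close>
    have "g = mat 1 + W ** (mat (of_nat M) ** E z)"
      unfolding g_def W(2) by (simp add: matrix_add_rdistrib3 BE[OF z(1)] mat_pull[of W] flip: matrix_mul_assoc)
    then have "int_mat g" using int_mat_add[OF int_mat_1] int_mat_mult W(1) ME[OF z(1)] by simp
    have gB: "g *v (B z *v u) = B z' *v u" for u
    proof -
      have "g ** B z = B z'" by (simp add: g_def EB[OF z(1)] flip: matrix_mul_assoc)
      then show ?thesis by (simp add: matrix_vector_mul_assoc)
    qed
    have iso: "herm (g *v w) = herm w" for w
    proof -
      have w: "w = B z *v (E z *v w)" by (simp add: matrix_vector_mul_assoc BE[OF z(1)])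
      have "hp (g *v w) (g *v w) = hp w w" by (subst (1 2 3 4) w) (simp only: gB hB[OF z(1)] hB[OF z(2)] h)
      then show ?thesis by (simp add: herm_eq_Re)
    qed
    have "det g * det (B z) = det (B z')"
      by (metis EB[OF z(1)] det_mul g_def matrix_mul_assoc matrix_mul_rid)
    then have "det g = 1" using detB[OF z(1)] detB[OF z(2)] h x[OF z(2)] D by simp
    moreover have "g *v z = z'" using gB[of "axis 1 1"] unfolding Bv by (simp add: axis_def)
    ultimately show "\<exists>g. g \<in> carrier SU_h \<and> int_mat g \<and> g *v z = z'"
      using iso \<open>int_mat g\<close> by (auto simp: carrier_SU_h)
  qed
qed

section \<open>From orbits of vectors to conjugacy classes of subgroups\<close>

lemma conjugate_Gam_subset:
  assumes g: "g \<in> carrier SU_h" "int_mat g"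
  shows "conjugate PSU_h (cls g) (Gam z) \<subseteq> Gam (g *v z)"
proof
  fix x assume "x \<in> conjugate PSU_h (cls g) (Gam z)"
  then obtain a where a: "a \<in> Gam z" "x = cls g \<otimes>\<^bsub>PSU_h\<^esub> a \<otimes>\<^bsub>PSU_h\<^esub> inv\<^bsub>PSU_h\<^esub> cls g" by (auto simp: conjugate_def)
  obtain A w where A: "A \<in> carrier SU_h" "int_mat A" "a = cls A" "w ^ 3 = 1" "A *v z = w *s z" using GamE[OF a(1)] .
  have x: "x = cls ((g ** A) ** hadj g)" unfolding a(2) A(3) using g A(1) SU_h_mult SU_h_hadj(1) by (simp add: cls_inv cls_mult)
  have "((g ** A) ** hadj g) *v (g *v z) = g *v (A *v ((hadj g ** g) *v z))" by (simp add: matrix_vector_mul_assoc matrix_mul_assoc)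
  also have "\<dots> = w *s (g *v z)" using SU_h_hadj(2)[OF g(1)] by (simp add: A(5) vector_scalar_commute)
  finally have "((g ** A) ** hadj g) *v (g *v z) = w *s (g *v z)" .
  then show "x \<in> Gam (g *v z)" unfolding x
    using g A SU_h_mult SU_h_hadj(1) int_mat_mult int_mat_hadj by (intro GamI[where w = w]) auto
qed

text \<open>The second inclusion is the first one applied to the inverse \<open>hadj g\<close>,
  which is again integral.\<close>

lemma conjugate_Gam:
  assumes g: "g \<in> carrier SU_h" "int_mat g"
  shows "conjugate PSU_h (cls g) (Gam z) = Gam (g *v z)"
proof
  interpret group PSU_h by (rule group_PSU_h)
  show "conjugate PSU_h (cls g) (Gam z) \<subseteq> Gam (g *v z)" by (rule conjugate_Gam_subset[OF g])
  show "Gam (g *v z) \<subseteq> conjugate PSU_h (cls g) (Gam z)"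
  proof
    fix x assume x: "x \<in> Gam (g *v z)"
    have xc: "x \<in> carrier PSU_h" "cls g \<in> carrier PSU_h" using x subgroup.subset[OF subgroup_Gam] g by auto
    define a where "a = inv\<^bsub>PSU_h\<^esub> cls g \<otimes>\<^bsub>PSU_h\<^esub> x \<otimes>\<^bsub>PSU_h\<^esub> cls g"
    have "a = cls (hadj g) \<otimes>\<^bsub>PSU_h\<^esub> x \<otimes>\<^bsub>PSU_h\<^esub> inv\<^bsub>PSU_h\<^esub> cls (hadj g)"
      unfolding a_def using xc(2) g(1) by (simp flip: cls_inv)
    then have "a \<in> conjugate PSU_h (cls (hadj g)) (Gam (g *v z))" using x by (auto simp: conjugate_def)
    then have "a \<in> Gam (hadj g *v (g *v z))" using conjugate_Gam_subset[OF SU_h_hadj(1)[OF g(1)] int_mat_hadj[OF g(2)]] by blast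
    then have "a \<in> Gam z" using SU_h_hadj(2)[OF g(1)] by (simp add: matrix_vector_mul_assoc)
    moreover have "x = cls g \<otimes>\<^bsub>PSU_h\<^esub> a \<otimes>\<^bsub>PSU_h\<^esub> inv\<^bsub>PSU_h\<^esub> cls g"
    proof -
      have "cls g \<otimes>\<^bsub>PSU_h\<^esub> a = x \<otimes>\<^bsub>PSU_h\<^esub> cls g" unfolding a_def using xc by (simp add: m_assoc[symmetric])
      then show ?thesis using xc by (simp add: m_assoc)
    qed
    ultimately show "x \<in> conjugate PSU_h (cls g) (Gam z)" unfolding conjugate_def by blast
  qed
qed

text \<open>Since \<open>Picard K\<close> is a group, g h runs through it together with g, so both
  sides consist of the same conjugates.\<close>

lemma Picard_conjugacy_class_eq:
  assumes "A \<subseteq> carrier PSU_h" "h \<in> Picard K"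
  shows "Picard_conjugacy K `` {conjugate PSU_h h A} = Picard_conjugacy K `` {A}"
proof -
  interpret group PSU_h by (rule group_PSU_h)
  have P: "x \<in> carrier PSU_h" if "x \<in> Picard K" for x using subgroup.mem_carrier[OF subgroup_Picard that] .
  have "conjugate PSU_h g (conjugate PSU_h h A) \<in> Picard_conjugacy K `` {A}" if "g \<in> Picard K" for g
    using conjugate_conjugate[OF assms(1) P[OF that] P[OF assms(2)]] subgroup.m_closed[OF subgroup_Picard that assms(2)]
    by (auto simp: Picard_conjugacy_def)
  moreover have "conjugate PSU_h g A \<in> Picard_conjugacy K `` {conjugate PSU_h h A}" if g: "g \<in> Picard K" for g
  proof -
    have hi: "g \<otimes>\<^bsub>PSU_h\<^esub> inv\<^bsub>PSU_h\<^esub> h \<in> Picard K"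
      using subgroup.m_closed[OF subgroup_Picard g subgroup.m_inv_closed[OF subgroup_Picard assms(2)]] .
    have "conjugate PSU_h (g \<otimes>\<^bsub>PSU_h\<^esub> inv\<^bsub>PSU_h\<^esub> h) (conjugate PSU_h h A) = conjugate PSU_h g A"
      using conjugate_conjugate[OF assms(1) P[OF hi] P[OF assms(2)]] P[OF g] P[OF assms(2)] by (simp add: m_assoc)
    then show ?thesis using hi by (auto simp: Picard_conjugacy_def)
  qed
  ultimately show ?thesis by (auto simp: Picard_conjugacy_def)
qed

lemma max_C_Fuchsian_of_discriminantE:
  assumes "\<Gamma> \<in> max_C_Fuchsian_of_discriminant K D" "D > 0"
  obtains z where "int_vec z" "herm z = real D" "\<Gamma> = Gam z"
proof -
  obtain z where z: "\<forall>i. z $ i \<in> OK" "{p \<in> P2 K. \<forall>g\<in>\<Gamma>. act g p = p} = {proj z}" "herm z = real D"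
    using assms(1) by (auto simp: max_C_Fuchsian_of_discriminant_def has_discriminant_def)
  have "proj z \<in> {p \<in> P2 K. \<forall>g\<in>\<Gamma>. act g p = p}" unfolding z(2) by simp
  then have "\<And>g. g \<in> \<Gamma> \<Longrightarrow> act g (proj z) = proj z" by blast
  moreover have "maximal_nonelementary_C_Fuchsian K \<Gamma>" using assms(1) by (simp add: max_C_Fuchsian_of_discriminant_def)
  ultimately have "\<Gamma> = Gam z" using z(3) assms(2) by (intro maximal_eq_Gam) auto
  then show ?thesis using that z by (auto simp: int_vec_def)
qed

lemma finite_conjugacy_classes:
  assumes D: "D > 0"
  shows "finite (max_C_Fuchsian_of_discriminant K D // Picard_conjugacy K)"
proof -
  define Z where "Z = {z. int_vec z \<and> herm z = real D}"
  obtain lab :: "complex^3 \<Rightarrow> real \<times> ((int \<times> int)^3^3)" where lab: "finite (lab ` {z. int_vec z \<and> herm z = real D})"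
    "\<And>z z'. int_vec z \<Longrightarrow> herm z = real D \<Longrightarrow> int_vec z' \<Longrightarrow> herm z' = real D \<Longrightarrow> lab z = lab z' \<Longrightarrow>
       \<exists>g. g \<in> carrier SU_h \<and> int_mat g \<and> g *v z = z'"
    using finitely_many_orbits[OF D] by blast
  have "finite ((\<lambda>z. Picard_conjugacy K `` {Gam z}) ` Z)"
  proof (rule finite_image_of_label)
    show "finite (lab ` Z)" using lab(1) by (simp add: Z_def)
    fix z z' assume "z \<in> Z" "z' \<in> Z" "lab z = lab z'"
    then obtain g where g: "g \<in> carrier SU_h" "int_mat g" "g *v z = z'" using lab(2) unfolding Z_def by blast
    have "Gam z' = conjugate PSU_h (cls g) (Gam z)" using conjugate_Gam[OF g(1,2)] g(3) by simp
    moreover have "cls g \<in> Picard K" using g by (auto simp: Picard_eq)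
    ultimately show "Picard_conjugacy K `` {Gam z} = Picard_conjugacy K `` {Gam z'}"
      using Picard_conjugacy_class_eq[OF subgroup.subset[OF subgroup_Gam]] by simp
  qed
  moreover have "max_C_Fuchsian_of_discriminant K D // Picard_conjugacy K \<subseteq> (\<lambda>z. Picard_conjugacy K `` {Gam z}) ` Z"
  proof
    fix c assume "c \<in> max_C_Fuchsian_of_discriminant K D // Picard_conjugacy K"
    then obtain \<Gamma> where \<Gamma>: "\<Gamma> \<in> max_C_Fuchsian_of_discriminant K D" "c = Picard_conjugacy K `` {\<Gamma>}" by (auto simp: quotient_def)
    obtain z where "int_vec z" "herm z = real D" "\<Gamma> = Gam z" using max_C_Fuchsian_of_discriminantE[OF \<Gamma>(1) D] .
    then show "c \<in> (\<lambda>z. Picard_conjugacy K `` {Gam z}) ` Z" using \<Gamma>(2) by (auto simp: Z_def)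
  qed
  ultimately show ?thesis by (rule rev_finite_subset)
qed

end

theorem theorem1p1:
  fixes K :: "complex set" and D :: nat
  assumes "imaginary_quadratic_field K" and "D > 0"
  shows "finite (max_C_Fuchsian_of_discriminant K D // Picard_conjugacy K) \<and>
         max_C_Fuchsian_of_discriminant K D // Picard_conjugacy K \<noteq> {} \<and>
         (\<forall>\<Gamma> \<in> max_C_Fuchsian_of_discriminant K D.
            commensurable_up_to_conjugacy PSU_h \<Gamma> (Picard_stab K (2 * D)))"
proof -
  obtain s d where "imaginary_quadratic K s d" using imaginary_quadratic_field_generator[OF assms(1)] .
  then interpret imaginary_quadratic K s d .
  have "max_C_Fuchsian_of_discriminant K D // Picard_conjugacy K \<noteq> {}"
    using Gam_fz_maximal[OF assms(2)] by (auto simp: quotient_def)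
  moreover have "commensurable_up_to_conjugacy PSU_h \<Gamma> (Picard_stab K (2 * D))"
    if \<Gamma>: "\<Gamma> \<in> max_C_Fuchsian_of_discriminant K D" for \<Gamma>
  proof -
    obtain z where "int_vec z" "herm z = real D" "\<Gamma> = Gam z" using max_C_Fuchsian_of_discriminantE[OF \<Gamma> assms(2)] .
    then show ?thesis using commensurable_Gam[OF assms(2)] by simp
  qed
  ultimately show ?thesis using finite_conjugacy_classes[OF assms(2)] by blast
qed

end
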